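(* Let $T$ be $\omega$-categorical and simple, but not supersimple. Then there is a finite tuple $b$ and, for each $i<\omega$, a $\emptyset$-indiscernible sequence $I^i=(b^i_j)_{j<\omega}$ with $b^i_0=b$, such that $I^i\not\equiv I^j$ (i.e. $I^i$ and $I^j$ have different types over $\emptyset$) for all $i\neq j<\omega$. *)

theory Defs
  imports Main "HOL-Library.Countable_Set"
begin

unbundle cardinal_syntax

section \<open>First-order languages, formulas and structures\<close>

record ('f, 'r) lang =
  fun_syms :: "'f set"
  fun_arity :: "'f \<Rightarrow> nat"
  rel_syms :: "'r set"
  rel_arity :: "'r \<Rightarrow> nat"

definition countable_lang :: "('f, 'r) lang \<Rightarrow> bool" where
  "countable_lang L \<longleftrightarrow> countable (fun_syms L) \<and> countable (rel_syms L)"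

datatype 'f tm = Var nat | Fn 'f "'f tm list"

datatype ('f, 'r) fm =
    Eq "'f tm" "'f tm"
  | Rel 'r "'f tm list"
  | Neg "('f, 'r) fm"
  | And "('f, 'r) fm" "('f, 'r) fm"
  | All nat "('f, 'r) fm"

primrec wf_tm :: "('f, 'r) lang \<Rightarrow> 'f tm \<Rightarrow> bool" where
  "wf_tm L (Var v) \<longleftrightarrow> True"
| "wf_tm L (Fn f ts) \<longleftrightarrow>
     f \<in> fun_syms L \<and> length ts = fun_arity L f \<and> list_all (wf_tm L) ts"

primrec wf_fm :: "('f, 'r) lang \<Rightarrow> ('f, 'r) fm \<Rightarrow> bool" where
  "wf_fm L (Eq s t) \<longleftrightarrow> wf_tm L s \<and> wf_tm L t"
| "wf_fm L (Rel r ts) \<longleftrightarrow>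
     r \<in> rel_syms L \<and> length ts = rel_arity L r \<and> list_all (wf_tm L) ts"
| "wf_fm L (Neg \<phi>) \<longleftrightarrow> wf_fm L \<phi>"
| "wf_fm L (And \<phi> \<psi>) \<longleftrightarrow> wf_fm L \<phi> \<and> wf_fm L \<psi>"
| "wf_fm L (All v \<phi>) \<longleftrightarrow> wf_fm L \<phi>"

primrec fv_tm :: "'f tm \<Rightarrow> nat set" where
  "fv_tm (Var v) = {v}"
| "fv_tm (Fn f ts) = \<Union> (set (map fv_tm ts))"

primrec fv_fm :: "('f, 'r) fm \<Rightarrow> nat set" where
  "fv_fm (Eq s t) = fv_tm s \<union> fv_tm t"
| "fv_fm (Rel r ts) = \<Union> (set (map fv_tm ts))"
| "fv_fm (Neg \<phi>) = fv_fm \<phi>"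
| "fv_fm (And \<phi> \<psi>) = fv_fm \<phi> \<union> fv_fm \<psi>"
| "fv_fm (All v \<phi>) = fv_fm \<phi> - {v}"

definition formula_in :: "('f, 'r) lang \<Rightarrow> nat \<Rightarrow> ('f, 'r) fm \<Rightarrow> bool" where
  "formula_in L n \<phi> \<longleftrightarrow> wf_fm L \<phi> \<and> fv_fm \<phi> \<subseteq> {..<n}"

abbreviation sentence :: "('f, 'r) lang \<Rightarrow> ('f, 'r) fm \<Rightarrow> bool" where
  "sentence L \<phi> \<equiv> formula_in L 0 \<phi>"

record ('a, 'f, 'r) struct =
  univ :: "'a set"
  fun_int :: "'f \<Rightarrow> 'a list \<Rightarrow> 'a"
  rel_int :: "'r \<Rightarrow> 'a list \<Rightarrow> bool"

definition structure_of :: "('f, 'r) lang \<Rightarrow> ('a, 'f, 'r) struct \<Rightarrow> bool" where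
  "structure_of L M \<longleftrightarrow> univ M \<noteq> {} \<and>
     (\<forall>f\<in>fun_syms L. \<forall>xs\<in>lists (univ M). length xs = fun_arity L f \<longrightarrow> fun_int M f xs \<in> univ M)"

primrec val :: "('a, 'f, 'r) struct \<Rightarrow> (nat \<Rightarrow> 'a) \<Rightarrow> 'f tm \<Rightarrow> 'a" where
  "val M e (Var v) = e v"
| "val M e (Fn f ts) = fun_int M f (map (val M e) ts)"

primrec sat :: "('a, 'f, 'r) struct \<Rightarrow> (nat \<Rightarrow> 'a) \<Rightarrow> ('f, 'r) fm \<Rightarrow> bool" where
  "sat M e (Eq s t) \<longleftrightarrow> val M e s = val M e t"
| "sat M e (Rel r ts) \<longleftrightarrow> rel_int M r (map (val M e) ts)"
| "sat M e (Neg \<phi>) \<longleftrightarrow> \<not> sat M e \<phi>"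
| "sat M e (And \<phi> \<psi>) \<longleftrightarrow> sat M e \<phi> \<and> sat M e \<psi>"
| "sat M e (All v \<phi>) \<longleftrightarrow> (\<forall>x\<in>univ M. sat M (e(v := x)) \<phi>)"

text \<open>\<open>holds M \<phi> xs\<close> reads the free variables \<open>0, \<dots>, length xs - 1\<close> of \<open>\<phi>\<close> off the tuple \<open>xs\<close>;
  it is only used when there are no other free variables, so \<open>undefined\<close> is never consulted.\<close>

definition holds :: "('a, 'f, 'r) struct \<Rightarrow> ('f, 'r) fm \<Rightarrow> 'a list \<Rightarrow> bool" where
  "holds M \<phi> xs \<longleftrightarrow> sat M (\<lambda>i. if i < length xs then xs ! i else undefined) \<phi>"

definition is_model :: "('f, 'r) lang \<Rightarrow> ('f, 'r) fm set \<Rightarrow> ('a, 'f, 'r) struct \<Rightarrow> bool" where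
  "is_model L T M \<longleftrightarrow> structure_of L M \<and> (\<forall>\<phi>\<in>T. holds M \<phi> [])"

definition isomorphism ::
    "('f, 'r) lang \<Rightarrow> ('a, 'f, 'r) struct \<Rightarrow> ('b, 'f, 'r) struct \<Rightarrow> ('a \<Rightarrow> 'b) \<Rightarrow> bool" where
  "isomorphism L M N h \<longleftrightarrow> bij_betw h (univ M) (univ N) \<and>
     (\<forall>f\<in>fun_syms L. \<forall>xs\<in>lists (univ M). length xs = fun_arity L f \<longrightarrow>
        h (fun_int M f xs) = fun_int N f (map h xs)) \<and>
     (\<forall>r\<in>rel_syms L. \<forall>xs\<in>lists (univ M). length xs = rel_arity L r \<longrightarrow>
        (rel_int M r xs \<longleftrightarrow> rel_int N r (map h xs)))"


section \<open>Complete and omega-categorical theories\<close>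

text \<open>The language will be countable, so by downward Loewenheim--Skolem it is enough to let the
  models in the next definitions have a universe consisting of natural numbers.\<close>

definition entails :: "('f, 'r) lang \<Rightarrow> ('f, 'r) fm set \<Rightarrow> ('f, 'r) fm \<Rightarrow> bool" where
  "entails L T \<phi> \<longleftrightarrow> (\<forall>M :: (nat, 'f, 'r) struct. is_model L T M \<longrightarrow> holds M \<phi> [])"

definition complete_theory :: "('f, 'r) lang \<Rightarrow> ('f, 'r) fm set \<Rightarrow> bool" where
  "complete_theory L T \<longleftrightarrow>
     (\<forall>\<phi>\<in>T. sentence L \<phi>) \<and>
     (\<exists>M :: (nat, 'f, 'r) struct. is_model L T M) \<and>
     (\<forall>\<phi>. sentence L \<phi> \<longrightarrow> entails L T \<phi> \<or> entails L T (Neg \<phi>))"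

definition omega_categorical :: "('f, 'r) lang \<Rightarrow> ('f, 'r) fm set \<Rightarrow> bool" where
  "omega_categorical L T \<longleftrightarrow>
     (\<exists>M :: (nat, 'f, 'r) struct. is_model L T M \<and> infinite (univ M)) \<and>
     (\<forall>(M :: (nat, 'f, 'r) struct) (N :: (nat, 'f, 'r) struct).
        is_model L T M \<and> infinite (univ M) \<and> is_model L T N \<and> infinite (univ N) \<longrightarrow>
        (\<exists>h. isomorphism L M N h))"


section \<open>Types and monster models\<close>

definition tuples :: "('a, 'f, 'r) struct \<Rightarrow> nat \<Rightarrow> 'a list set" where
  "tuples M n = {a \<in> lists (univ M). length a = n}"

text \<open>A formula \<open>\<phi>(x, b)\<close> with \<open>n\<close> object variables \<open>x\<close> and parameters \<open>b\<close> is encoded as the pair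
  \<open>(\<phi>, b)\<close>: the variables \<open>0, \<dots>, n - 1\<close> of \<open>\<phi>\<close> are \<open>x\<close>, and \<open>b\<close> is substituted for the next
  \<open>length b\<close> variables.\<close>

definition formulas_over ::
    "('f, 'r) lang \<Rightarrow> nat \<Rightarrow> 'a set \<Rightarrow> (('f, 'r) fm \<times> 'a list) set" where
  "formulas_over L n A = {(\<phi>, b). b \<in> lists A \<and> formula_in L (n + length b) \<phi>}"

definition realizes ::
    "('a, 'f, 'r) struct \<Rightarrow> 'a list \<Rightarrow> (('f, 'r) fm \<times> 'a list) set \<Rightarrow> bool" where
  "realizes M a p \<longleftrightarrow> (\<forall>(\<phi>, b)\<in>p. holds M \<phi> (a @ b))"

definition consistent ::
    "('a, 'f, 'r) struct \<Rightarrow> nat \<Rightarrow> (('f, 'r) fm \<times> 'a list) set \<Rightarrow> bool" where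
  "consistent M n p \<longleftrightarrow> (\<forall>q. finite q \<and> q \<subseteq> p \<longrightarrow> (\<exists>a\<in>tuples M n. realizes M a q))"

definition tp ::
    "('f, 'r) lang \<Rightarrow> ('a, 'f, 'r) struct \<Rightarrow> 'a list \<Rightarrow> 'a set \<Rightarrow> (('f, 'r) fm \<times> 'a list) set" where
  "tp L M a A = {(\<phi>, b) \<in> formulas_over L (length a) A. holds M \<phi> (a @ b)}"

definition saturated :: "('f, 'r) lang \<Rightarrow> 'k rel \<Rightarrow> ('a, 'f, 'r) struct \<Rightarrow> bool" where
  "saturated L \<kappa> M \<longleftrightarrow>
     (\<forall>A n p. A \<subseteq> univ M \<and> |A| <o \<kappa> \<and> p \<subseteq> formulas_over L n A \<and> consistent M n p \<longrightarrow>
        (\<exists>a\<in>tuples M n. realizes M a p))"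

definition elementary_map ::
    "('f, 'r) lang \<Rightarrow> ('a, 'f, 'r) struct \<Rightarrow> 'a set \<Rightarrow> ('a \<Rightarrow> 'a) \<Rightarrow> bool" where
  "elementary_map L M A f \<longleftrightarrow> A \<subseteq> univ M \<and> f ` A \<subseteq> univ M \<and>
     (\<forall>a\<in>lists A. tp L M a {} = tp L M (map f a) {})"

definition strongly_homogeneous ::
    "('f, 'r) lang \<Rightarrow> 'k rel \<Rightarrow> ('a, 'f, 'r) struct \<Rightarrow> bool" where
  "strongly_homogeneous L \<kappa> M \<longleftrightarrow>
     (\<forall>A f. |A| <o \<kappa> \<and> elementary_map L M A f \<longrightarrow>
        (\<exists>g. isomorphism L M M g \<and> (\<forall>x\<in>A. g x = f x)))"

text \<open>For a countable language; subsets of cardinality less than \<open>\<kappa>\<close> are the small ones.\<close>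

definition monster_model ::
    "('f, 'r) lang \<Rightarrow> ('f, 'r) fm set \<Rightarrow> 'k rel \<Rightarrow> ('a, 'f, 'r) struct \<Rightarrow> bool" where
  "monster_model L T \<kappa> M \<longleftrightarrow> Card_order \<kappa> \<and> natLeq <o \<kappa> \<and>
     is_model L T M \<and> infinite (univ M) \<and> saturated L \<kappa> M \<and> strongly_homogeneous L \<kappa> M"


section \<open>Simple and supersimple theories\<close>

text \<open>As usual, these properties of a complete theory are evaluated in its monster model \<open>M\<close>.
  In \<open>k_inconsistent\<close> it is the indexed family, not the set of its members, that matters.\<close>

definition k_inconsistent ::
    "('a, 'f, 'r) struct \<Rightarrow> nat \<Rightarrow> nat \<Rightarrow> ('f, 'r) fm \<Rightarrow> (nat \<Rightarrow> 'a list) \<Rightarrow> bool" where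
  "k_inconsistent M k n \<phi> b \<longleftrightarrow>
     (\<forall>K. finite K \<and> card K = k \<longrightarrow> \<not> consistent M n {(\<phi>, b i) | i. i \<in> K})"

definition tree_property ::
    "('f, 'r) lang \<Rightarrow> ('a, 'f, 'r) struct \<Rightarrow> nat \<Rightarrow> nat \<Rightarrow> ('f, 'r) fm \<Rightarrow> bool" where
  "tree_property L M n m \<phi> \<longleftrightarrow>
     (\<exists>k. \<exists>b :: nat list \<Rightarrow> 'a list.
        (\<forall>s. b s \<in> tuples M m) \<and>
        (\<forall>s. k_inconsistent M k n \<phi> (\<lambda>i. b (s @ [i]))) \<and>
        (\<forall>\<sigma> :: nat \<Rightarrow> nat. consistent M n {(\<phi>, b (map \<sigma> [0..<l])) | l. l > 0}))"

definition simple_theory :: "('f, 'r) lang \<Rightarrow> ('a, 'f, 'r) struct \<Rightarrow> bool" where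
  "simple_theory L M \<longleftrightarrow>
     (\<forall>n m \<phi>. formula_in L (n + m) \<phi> \<longrightarrow> \<not> tree_property L M n m \<phi>)"

definition divides ::
    "('f, 'r) lang \<Rightarrow> ('a, 'f, 'r) struct \<Rightarrow> 'a set \<Rightarrow> nat \<Rightarrow> ('f, 'r) fm \<Rightarrow> 'a list \<Rightarrow> bool" where
  "divides L M A n \<phi> b \<longleftrightarrow>
     (\<exists>k. \<exists>c :: nat \<Rightarrow> 'a list.
        (\<forall>i. c i \<in> tuples M (length b) \<and> tp L M (c i) A = tp L M b A) \<and>
        k_inconsistent M k n \<phi> c)"

definition forks ::
    "('f, 'r) lang \<Rightarrow> ('a, 'f, 'r) struct \<Rightarrow> 'a set \<Rightarrow> nat \<Rightarrow> (('f, 'r) fm \<times> 'a list) set \<Rightarrow> bool" where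
  "forks L M A n p \<longleftrightarrow>
     (\<exists>D. finite D \<and> D \<subseteq> formulas_over L n (univ M) \<and>
        (\<forall>(\<psi>, c)\<in>D. divides L M A n \<psi> c) \<and>
        (\<forall>a\<in>tuples M n. realizes M a p \<longrightarrow> (\<exists>(\<psi>, c)\<in>D. holds M \<psi> (a @ c))))"

definition supersimple_theory :: "('f, 'r) lang \<Rightarrow> 'k rel \<Rightarrow> ('a, 'f, 'r) struct \<Rightarrow> bool" where
  "supersimple_theory L \<kappa> M \<longleftrightarrow> simple_theory L M \<and>
     (\<forall>a A. a \<in> lists (univ M) \<and> A \<subseteq> univ M \<and> |A| <o \<kappa> \<longrightarrow>
        (\<exists>A\<^sub>0. finite A\<^sub>0 \<and> A\<^sub>0 \<subseteq> A \<and> \<not> forks L M A\<^sub>0 (length a) (tp L M a A)))"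


section \<open>Indiscernible sequences of finite tuples\<close>

definition indiscernible ::
    "('f, 'r) lang \<Rightarrow> ('a, 'f, 'r) struct \<Rightarrow> 'a set \<Rightarrow> (nat \<Rightarrow> 'a list) \<Rightarrow> bool" where
  "indiscernible L M A I \<longleftrightarrow>
     (\<forall>j. I j \<in> tuples M (length (I 0))) \<and>
     (\<forall>is js. sorted_wrt (<) is \<and> sorted_wrt (<) js \<and> length is = length js \<longrightarrow>
        tp L M (concat (map I is)) A = tp L M (concat (map I js)) A)"

text \<open>Equality of the types over the empty set of two sequences, as tuples of length omega:
  a formula only sees finitely many entries.\<close>

definition seq_equiv ::
    "('f, 'r) lang \<Rightarrow> ('a, 'f, 'r) struct \<Rightarrow> (nat \<Rightarrow> 'a list) \<Rightarrow> (nat \<Rightarrow> 'a list) \<Rightarrow> bool" where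
  "seq_equiv L M I J \<longleftrightarrow>
     (\<forall>is. tp L M (concat (map I is)) {} = tp L M (concat (map J is)) {})"

end

theory Submission
  imports Defs "HOL-Library.Ramsey"
begin

text \<open>
  Fix \<open>a\<close> and \<open>A\<close> such that the type of \<open>a\<close> over \<open>A\<close> forks over every finite subset of \<open>A\<close>, and
  choose finite \<open>A\<^sub>0 \<subseteq> A\<^sub>1 \<subseteq> \<dots> \<subseteq> A\<close> such that the type of \<open>a\<close> over \<open>A\<^sub>i\<^sub>+\<^sub>1\<close> forks over \<open>A\<^sub>i\<close>. For suitable
  finitely many formulas, \<open>a\<close> then satisfies a longer dividing chain over \<open>A\<^sub>i\<close> than over any later
  \<open>A\<^sub>j\<close>; in a simple theory such chains have bounded length. If \<open>c\<close> is such a longest chain over \<open>A\<^sub>i\<close>, let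
  \<open>I\<^sup>i\<close> be the first coordinate of a Morley sequence of \<open>a, c\<close> over \<open>A\<^sub>i\<close>. Whenever \<open>I\<^sup>i\<close> is
  indiscernible over a finite tuple \<open>d\<close>, one may assume that the whole Morley sequence is, and then
  the argument of Kim's lemma makes \<open>d\<close> independent from \<open>a, c\<close> over \<open>A\<^sub>i\<close>, so that \<open>c\<close> remains a
  dividing chain over \<open>d\<close>. If \<open>I\<^sup>i\<close> and \<open>I\<^sup>j\<close> had the same type for some \<open>j > i\<close>, this would apply to a
  copy \<open>d\<close> of \<open>A\<^sub>j\<close> and give a chain over \<open>A\<^sub>j\<close> that is too long.
\<close>

section \<open>Definable predicates\<close>

text \<open>The type of \<open>I^i\<close> over the empty set does not mention \<open>A_i\<close>,
  so the sequences can only be told apart by something that is recoverable up to automorphism: the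
  length of a dividing chain for \<open>a\<close>. All of them start with the same \<open>a\<close>;
  an automorphism carrying one to another therefore fixes \<open>a\<close> and transports chains for
  \<open>a\<close>.

  The drop in length comes from forking. A chain over \<open>A_(i+1)\<close> can be moved, by
  conjugation over \<open>A_(i+1)\<close>, to one over the parameters of finitely many dividing
  formulas that cover the type; one of these formulas is then satisfied and can be put in front. The
  labels must stay in one finite set, with one degree \<open>k\<close> of inconsistency: a long
  chain then repeats some formula often, and repetitions of one formula are what builds the tree
  property. Prepending with both bases equal also produces non-dividing conjugates, hence Morley
  sequences, so no symmetry or transitivity of independence is presupposed.\<close>

primrec ren_tm :: "(nat \<Rightarrow> nat) \<Rightarrow> 'f tm \<Rightarrow> 'f tm" where
  "ren_tm f (Var v) = Var (f v)"
| "ren_tm f (Fn g ts) = Fn g (map (ren_tm f) ts)"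

text \<open>The new bound variable exceeds every image of a free variable, so nothing is captured
  whatever \<open>f\<close> is, injective or not; \<open>insert 0\<close> covers an empty set of
  free variables.\<close>

primrec ren :: "('f, 'r) fm \<Rightarrow> (nat \<Rightarrow> nat) \<Rightarrow> ('f, 'r) fm" where
  "ren (Eq s t) f = Eq (ren_tm f s) (ren_tm f t)"
| "ren (Rel r ts) f = Rel r (map (ren_tm f) ts)"
| "ren (Neg \<phi>) f = Neg (ren \<phi> f)"
| "ren (And \<phi> \<psi>) f = And (ren \<phi> f) (ren \<psi> f)"
| "ren (All v \<phi>) f =
     (let w = Suc (Max (insert 0 (f ` fv_fm \<phi>))) in All w (ren \<phi> (f(v := w))))"

lemma finite_fv_tm: "finite (fv_tm t)"
  by (induction t) auto

lemma finite_fv_fm: "finite (fv_fm \<phi>)"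
  by (induction \<phi>) (auto simp: finite_fv_tm)

lemma val_cong: "(\<And>v. v \<in> fv_tm t \<Longrightarrow> e v = e' v) \<Longrightarrow> val M e t = val M e' t"
proof (induction t)
  case (Fn f ts)
  have "map (val M e) ts = map (val M e') ts"
    using Fn by (intro map_cong) auto
  then show ?case by (simp only: val.simps)
qed auto

lemma sat_cong: "(\<And>v. v \<in> fv_fm \<phi> \<Longrightarrow> e v = e' v) \<Longrightarrow> sat M e \<phi> = sat M e' \<phi>"
proof (induction \<phi> arbitrary: e e')
  case (Eq s t)
  then have "val M e s = val M e' s" "val M e t = val M e' t"
    by (auto intro!: val_cong)
  then show ?case by simp
next
  case (Rel r ts)
  then have "map (val M e) ts = map (val M e') ts"
    by (intro map_cong) (auto intro!: val_cong)
  then show ?case by (metis sat.simps(2))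
next
  case (Neg \<phi>)
  have "sat M e \<phi> = sat M e' \<phi>" using Neg.prems by (intro Neg.IH) auto
  then show ?case by simp
next
  case (And \<phi> \<psi>)
  have "sat M e \<phi> = sat M e' \<phi>" using And.prems by (intro And.IH(1)) auto
  moreover have "sat M e \<psi> = sat M e' \<psi>" using And.prems by (intro And.IH(2)) auto
  ultimately show ?case by simp
next
  case (All v \<phi>)
  have "sat M (e(v := x)) \<phi> = sat M (e'(v := x)) \<phi>" for x
    using All.prems by (intro All.IH) auto
  then show ?case by simp
qed

lemma val_ren: "val M e (ren_tm f t) = val M (\<lambda>a. e (f a)) t"
proof (induction t)
  case (Fn g ts)
  then have "map (val M e) (map (ren_tm f) ts) = map (val M (\<lambda>a. e (f a))) ts"
    unfolding map_map by (intro map_cong refl) (simp only: comp_apply)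
  then show ?case by (simp only: val.simps ren_tm.simps)
qed auto

lemma Suc_Max_fresh: "finite X \<Longrightarrow> x \<in> X \<Longrightarrow> x \<noteq> Suc (Max (insert 0 X))"
  by (metis Max_ge finite_insert insertCI not_less_eq_eq order_refl)

lemma sat_ren: "sat M e (ren \<phi> f) = sat M (\<lambda>a. e (f a)) \<phi>"
proof (induction \<phi> arbitrary: e f)
  case (Rel r ts)
  have "map (val M e) (map (ren_tm f) ts) = map (val M (\<lambda>a. e (f a))) ts"
    by (simp add: val_ren)
  then show ?case by (simp only: sat.simps ren.simps)
next
  case (All v \<phi>)
  define w where "w = Suc (Max (insert 0 (f ` fv_fm \<phi>)))"
  have w: "f u \<noteq> w" if "u \<in> fv_fm \<phi>" for u
    unfolding w_def using that by (intro Suc_Max_fresh) (auto simp: finite_fv_fm)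
  have "sat M (e(w := x)) (ren \<phi> (f(v := w))) = sat M ((\<lambda>a. e (f a))(v := x)) \<phi>" for x
    unfolding All.IH using w by (intro sat_cong) auto
  then show ?case by (simp add: Let_def flip: w_def)
qed (auto simp: val_ren)

lemma wf_ren_tm: "wf_tm L t \<Longrightarrow> wf_tm L (ren_tm f t)"
  by (induction t) (auto simp: list_all_iff)

lemma wf_ren: "wf_fm L \<phi> \<Longrightarrow> wf_fm L (ren \<phi> f)"
  by (induction \<phi> arbitrary: f) (auto simp: wf_ren_tm list_all_iff Let_def)

lemma fv_ren_tm: "fv_tm (ren_tm f t) = f ` fv_tm t"
  by (induction t) auto

lemma fv_ren: "fv_fm (ren \<phi> f) \<subseteq> f ` fv_fm \<phi>"
proof (induction \<phi> arbitrary: f)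
  case (All v \<phi>)
  define w where "w = Suc (Max (insert 0 (f ` fv_fm \<phi>)))"
  have "fv_fm (ren \<phi> (f(v := w))) \<subseteq> f(v := w) ` fv_fm \<phi>" by (rule All.IH)
  then have "fv_fm (ren \<phi> (f(v := w))) - {w} \<subseteq> f ` (fv_fm \<phi> - {v})" by (auto split: if_splits)
  then show ?case by (simp add: Let_def flip: w_def)
qed (auto simp: fv_ren_tm, blast+)

lemma tuples_iff: "u \<in> tuples M n \<longleftrightarrow> set u \<subseteq> univ M \<and> length u = n"
  by (auto simp: tuples_def)

text \<open>Working with predicates, up to agreement on tuples of the right length, turns each
  construction of a formula into a closure property. Formulas reappear only where saturation, types
  or the tree property are invoked.\<close>

definition definable :: "('f, 'r) lang \<Rightarrow> ('a, 'f, 'r) struct \<Rightarrow> nat \<Rightarrow> ('a list \<Rightarrow> bool) \<Rightarrow> bool" where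
  "definable L M n P \<longleftrightarrow>
     (\<exists>\<phi>. formula_in L n \<phi> \<and> (\<forall>u\<in>tuples M n. P u \<longleftrightarrow> holds M \<phi> u))"

lemma definable_holds: "formula_in L n \<phi> \<Longrightarrow> definable L M n (holds M \<phi>)"
  by (auto simp: definable_def)

lemma definable_cong:
  assumes "definable L M n P" "\<And>u. u \<in> tuples M n \<Longrightarrow> P u = Q u" shows "definable L M n Q"
  using assms unfolding definable_def by metis

lemma definable_not:
  assumes "definable L M n P" shows "definable L M n (\<lambda>u. \<not> P u)"
proof -
  obtain \<phi> where "formula_in L n \<phi>" "\<forall>u\<in>tuples M n. P u \<longleftrightarrow> holds M \<phi> u"
    using assms by (auto simp: definable_def)
  then show ?thesis
    unfolding definable_def by (intro exI[of _ "Neg \<phi>"]) (auto simp: formula_in_def holds_def)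
qed

lemma definable_conj:
  assumes "definable L M n P" "definable L M n Q" shows "definable L M n (\<lambda>u. P u \<and> Q u)"
proof -
  obtain \<phi> \<psi> where "formula_in L n \<phi>" "\<forall>u\<in>tuples M n. P u \<longleftrightarrow> holds M \<phi> u"
    "formula_in L n \<psi>" "\<forall>u\<in>tuples M n. Q u \<longleftrightarrow> holds M \<psi> u"
    using assms by (auto simp: definable_def)
  then show ?thesis
    unfolding definable_def by (intro exI[of _ "And \<phi> \<psi>"]) (auto simp: formula_in_def holds_def)
qed

lemma definable_iff:
  assumes "definable L M n P" "definable L M n Q" shows "definable L M n (\<lambda>u. P u \<longleftrightarrow> Q u)"
proof -
  have "definable L M n (\<lambda>u. \<not> (P u \<and> \<not> Q u) \<and> \<not> (Q u \<and> \<not> P u))"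
    using assms by (intro definable_conj definable_not)
  then show ?thesis by (rule definable_cong) auto
qed

lemma definable_True: "definable L M n (\<lambda>u. True)"
proof -
  \<comment> \<open>A sentence, so that \<open>n = 0\<close> is covered as well.\<close>
  have "formula_in L n (All 0 (Eq (Var 0) (Var 0)))" by (auto simp: formula_in_def)
  then show ?thesis unfolding definable_def by (intro exI[of _ "All 0 (Eq (Var 0) (Var 0))"]) (auto simp: holds_def)
qed

lemma definable_Ball:
  assumes "finite F" "\<And>i. i \<in> F \<Longrightarrow> definable L M n (P i)"
  shows "definable L M n (\<lambda>u. \<forall>i\<in>F. P i u)"
  using assms
proof (induction F rule: finite_induct)
  case empty
  then show ?case by (simp add: definable_True)
next
  case (insert i F)
  then have "definable L M n (\<lambda>u. P i u \<and> (\<forall>i\<in>F. P i u))" by (intro definable_conj) auto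
  then show ?case by (rule definable_cong) auto
qed

text \<open>Variable \<open>v\<close> is renamed to \<open>js ! v\<close>. Since \<open>js\<close>
  may permute, repeat and omit positions, projections, swaps and dummy variables are all
  instances.\<close>

lemma definable_reindex:
  assumes "definable L M (length js) P" "set js \<subseteq> {..<m}"
  shows "definable L M m (\<lambda>u. P (map ((!) u) js))"
proof -
  obtain \<phi> where \<phi>: "formula_in L (length js) \<phi>" "\<forall>u\<in>tuples M (length js). P u \<longleftrightarrow> holds M \<phi> u"
    using assms by (auto simp: definable_def)
  let ?\<psi> = "ren \<phi> ((!) js)"
  have "fv_fm ?\<psi> \<subseteq> (!) js ` fv_fm \<phi>" by (rule fv_ren)
  also have "\<dots> \<subseteq> set js" using \<phi>(1) by (auto simp: formula_in_def)
  finally have 1: "formula_in L m ?\<psi>"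
    using \<phi>(1) assms(2) unfolding formula_in_def by (blast intro: wf_ren)
  have "P (map ((!) u) js) \<longleftrightarrow> holds M ?\<psi> u" if "u \<in> tuples M m" for u
  proof -
    have "map ((!) u) js \<in> tuples M (length js)" using that assms(2)
      by (auto simp: tuples_iff subset_iff)
    then have "P (map ((!) u) js) \<longleftrightarrow> holds M \<phi> (map ((!) u) js)" using \<phi>(2) by blast
    also have "\<dots> \<longleftrightarrow> holds M ?\<psi> u"
      unfolding holds_def sat_ren
    proof (rule sat_cong)
      fix v assume "v \<in> fv_fm \<phi>"
      then have "v < length js" using \<phi>(1) by (auto simp: formula_in_def)
      then have "js ! v < length u" using assms(2) that nth_mem by (fastforce simp: tuples_iff)
      then show "(if v < length (map ((!) u) js) then map ((!) u) js ! v else undefined) =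
         (if js ! v < length u then u ! (js ! v) else undefined)"
        using \<open>v < length js\<close> by simp
    qed
    finally show ?thesis .
  qed
  with 1 show ?thesis unfolding definable_def by blast
qed

lemma definable_select:
  fixes f :: "'a list \<Rightarrow> 'a list"
  assumes "definable L M n P" "set js \<subseteq> {..<m}" "length js = n"
    "\<And>u. u \<in> tuples M m \<Longrightarrow> f u = map ((!) u) js"
  shows "definable L M m (\<lambda>u. P (f u))"
  by (rule definable_cong[OF definable_reindex[of L M js P m]]) (use assms in auto)

lemma take_eq_map_nth: "k \<le> length u \<Longrightarrow> take k u = map ((!) u) [0..<k]"
  by (rule nth_equalityI) auto

lemma drop_eq_map_nth: "drop k u = map ((!) u) [k..<length u]"
  by (rule nth_equalityI) auto

lemma definable_Ex1:
  assumes "definable L M (Suc n) P"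
  shows "definable L M n (\<lambda>u. \<exists>x\<in>univ M. P (u @ [x]))"
proof -
  obtain \<phi> where \<phi>: "formula_in L (Suc n) \<phi>" "\<forall>u\<in>tuples M (Suc n). P u \<longleftrightarrow> holds M \<phi> u"
    using assms by (auto simp: definable_def)
  \<comment> \<open>The quantified entry is the last one, hence variable \<open>n\<close>, and can
    be bound without renaming.\<close>
  let ?\<psi> = "Neg (All n (Neg \<phi>))"
  have 1: "formula_in L n ?\<psi>" using \<phi>(1) by (auto simp: formula_in_def lessThan_Suc)
  have "(\<exists>x\<in>univ M. P (u @ [x])) \<longleftrightarrow> holds M ?\<psi> u" if u: "u \<in> tuples M n" for u
  proof -
    have "P (u @ [x]) \<longleftrightarrow> sat M ((\<lambda>i. if i < length u then u ! i else undefined)(n := x)) \<phi>"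
      if "x \<in> univ M" for x
    proof -
      have "P (u @ [x]) \<longleftrightarrow> holds M \<phi> (u @ [x])" using \<phi>(2) u that by (auto simp: tuples_iff)
      also have "\<dots> \<longleftrightarrow> sat M ((\<lambda>i. if i < length u then u ! i else undefined)(n := x)) \<phi>"
        unfolding holds_def by (rule arg_cong2[where f = "sat M"]) (use u in \<open>auto simp: tuples_iff nth_append\<close>)
      finally show ?thesis .
    qed
    then show ?thesis by (simp add: holds_def)
  qed
  with 1 show ?thesis unfolding definable_def by blast
qed

lemma definable_Ex_append:
  assumes "definable L M (n + m) P"
  shows "definable L M n (\<lambda>u. \<exists>x\<in>tuples M m. P (u @ x))"
  using assms
proof (induction m arbitrary: n P)
  case 0
  then show ?case by (auto simp: tuples_def cong: conj_cong)
next
  case (Suc m)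
  have "definable L M (Suc n + m) P" using Suc.prems by simp
  then have "definable L M (Suc n) (\<lambda>u. \<exists>x\<in>tuples M m. P (u @ x))" by (rule Suc.IH)
  then have "definable L M n (\<lambda>u. \<exists>y\<in>univ M. \<exists>x\<in>tuples M m. P ((u @ [y]) @ x))"
    by (rule definable_Ex1)
  then show ?case
  proof (rule definable_cong)
    fix u
    show "(\<exists>y\<in>univ M. \<exists>x\<in>tuples M m. P ((u @ [y]) @ x)) = (\<exists>x\<in>tuples M (Suc m). P (u @ x))"
    proof
      assume "\<exists>y\<in>univ M. \<exists>x\<in>tuples M m. P ((u @ [y]) @ x)"
      then obtain y x where "y \<in> univ M" "x \<in> tuples M m" "P (u @ (y # x))" by auto
      moreover then have "y # x \<in> tuples M (Suc m)" by (auto simp: tuples_iff)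
      ultimately show "\<exists>x\<in>tuples M (Suc m). P (u @ x)" by blast
    next
      assume "\<exists>x\<in>tuples M (Suc m). P (u @ x)"
      then obtain x where x: "x \<in> tuples M (Suc m)" "P (u @ x)" by blast
      then obtain y z where "x = y # z" by (cases x) (auto simp: tuples_iff)
      then show "\<exists>y\<in>univ M. \<exists>x\<in>tuples M m. P ((u @ [y]) @ x)"
        using x by (intro bexI[of _ y] bexI[of _ z]) (auto simp: tuples_iff)
    qed
  qed
qed

lemma definable_swap:
  assumes "definable L M (m + n) P"
  shows "definable L M (n + m) (\<lambda>u. P (drop n u @ take n u))"
  by (rule definable_select[OF assms, of "[n..<n+m] @ [0..<n]"])
    (auto simp: tuples_iff take_eq_map_nth drop_eq_map_nth)

lemma definable_Ex:
  assumes "definable L M (m + n) P"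
  shows "definable L M n (\<lambda>u. \<exists>x\<in>tuples M m. P (x @ u))"
proof -
  have "definable L M n (\<lambda>u. \<exists>x\<in>tuples M m. P (drop n (u @ x) @ take n (u @ x)))"
    by (intro definable_Ex_append definable_swap assms)
  then show ?thesis by (rule definable_cong) (auto simp: tuples_iff)
qed

section \<open>Countably saturated and homogeneous structures\<close>

lemma val_in_univ:
  "structure_of L M \<Longrightarrow> wf_tm L t \<Longrightarrow> (\<forall>v\<in>fv_tm t. e v \<in> univ M) \<Longrightarrow> val M e t \<in> univ M"
proof (induction t)
  case (Fn f ts)
  have "map (val M e) ts \<in> lists (univ M)"
    using Fn by (auto simp: list_all_iff)
  then show ?case using Fn.prems by (auto simp: structure_of_def)
qed auto

lemma val_iso:
  assumes "structure_of L M" "isomorphism L M N g"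
  shows "wf_tm L t \<Longrightarrow> (\<forall>v\<in>fv_tm t. e v \<in> univ M) \<Longrightarrow> val N (\<lambda>v. g (e v)) t = g (val M e t)"
proof (induction t)
  case (Fn f ts)
  have 1: "map (val N (\<lambda>v. g (e v))) ts = map g (map (val M e) ts)"
    unfolding map_map using Fn by (intro map_cong refl) (auto simp: list_all_iff)
  have "map (val M e) ts \<in> lists (univ M)"
    using Fn.prems by (auto simp: list_all_iff intro!: val_in_univ[OF assms(1)])
  then have "g (fun_int M f (map (val M e) ts)) = fun_int N f (map g (map (val M e) ts))"
    using assms(2) Fn.prems(1) unfolding isomorphism_def by (metis length_map wf_tm.simps(2))
  then show ?case by (simp only: val.simps 1)
qed auto

lemma sat_iso:
  assumes "structure_of L M" "isomorphism L M N g"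
  shows "wf_fm L \<phi> \<Longrightarrow> (\<forall>v\<in>fv_fm \<phi>. e v \<in> univ M) \<Longrightarrow> sat N (\<lambda>v. g (e v)) \<phi> = sat M e \<phi>"
proof (induction \<phi> arbitrary: e)
  case (Eq s t)
  have inj: "inj_on g (univ M)" using assms(2) by (auto simp: isomorphism_def bij_betw_def)
  have "val N (\<lambda>v. g (e v)) s = g (val M e s)" "val N (\<lambda>v. g (e v)) t = g (val M e t)"
    using Eq by (auto intro!: val_iso[OF assms])
  moreover have "val M e s \<in> univ M" "val M e t \<in> univ M"
    using Eq by (auto intro!: val_in_univ[OF assms(1)])
  ultimately show ?case using inj by (auto dest: inj_onD)
next
  case (Rel r ts)
  have 1: "map (val N (\<lambda>v. g (e v))) ts = map g (map (val M e) ts)"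
    unfolding map_map using Rel by (intro map_cong refl) (auto simp: list_all_iff intro!: val_iso[OF assms])
  have "map (val M e) ts \<in> lists (univ M)"
    using Rel.prems by (auto simp: list_all_iff intro!: val_in_univ[OF assms(1)])
  then have "rel_int M r (map (val M e) ts) = rel_int N r (map g (map (val M e) ts))"
    using assms(2) Rel.prems(1) unfolding isomorphism_def by (metis length_map wf_fm.simps(2))
  then show ?case by (simp only: sat.simps 1)
next
  case (Neg \<phi>)
  have "sat N (\<lambda>v. g (e v)) \<phi> = sat M e \<phi>" using Neg.prems by (intro Neg.IH) auto
  then show ?case by simp
next
  case (And \<phi> \<psi>)
  have "sat N (\<lambda>v. g (e v)) \<phi> = sat M e \<phi>" "sat N (\<lambda>v. g (e v)) \<psi> = sat M e \<psi>"
    using And.prems by (auto intro!: And.IH)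
  then show ?case by simp
next
  case (All v \<phi>)
  have bij: "g ` univ M = univ N" using assms(2) by (auto simp: isomorphism_def bij_betw_def)
  have "sat N ((\<lambda>v. g (e v))(v := g x)) \<phi> = sat M (e(v := x)) \<phi>" if "x \<in> univ M" for x
  proof -
    have "sat N (\<lambda>u. g ((e(v := x)) u)) \<phi> = sat M (e(v := x)) \<phi>"
      using All.prems that by (intro All.IH) auto
    moreover have "(\<lambda>u. g ((e(v := x)) u)) = (\<lambda>v. g (e v))(v := g x)" by auto
    ultimately show ?thesis by simp
  qed
  then show ?case by (simp flip: bij)
qed

lemma tp_empty_eqI:
  assumes "length u = length v" "\<And>\<phi>. formula_in L (length u) \<phi> \<Longrightarrow> holds M \<phi> u = holds M \<phi> v"
  shows "tp L M u {} = tp L M v {}"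
  using assms by (auto simp: tp_def formulas_over_def)

lemma tp_empty_eq_definable:
  assumes "tp L M u {} = tp L M v {}" "u \<in> tuples M n" "v \<in> tuples M n" "definable L M n P"
  shows "P u \<longleftrightarrow> P v"
proof -
  obtain \<phi> where \<phi>: "formula_in L n \<phi>" "\<forall>u\<in>tuples M n. P u \<longleftrightarrow> holds M \<phi> u"
    using assms by (auto simp: definable_def)
  have "(\<phi>, []) \<in> tp L M u {} \<longleftrightarrow> (\<phi>, []) \<in> tp L M v {}" using assms by simp
  then have "holds M \<phi> u \<longleftrightarrow> holds M \<phi> v" using \<phi>(1) assms(2,3) by (auto simp: tp_def formulas_over_def tuples_iff)
  then show ?thesis using \<phi>(2) assms by blast
qed

text \<open>Apart from the set over which the given type forks, all parameters in the argument come
  from finite tuples and from sequences of finite tuples. Saturation and homogeneity over countable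
  sets handle these, and the cardinal disappears.\<close>

locale big_model =
  fixes L :: "('f, 'r) lang" and M :: "('a, 'f, 'r) struct"
  assumes struct: "structure_of L M"
    and realize_countable:
      "\<lbrakk>A \<subseteq> univ M; countable A; p \<subseteq> formulas_over L n A; consistent M n p\<rbrakk>
        \<Longrightarrow> \<exists>a\<in>tuples M n. realizes M a p"
    and extend_countable:
      "\<lbrakk>countable A; elementary_map L M A f\<rbrakk>
        \<Longrightarrow> \<exists>g. isomorphism L M M g \<and> (\<forall>x\<in>A. g x = f x)"
begin

abbreviation "U \<equiv> univ M"
abbreviation "dfn \<equiv> definable L M"
abbreviation "aut g \<equiv> isomorphism L M M g"

lemma U_nonempty: "U \<noteq> {}"
  using struct by (auto simp: structure_of_def)

lemma aut_in: "aut g \<Longrightarrow> x \<in> U \<Longrightarrow> g x \<in> U"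
  by (auto simp: isomorphism_def bij_betw_def)

lemma aut_tuples: "aut g \<Longrightarrow> u \<in> tuples M n \<Longrightarrow> map g u \<in> tuples M n"
  by (auto simp: tuples_iff aut_in)

lemma aut_id: "aut (\<lambda>x. x)"
  by (auto simp: isomorphism_def bij_betw_def)

lemma aut_comp:
  assumes "aut g" "aut h" shows "aut (\<lambda>x. g (h x))"
  unfolding isomorphism_def
proof (intro conjI ballI impI)
  show "bij_betw (\<lambda>x. g (h x)) U U"
    using assms bij_betw_trans[of h U U g U] by (auto simp: isomorphism_def comp_def)
  have m: "map h xs \<in> lists U" if "xs \<in> lists U" for xs using that aut_in[OF assms(2)] by auto
  have mm: "map (\<lambda>x. g (h x)) xs = map g (map h xs)" for xs by simp
  show "g (h (fun_int M f xs)) = fun_int M f (map (\<lambda>x. g (h x)) xs)"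
    if "f \<in> fun_syms L" "xs \<in> lists U" "length xs = fun_arity L f" for f xs
  proof -
    have "h (fun_int M f xs) = fun_int M f (map h xs)"
      using assms(2) that unfolding isomorphism_def by blast
    moreover have "g (fun_int M f (map h xs)) = fun_int M f (map g (map h xs))"
      using assms(1) that m[OF that(2)] unfolding isomorphism_def by (metis length_map)
    ultimately show ?thesis unfolding mm by simp
  qed
  show "rel_int M r xs = rel_int M r (map (\<lambda>x. g (h x)) xs)"
    if "r \<in> rel_syms L" "xs \<in> lists U" "length xs = rel_arity L r" for r xs
  proof -
    have "rel_int M r xs = rel_int M r (map h xs)"
      using assms(2) that unfolding isomorphism_def by blast
    moreover have "rel_int M r (map h xs) = rel_int M r (map g (map h xs))"
      using assms(1) that m[OF that(2)] unfolding isomorphism_def by (metis length_map)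
    ultimately show ?thesis unfolding mm by simp
  qed
qed

lemma aut_inverse:
  assumes "aut g" obtains h where "aut h" "\<And>x. x \<in> U \<Longrightarrow> h (g x) = x" "\<And>x. x \<in> U \<Longrightarrow> g (h x) = x"
proof
  let ?h = "inv_into U g"
  have bij: "bij_betw g U U" using assms by (auto simp: isomorphism_def)
  show hg: "\<And>x. x \<in> U \<Longrightarrow> ?h (g x) = x" using bij by (auto simp: bij_betw_def)
  show gh: "\<And>x. x \<in> U \<Longrightarrow> g (?h x) = x" using bij by (auto simp: bij_betw_def f_inv_into_f)
  have bij': "bij_betw ?h U U" using bij by (rule bij_betw_inv_into)
  have in': "map ?h xs \<in> lists U" if "xs \<in> lists U" for xs
    using that bij' by (metis bij_betw_imp_surj_on lists_image image_eqI)
  have mm: "map g (map ?h xs) = xs" if "xs \<in> lists U" for xs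
    using that gh by (auto simp: map_idI)
  have "?h (fun_int M f xs) = fun_int M f (map ?h xs)"
    if "f \<in> fun_syms L" "xs \<in> lists U" "length xs = fun_arity L f" for f xs
  proof -
    have "fun_int M f (map ?h xs) \<in> U"
      using struct that in'[OF that(2)] by (auto simp: structure_of_def)
    moreover have "g (fun_int M f (map ?h xs)) = fun_int M f xs"
      using assms that in'[OF that(2)] mm[OF that(2)] unfolding isomorphism_def by (metis length_map)
    ultimately show ?thesis using hg by metis
  qed
  moreover have "rel_int M r xs \<longleftrightarrow> rel_int M r (map ?h xs)"
    if "r \<in> rel_syms L" "xs \<in> lists U" "length xs = rel_arity L r" for r xs
    using assms that in'[OF that(2)] mm[OF that(2)] unfolding isomorphism_def by (metis length_map)
  ultimately show "aut ?h" using bij' by (auto simp: isomorphism_def)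
qed

lemma aut_definable:
  assumes "aut g" "dfn n P" "u \<in> tuples M n"
  shows "P (map g u) \<longleftrightarrow> P u"
proof -
  obtain \<phi> where \<phi>: "formula_in L n \<phi>" "\<forall>u\<in>tuples M n. P u \<longleftrightarrow> holds M \<phi> u"
    using assms by (auto simp: definable_def)
  let ?e = "\<lambda>i. if i < length u then u ! i else undefined"
  have fv: "v < length u" if "v \<in> fv_fm \<phi>" for v using that \<phi>(1) assms(3) by (auto simp: formula_in_def tuples_iff)
  have "holds M \<phi> (map g u) \<longleftrightarrow> sat M (\<lambda>v. g (?e v)) \<phi>"
    unfolding holds_def by (rule sat_cong) (auto dest: fv)
  also have "\<dots> \<longleftrightarrow> holds M \<phi> u"
    unfolding holds_def using \<phi>(1) assms(3) fv
    by (intro sat_iso[OF struct assms(1)]) (auto simp: formula_in_def tuples_iff)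
  finally show ?thesis using \<phi>(2) assms(3) aut_tuples[OF assms(1,3)] by blast
qed

text \<open>The families may repeat values. Applying the hypothesis to the formula
  \<open>x = y\<close> shows that \<open>s i\<close> determines \<open>t i\<close>; the resulting
  map is elementary and extends by homogeneity.\<close>

lemma aut_of_equiv:
  fixes s t :: "'i \<Rightarrow> 'a"
  assumes "countable X" "s ` X \<subseteq> U" "t ` X \<subseteq> U"
    and eq: "\<And>js P. set js \<subseteq> X \<Longrightarrow> dfn (length js) P \<Longrightarrow> P (map s js) \<longleftrightarrow> P (map t js)"
  shows "\<exists>g. aut g \<and> (\<forall>i\<in>X. g (s i) = t i)"
proof -
  have wd: "t i = t j" if "i \<in> X" "j \<in> X" "s i = s j" for i j
  proof -
    have "formula_in L (length [i, j]) (Eq (Var 0) (Var 1))" by (auto simp: formula_in_def)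
    then have "holds M (Eq (Var 0) (Var 1)) (map s [i, j]) \<longleftrightarrow> holds M (Eq (Var 0) (Var 1)) (map t [i, j])"
      by (intro eq definable_holds) (use that in auto)
    then show ?thesis using that by (simp add: holds_def)
  qed
  define f where "f x = t (SOME i. i \<in> X \<and> s i = x)" for x
  have f: "f (s i) = t i" if "i \<in> X" for i
    unfolding f_def by (rule wd) (use that someI[of "\<lambda>j. j \<in> X \<and> s j = s i" i] in auto)
  have "elementary_map L M (s ` X) f"
    unfolding elementary_map_def
  proof (intro conjI ballI)
    show "f ` s ` X \<subseteq> U" using f assms(3) by auto
    fix a assume "a \<in> lists (s ` X)"
    then obtain js where js: "a = map s js" "set js \<subseteq> X"
      by (auto simp: lists_image)
    have m: "map f a = map t js" using js f by auto
    have "holds M \<phi> (map s js) = holds M \<phi> (map t js)" if "formula_in L (length js) \<phi>" for \<phi>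
      by (rule eq[OF js(2) definable_holds[OF that]])
    then have "tp L M (map s js) {} = tp L M (map t js) {}"
      by (intro tp_empty_eqI) (simp_all only: length_map)
    then show "tp L M a {} = tp L M (map f a) {}" by (metis m js(1))
  qed (use assms in auto)
  then obtain g where "aut g" "\<forall>x\<in>s ` X. g x = f x"
    using extend_countable[of "s ` X" f] assms(1) by auto
  then show ?thesis using f by auto
qed

text \<open>Over a small set \<open>A\<close>, homogeneity turns equality of types over \<open>A\<close> into conjugacy by an
  automorphism fixing \<open>A\<close> pointwise.\<close>

definition conjugate :: "'a set \<Rightarrow> 'a list \<Rightarrow> 'a list \<Rightarrow> bool" where
  "conjugate A u v \<longleftrightarrow> (\<exists>g. aut g \<and> (\<forall>x\<in>A. g x = x) \<and> map g u = v)"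

lemma conjugate_refl: "conjugate A u u"
  unfolding conjugate_def by (rule exI[of _ "\<lambda>x. x"]) (auto simp: aut_id)

lemma conjugate_sym:
  assumes "conjugate A u v" "A \<subseteq> U" "set u \<subseteq> U" shows "conjugate A v u"
proof -
  obtain g where g: "aut g" "\<forall>x\<in>A. g x = x" "map g u = v" using assms by (auto simp: conjugate_def)
  obtain h where h: "aut h" "\<And>x. x \<in> U \<Longrightarrow> h (g x) = x" using aut_inverse[OF g(1)] by metis
  have "\<forall>x\<in>A. h x = x" using g(2) h(2) assms(2) by (metis subsetD)
  moreover have "map h v = u" using h(2) assms(3) by (auto simp: g(3)[symmetric] subset_iff intro!: map_idI)
  ultimately show ?thesis using h(1) by (auto simp: conjugate_def)
qed

lemma conjugate_trans:
  assumes "conjugate A u v" "conjugate A v w" shows "conjugate A u w"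
proof -
  obtain g h where "aut g" "\<forall>x\<in>A. g x = x" "map g u = v" "aut h" "\<forall>x\<in>A. h x = x" "map h v = w"
    using assms by (auto simp: conjugate_def)
  then show ?thesis unfolding conjugate_def
    by (intro exI[of _ "\<lambda>x. h (g x)"]) (auto intro: aut_comp)
qed

lemma conjugate_mono: "conjugate A u v \<Longrightarrow> B \<subseteq> A \<Longrightarrow> conjugate B u v"
  by (auto simp: conjugate_def)

lemma conjugate_length: "conjugate A u v \<Longrightarrow> length v = length u"
  by (auto simp: conjugate_def)

lemma conjugate_tuples: "conjugate A u v \<Longrightarrow> u \<in> tuples M n \<Longrightarrow> v \<in> tuples M n"
  by (auto simp: conjugate_def intro: aut_tuples)

lemma conjugate_definable:
  assumes "conjugate A u v" "u \<in> tuples M n" "w \<in> tuples M m" "set w \<subseteq> A" "dfn (n + m) P"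
  shows "P (u @ w) \<longleftrightarrow> P (v @ w)"
proof -
  obtain g where g: "aut g" "\<forall>x\<in>A. g x = x" "map g u = v" using assms by (auto simp: conjugate_def)
  have "map g (u @ w) = v @ w" using g assms(4) by (auto simp: subset_iff map_idI)
  moreover have "u @ w \<in> tuples M (n + m)" using assms by (auto simp: tuples_iff)
  ultimately show ?thesis using aut_definable[OF g(1) assms(5)] by metis
qed

text \<open>Only one implication is assumed, since the negation of \<open>P\<close> supplies the
  converse. Treating \<open>e\<close> and \<open>u\<close> together as one family makes the
  automorphism fix \<open>e\<close>.\<close>

lemma conjugate_of_equiv:
  assumes "set e \<subseteq> U" "u \<in> tuples M n" "v \<in> tuples M n"
    and eq: "\<And>P. dfn (length e + n) P \<Longrightarrow> P (e @ u) \<Longrightarrow> P (e @ v)"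
  shows "conjugate (set e) u v"
proof -
  let ?s = "(!) (e @ u)" and ?t = "(!) (e @ v)" and ?N = "length e + n"
  have ss: "?s ` {..<?N} = set (e @ u)" "?t ` {..<?N} = set (e @ v)"
    using assms by (auto simp: tuples_iff set_conv_nth image_def)
  have "\<exists>g. aut g \<and> (\<forall>i\<in>{..<?N}. g (?s i) = ?t i)"
  proof (rule aut_of_equiv)
    fix js P assume js: "set js \<subseteq> {..<?N}" "dfn (length js) P"
    have d: "dfn ?N (\<lambda>u. P (map ((!) u) js))" using definable_reindex[OF js(2,1)] .
    show "P (map ?s js) \<longleftrightarrow> P (map ?t js)"
      using eq[OF d] eq[OF definable_not[OF d]] by blast
  qed (use assms(1-3) in \<open>simp_all add: ss tuples_iff\<close>)
  then obtain g where g: "aut g" "\<And>i. i < ?N \<Longrightarrow> g (?s i) = ?t i" by auto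
  have "g x = x" if x: "x \<in> set e" for x
  proof -
    obtain i where "i < length e" "x = e ! i" using x by (metis in_set_conv_nth)
    then show ?thesis using g(2)[of i] by (simp add: nth_append)
  qed
  moreover have "map g u = v"
  proof (rule nth_equalityI)
    show "length (map g u) = length v" using assms by (simp add: tuples_iff)
    fix i assume "i < length (map g u)"
    then show "map g u ! i = v ! i" using g(2)[of "length e + i"] assms by (simp add: tuples_iff nth_append)
  qed
  ultimately show ?thesis using g(1) unfolding conjugate_def by blast
qed

lemma conjugate_of_tp:
  assumes "finite A" "A \<subseteq> U" "u \<in> tuples M n" "v \<in> tuples M n" "tp L M u A = tp L M v A"
  shows "conjugate A u v"
proof -
  obtain e where e: "set e = A" using assms(1) finite_list by blast
  have "conjugate (set e) u v"
  proof (rule conjugate_of_equiv)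
    fix P assume P: "dfn (length e + n) P" "P (e @ u)"
    have "dfn (n + length e) (\<lambda>w. P (drop n w @ take n w))"
      by (rule definable_swap[OF P(1)])
    then obtain \<phi> where \<phi>: "formula_in L (n + length e) \<phi>"
        "\<forall>w\<in>tuples M (n + length e). P (drop n w @ take n w) \<longleftrightarrow> holds M \<phi> w"
      by (auto simp: definable_def)
    have t: "u @ e \<in> tuples M (n + length e)" "v @ e \<in> tuples M (n + length e)" "length u = n" "length v = n"
      using assms e by (auto simp: tuples_iff)
    have "holds M \<phi> (u @ e)" using bspec[OF \<phi>(2) t(1)] P(2) t(3) by simp
    then have "(\<phi>, e) \<in> tp L M u A"
      using \<phi>(1) t(3) e by (auto simp: tp_def formulas_over_def)
    then have "holds M \<phi> (v @ e)" using assms(5) by (auto simp: tp_def)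
    then show "P (e @ v)" using bspec[OF \<phi>(2) t(2)] t(4) by simp
  qed (use assms e in auto)
  then show ?thesis using e by simp
qed

lemma tp_of_conjugate:
  assumes "conjugate A u v" "A \<subseteq> U" "set u \<subseteq> U"
  shows "tp L M u A = tp L M v A"
proof -
  have "holds M \<phi> (u @ b) \<longleftrightarrow> holds M \<phi> (v @ b)" if "b \<in> lists A" "formula_in L (length u + length b) \<phi>" for b \<phi>
    by (rule conjugate_definable[OF assms(1) _ _ _ definable_holds[OF that(2)]])
      (use that assms in \<open>auto simp: tuples_iff\<close>)
  then show ?thesis using conjugate_length[OF assms(1)] by (auto simp: tp_def formulas_over_def)
qed

lemma realize_definable:
  assumes "countable C" "C \<subseteq> U"
    and dfn: "\<And>P w. (P, w) \<in> \<Gamma> \<Longrightarrow> set w \<subseteq> C \<and> dfn (n + length w) P"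
    and fin: "\<And>F. finite F \<Longrightarrow> F \<subseteq> \<Gamma> \<Longrightarrow> \<exists>x\<in>tuples M n. \<forall>(P, w)\<in>F. P (x @ w)"
  shows "\<exists>x\<in>tuples M n. \<forall>(P, w)\<in>\<Gamma>. P (x @ w)"
proof -
  have "\<forall>z\<in>\<Gamma>. \<exists>\<phi>. formula_in L (n + length (snd z)) \<phi> \<and>
      (\<forall>u\<in>tuples M (n + length (snd z)). fst z u \<longleftrightarrow> holds M \<phi> u)"
    using dfn unfolding definable_def by (metis prod.collapse)
  then obtain f where f: "\<forall>z\<in>\<Gamma>. formula_in L (n + length (snd z)) (f z) \<and>
      (\<forall>u\<in>tuples M (n + length (snd z)). fst z u \<longleftrightarrow> holds M (f z) u)"
    by metis
  have hf: "P (x @ w) \<longleftrightarrow> holds M (f (P, w)) (x @ w)" if "(P, w) \<in> \<Gamma>" "x \<in> tuples M n" for P w x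
  proof -
    have "x @ w \<in> tuples M (n + length w)"
      using that dfn[OF that(1)] assms(2) by (auto simp: tuples_iff)
    then show ?thesis using bspec[OF f that(1)] by simp
  qed
  let ?g = "\<lambda>z. (f z, snd z)"
  have "\<exists>a\<in>tuples M n. realizes M a (?g ` \<Gamma>)"
  proof (rule realize_countable[OF assms(2,1)])
    show "?g ` \<Gamma> \<subseteq> formulas_over L n C"
      using f dfn by (force simp: formulas_over_def)
    show "consistent M n (?g ` \<Gamma>)"
      unfolding consistent_def
    proof (intro allI impI)
      fix q assume "finite q \<and> q \<subseteq> ?g ` \<Gamma>"
      then obtain F where F: "F \<subseteq> \<Gamma>" "finite F" "q = ?g ` F" by (meson finite_subset_image)
      obtain x where x: "x \<in> tuples M n" "\<forall>(P, w)\<in>F. P (x @ w)" using fin[OF F(2,1)] by blast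
      have "holds M (f (P, w)) (x @ w)" if "(P, w) \<in> F" for P w
        using hf[of P w x] that F(1) x by blast
      then have "realizes M x q" unfolding realizes_def F(3) by force
      with x(1) show "\<exists>a\<in>tuples M n. realizes M a q" by blast
    qed
  qed
  then obtain a where a: "a \<in> tuples M n" "realizes M a (?g ` \<Gamma>)" by blast
  have "P (a @ w)" if "(P, w) \<in> \<Gamma>" for P w
    using hf[OF that a(1)] a(2) that by (force simp: realizes_def)
  with a(1) show ?thesis by blast
qed

end

section \<open>Ramsey's theorem, compactness for sequences, and extraction of indiscernible
  sequences\<close>

lemma ex_homogeneous_set:
  fixes \<Q> :: "((nat list \<Rightarrow> bool) \<times> nat) set"
  assumes "finite \<Q>"
  shows "\<exists>Y. infinite Y \<and> (\<forall>P r is js. (P, r) \<in> \<Q> \<and> sorted_wrt (<) is \<and> sorted_wrt (<) js \<and>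
      length is = r \<and> length js = r \<and> set is \<subseteq> Y \<and> set js \<subseteq> Y \<longrightarrow> P is = P js)"
  using assms
proof (induction \<Q> rule: finite_induct)
  case empty
  then show ?case by (auto intro: exI[of _ UNIV])
next
  case (insert q \<Q>)
  obtain P r where q: "q = (P, r)" by (cases q)
  obtain Y where Y: "infinite Y" "\<And>P r is js. (P, r) \<in> \<Q> \<Longrightarrow> sorted_wrt (<) is \<Longrightarrow> sorted_wrt (<) js \<Longrightarrow>
      length is = r \<Longrightarrow> length js = r \<Longrightarrow> set is \<subseteq> Y \<Longrightarrow> set js \<subseteq> Y \<Longrightarrow> P is = P js"
    using insert.IH by metis
  \<comment> \<open>Ramsey's theorem colours finite sets. An increasing list is recovered from its
    set of entries, so \<open>P\<close> becomes a colouring of the \<open>r\<close>-element sets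
    with two colours.\<close>
  let ?c = "\<lambda>X. if P (sorted_list_of_set X) then 1 else (0::nat)"
  obtain Z t where Z: "Z \<subseteq> Y" "infinite Z" "\<And>X. X \<subseteq> Z \<Longrightarrow> finite X \<Longrightarrow> card X = r \<Longrightarrow> ?c X = t"
  proof -
    have "\<exists>Z t. Z \<subseteq> Y \<and> infinite Z \<and> t < 2 \<and> (\<forall>X. X \<subseteq> Z \<and> finite X \<and> card X = r \<longrightarrow> ?c X = t)"
      by (rule Ramsey[OF Y(1), where f = ?c and s = 2 and r = r]) simp
    then obtain Z t where "Z \<subseteq> Y" "infinite Z" "\<forall>X. X \<subseteq> Z \<and> finite X \<and> card X = r \<longrightarrow> ?c X = t"
      by (elim exE conjE)
    then show ?thesis by (intro that[of Z t]) simp_all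
  qed
  have "?c (set is) = t \<and> sorted_list_of_set (set is) = is"
    if "sorted_wrt (<) is" "length is = r" "set is \<subseteq> Z" for "is"
    using that Z(3)[of "set is"] by (auto simp: strict_sorted_iff distinct_card sorted_list_of_set.idem_if_sorted_distinct)
  then have hP: "P is = P js" if "sorted_wrt (<) is" "length is = r" "set is \<subseteq> Z"
      "sorted_wrt (<) js" "length js = r" "set js \<subseteq> Z" for "is" js
    using that by (metis zero_neq_one)
  have hQ: "P is = P js" if "(P, r) \<in> \<Q>" "sorted_wrt (<) is" "sorted_wrt (<) js"
      "length is = r" "length js = r" "set is \<subseteq> Z" "set js \<subseteq> Z" for P r "is" js
    by (rule Y(2)[OF that(1-5)]) (use that Z(1) in auto)
  show ?case
  proof (intro exI[of _ Z] conjI allI impI)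
    show "infinite Z" by (rule Z(2))
    fix P' r' "is" js
    assume *: "(P', r') \<in> insert q \<Q> \<and> sorted_wrt (<) is \<and> sorted_wrt (<) js \<and>
      length is = r' \<and> length js = r' \<and> set is \<subseteq> Z \<and> set js \<subseteq> Z"
    show "P' is = P' js"
    proof (cases "(P', r') = q")
      case True
      then show ?thesis using * hP[of "is" js] q by simp
    next
      case False
      then show ?thesis using * hQ[of P' r' "is" js] by simp
    qed
  qed
qed

context big_model
begin

text \<open>Saturation deals with finitely many variables at a time, so the entries are chosen one
  by one. The invariant \<open>ok\<close> says that the prefix extends to a solution of every finite
  part of the system; the next entry realizes the one-variable type asserting that this remains
  so.\<close>

lemma realize_sequence:
  fixes \<Gamma> :: "(('a list \<Rightarrow> bool) \<times> nat list) set"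
  assumes e: "set e \<subseteq> U"
    and dfn: "\<And>P js. (P, js) \<in> \<Gamma> \<Longrightarrow> dfn (length e + length js) P"
    and fin: "\<And>F. finite F \<Longrightarrow> F \<subseteq> \<Gamma> \<Longrightarrow> \<exists>s. range s \<subseteq> U \<and> (\<forall>(P, js)\<in>F. P (e @ map s js))"
  shows "\<exists>s. range s \<subseteq> U \<and> (\<forall>(P, js)\<in>\<Gamma>. P (e @ map s js))"
proof -
  define ok where "ok pre \<longleftrightarrow> set pre \<subseteq> U \<and> (\<forall>F. finite F \<and> F \<subseteq> \<Gamma> \<longrightarrow>
    (\<exists>s. range s \<subseteq> U \<and> (\<forall>i<length pre. s i = pre ! i) \<and> (\<forall>(P, js)\<in>F. P (e @ map s js))))" for pre
  have step: "\<exists>x. ok (pre @ [x])" if ok: "ok pre" for pre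
  proof -
    define lp le where "lp = length pre" and "le = length e"
    \<comment> \<open>Positions in \<open>[x] @ (e @ pre) @ t\<close>, where the new entry stands
      first as \<open>realize_definable\<close> requires: parameters shift by one, the sequence
      index \<open>lp\<close> goes to 0, and a later index \<open>i\<close> falls into
      \<open>t\<close>, at position \<open>le + i\<close> of the whole list.\<close>
    define J where "J js = map Suc [0..<le] @
        map (\<lambda>i. if i < lp then Suc (le + i) else if i = lp then 0 else le + i) js" for js
    \<comment> \<open>A strict bound for the indices in \<open>F\<close>, so that \<open>N F\<close>
      entries after the new one are enough to express solvability of \<open>F\<close>.\<close>
    define N where "N F = Suc (Max (insert 0 (\<Union>(P, js)\<in>F. set js)))" for F :: "(('a list \<Rightarrow> bool) \<times> nat list) set"
    have N: "i < N F" if "finite F" "(P, js) \<in> F" "i \<in> set js" for F P js i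
    proof -
      have "finite (insert 0 (\<Union>(P, js)\<in>F. set js))" using that by auto
      then have "i \<le> Max (insert 0 (\<Union>(P, js)\<in>F. set js))"
        using that by (intro Max_ge) (auto intro!: bexI[of _ "(P, js)"])
      then show ?thesis by (simp add: N_def)
    qed
    have J: "map ((!) ([x] @ (e @ pre) @ t)) (J js) = e @ map ((!) (pre @ [x] @ t)) js" for x t js
    proof -
      have "map ((!) ([x] @ (e @ pre) @ t)) (map Suc [0..<le]) = e"
        by (rule nth_equalityI) (auto simp: le_def nth_append)
      moreover have "([x] @ (e @ pre) @ t) ! (if i < lp then Suc (le + i) else if i = lp then 0 else le + i)
          = (pre @ [x] @ t) ! i" for i
      proof (cases "i < lp \<or> i = lp")
        case False
        then obtain j where "i = lp + Suc j" by (metis add_Suc_right less_imp_Suc_add linorder_neqE_nat)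
        then show ?thesis by (simp add: le_def lp_def nth_append)
      qed (auto simp: le_def lp_def nth_append)
      ultimately show ?thesis unfolding J_def by simp
    qed
    define R where "R F u \<longleftrightarrow> (\<exists>t\<in>tuples M (N F). \<forall>(P, js)\<in>F. P (map ((!) (u @ t)) (J js)))"
      for F :: "(('a list \<Rightarrow> bool) \<times> nat list) set" and u
    define \<Delta> where "\<Delta> = {(R F, e @ pre) | F. finite F \<and> F \<subseteq> \<Gamma>}"
    have "\<exists>x\<in>tuples M 1. \<forall>(P, w)\<in>\<Delta>. P (x @ w)"
    proof (rule realize_definable)
      show "countable (set (e @ pre))" "set (e @ pre) \<subseteq> U"
        using e ok by (auto simp: ok_def countable_finite)
      fix P w assume "(P, w) \<in> \<Delta>"
      then obtain F where F: "P = R F" "w = e @ pre" "finite F" "F \<subseteq> \<Gamma>" by (auto simp: \<Delta>_def)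
      have "dfn ((1 + length w) + N F) (\<lambda>u. \<forall>z\<in>F. fst z (map ((!) u) (J (snd z))))"
      proof (rule definable_Ball[OF F(3)])
        fix z assume z: "z \<in> F"
        obtain Q js where zz: "z = (Q, js)" by (cases z)
        have "dfn (length (J js)) Q" using dfn[of Q js] z zz F(4) by (auto simp: J_def le_def)
        moreover have "set (J js) \<subseteq> {..<(1 + length w) + N F}"
          using N[OF F(3), of Q js] z zz by (fastforce simp: J_def F(2) lp_def le_def)
        ultimately show "dfn ((1 + length w) + N F) (\<lambda>u. fst z (map ((!) u) (J (snd z))))"
          unfolding zz fst_conv snd_conv by (rule definable_reindex)
      qed
      then have "dfn (1 + length w) (\<lambda>u. \<exists>t\<in>tuples M (N F). \<forall>z\<in>F. fst z (map ((!) (u @ t)) (J (snd z))))"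
        by (rule definable_Ex_append)
      then have "dfn (1 + length w) P"
        by (rule definable_cong) (auto simp: F(1) R_def split_def)
      then show "set w \<subseteq> set (e @ pre) \<and> dfn (1 + length w) P" using F(2) by simp
    next
      fix G assume G: "finite G" "G \<subseteq> \<Delta>"
      have "\<Delta> = (\<lambda>F. (R F, e @ pre)) ` {F. finite F \<and> F \<subseteq> \<Gamma>}" by (auto simp: \<Delta>_def)
      from finite_subset_image[OF G(1) G(2)[unfolded this]]
      obtain \<F> where \<F>: "\<F> \<subseteq> {F. finite F \<and> F \<subseteq> \<Gamma>}" "finite \<F>" "G = (\<lambda>F. (R F, e @ pre)) ` \<F>"
        by (elim exE conjE)
      then have "finite (\<Union>\<F>)" "\<Union>\<F> \<subseteq> \<Gamma>" by auto
      then obtain s where s: "range s \<subseteq> U" "\<forall>i<length pre. s i = pre ! i" "\<forall>(P, js)\<in>\<Union>\<F>. P (e @ map s js)"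
        using ok unfolding ok_def by meson
      have "R F ([s lp] @ e @ pre)" if F: "F \<in> \<F>" for F
        unfolding R_def
      proof
        let ?t = "map s [Suc lp..<Suc lp + N F]"
        show "?t \<in> tuples M (N F)" using s(1) by (auto simp: tuples_iff)
        have "map ((!) (([s lp] @ e @ pre) @ ?t)) (J js) = e @ map s js" if js: "(P, js) \<in> F" for P js
        proof -
          have "(pre @ [s lp] @ ?t) ! i = s i" if "i \<in> set js" for i
          proof -
            have "i < N F" using N[of F P js i] F js that \<F>(1) by auto
            have "pre @ [s lp] @ ?t = map s [0..<Suc lp + N F]"
            proof -
              have "pre = map s [0..<lp]" using s(2) by (intro nth_equalityI) (auto simp: lp_def)
              moreover have "[0..<Suc lp + N F] = [0..<lp] @ [lp] @ [Suc lp..<Suc lp + N F]"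
                using upt_add_eq_append[of 0 "Suc lp" "N F"] by simp
              ultimately show ?thesis by simp
            qed
            then have "(pre @ [s lp] @ ?t) ! i = map s [0..<Suc lp + N F] ! i" by (rule arg_cong)
            also have "\<dots> = s i" using \<open>i < N F\<close> by (subst nth_map) (simp_all del: upt_Suc)
            finally show ?thesis .
          qed
          then show ?thesis using J[of "s lp" ?t js] by simp
        qed
        then show "\<forall>(P, js)\<in>F. P (map ((!) (([s lp] @ e @ pre) @ ?t)) (J js))"
          using s(3) F by force
      qed
      then show "\<exists>x\<in>tuples M 1. \<forall>(P, w)\<in>G. P (x @ w)"
        using s(1) by (intro bexI[of _ "[s lp]"]) (auto simp: \<F>(3) tuples_iff)
    qed
    then obtain x where x: "[x] \<in> tuples M 1" "\<forall>(P, w)\<in>\<Delta>. P ([x] @ w)"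
      by (metis One_nat_def Suc_length_conv length_0_conv tuples_iff)
    have "ok (pre @ [x])"
      unfolding ok_def
    proof (intro conjI allI impI)
      show "set (pre @ [x]) \<subseteq> U" using ok x by (auto simp: ok_def tuples_iff)
      fix F assume F: "finite F \<and> F \<subseteq> \<Gamma>"
      then have "R F ([x] @ e @ pre)" using x(2) by (auto simp: \<Delta>_def)
      then obtain t where t: "t \<in> tuples M (N F)" "\<forall>(P, js)\<in>F. P (map ((!) (([x] @ e @ pre) @ t)) (J js))"
        unfolding R_def by blast
      \<comment> \<open>Beyond the indices occurring in \<open>F\<close> the value \<open>x\<close>
        only keeps the sequence inside the universe.\<close>
      let ?s = "\<lambda>i. if i < Suc lp + N F then (pre @ [x] @ t) ! i else x"
      have len: "length (pre @ [x] @ t) = Suc lp + N F" using t by (simp add: tuples_iff lp_def)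
      have "set (pre @ [x] @ t) \<subseteq> U" using ok x(1) t(1) by (auto simp: ok_def tuples_iff)
      then have "(pre @ [x] @ t) ! i \<in> U" if "i < Suc lp + N F" for i
        using that len by (metis nth_mem subsetD)
      then have "range ?s \<subseteq> U" using x(1) by (auto simp: tuples_iff)
      moreover have "\<forall>i<length (pre @ [x]). ?s i = (pre @ [x]) ! i"
        by (auto simp: lp_def nth_append)
      moreover have "P (e @ map ?s js)" if js: "(P, js) \<in> F" for P js
      proof -
        have "map ?s js = map ((!) (pre @ [x] @ t)) js" using N[of F P js] F js by fastforce
        moreover have "P (map ((!) (([x] @ e @ pre) @ t)) (J js))" using t(2) js by blast
        ultimately show ?thesis using J[of x t js] by (metis append_assoc)
      qed
      ultimately show "\<exists>s. range s \<subseteq> U \<and> (\<forall>i<length (pre @ [x]). s i = (pre @ [x]) ! i) \<and>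
          (\<forall>(P, js)\<in>F. P (e @ map s js))"
        by (intro exI[of _ ?s]) auto
    qed
    then show ?thesis ..
  qed
  define pre where "pre = rec_nat [] (\<lambda>_ p. p @ [SOME x. ok (p @ [x])])"
  have pre_simps: "pre 0 = []" "pre (Suc n) = pre n @ [SOME x. ok (pre n @ [x])]" for n
    by (auto simp: pre_def)
  have ok_pre: "ok (pre n)" for n
  proof (induction n)
    case 0
    then show ?case using fin by (auto simp: pre_simps ok_def)
  next
    case (Suc n)
    show ?case unfolding pre_simps using someI_ex[OF step[OF Suc]] .
  qed
  have len: "length (pre n) = n" for n by (induction n) (auto simp: pre_simps)
  define s where "s i = pre (Suc i) ! i" for i
  have pre_s: "pre n ! i = s i" if "i < n" for i n
    using that
  proof (induction n)
    case (Suc n)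
    then show ?case
      by (cases "i = n") (auto simp: s_def, simp add: pre_simps nth_append len)
  qed simp
  have "range s \<subseteq> U"
  proof
    fix y assume "y \<in> range s"
    then obtain i where "y = pre (Suc i) ! i" by (auto simp: s_def)
    then show "y \<in> U" using ok_pre[of "Suc i"] len[of "Suc i"] nth_mem[of i "pre (Suc i)"] by (auto simp: ok_def)
  qed
  moreover have "P (e @ map s js)" if P: "(P, js) \<in> \<Gamma>" for P js
  proof -
    let ?n = "Suc (Max (insert 0 (set js)))"
    have n: "i < ?n" if "i \<in> set js" for i using that by (simp add: less_Suc_eq_le)
    obtain s' where s': "\<forall>i<length (pre ?n). s' i = pre ?n ! i" "P (e @ map s' js)"
      using ok_pre[of ?n] P unfolding ok_def by (auto dest!: spec[of _ "{(P, js)}"])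
    then have "map s' js = map s js" using n pre_s len by auto
    then show ?thesis using s'(2) by metis
  qed
  ultimately show ?thesis by blast
qed

text \<open>The parameters are a list in front of the blocks, so that a single definable predicate
  sees both. As \<open>is\<close> and \<open>js\<close> may be exchanged, the implication amounts to
  an equivalence.\<close>

definition indisc :: "nat \<Rightarrow> 'a list \<Rightarrow> (nat \<Rightarrow> 'a list) \<Rightarrow> bool" where
  "indisc m e b \<longleftrightarrow> (\<forall>i. b i \<in> tuples M m) \<and>
     (\<forall>P is js. sorted_wrt (<) is \<and> sorted_wrt (<) js \<and> length is = length js \<and>
        dfn (length e + length is * m) P \<longrightarrow> P (e @ concat (map b is)) \<longrightarrow> P (e @ concat (map b js)))"

text \<open>\<open>b'\<close> satisfies the Ehrenfeucht--Mostowski type of \<open>b\<close> over \<open>e\<close>.\<close>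

definition EM_le :: "nat \<Rightarrow> 'a list \<Rightarrow> (nat \<Rightarrow> 'a list) \<Rightarrow> (nat \<Rightarrow> 'a list) \<Rightarrow> bool" where
  "EM_le m e b b' \<longleftrightarrow> (\<forall>P r. dfn (length e + r * m) P \<and>
      (\<forall>is. sorted_wrt (<) is \<and> length is = r \<longrightarrow> P (e @ concat (map b is))) \<longrightarrow>
      (\<forall>is. sorted_wrt (<) is \<and> length is = r \<longrightarrow> P (e @ concat (map b' is))))"

lemma EM_leD:
  assumes "EM_le m e b b'" "dfn (length e + r * m) P"
    "\<And>js. sorted_wrt (<) js \<Longrightarrow> length js = r \<Longrightarrow> P (e @ concat (map b js))"
    "sorted_wrt (<) is" "length is = r"
  shows "P (e @ concat (map b' is))"
  using assms unfolding EM_le_def by blast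

lemma length_concat_blocks: "(\<And>i. length (b i) = m) \<Longrightarrow> length (concat (map b is)) = length is * m"
  by (induction "is") auto

text \<open>Compactness: a finite part of the system involves finitely many predicates, and by
  Ramsey's theorem some subsequence of \<open>b\<close> is homogeneous for them and solves
  it.\<close>

lemma extract_indisc:
  assumes b: "\<And>i. b i \<in> tuples M m" and e: "set e \<subseteq> U"
  shows "\<exists>b'. indisc m e b' \<and> EM_le m e b b'"
proof -
  define le where "le = length e"
  \<comment> \<open>The sequence of \<open>m\<close>-tuples is unravelled into a sequence of
    elements, to which \<open>realize_sequence\<close> applies.\<close>
  define idx where "idx is = concat (map (\<lambda>l. [l * m..<l * m + m]) is)" for "is" :: "nat list"
  define blk where "blk s l = map s [l * m..<l * m + m]" for s :: "nat \<Rightarrow> 'a" and l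
  have blk: "concat (map (blk s) is) = map s (idx is)" for s "is"
    by (induction "is") (auto simp: blk_def idx_def)
  have lidx: "length (idx is) = length is * m" for "is"
    unfolding idx_def by (induction "is") auto
  \<comment> \<open>To be read on \<open>e\<close> followed by two groups of \<open>r\<close>
    blocks: \<open>P\<close> has the same truth value on \<open>e\<close> with the first group as on
    \<open>e\<close> with the second.\<close>
  define eqp where "eqp P r = (\<lambda>u. P (take (le + r * m) u) \<longleftrightarrow> P (take le u @ drop (le + r * m) u))"
    for P :: "'a list \<Rightarrow> bool" and r :: nat
  \<comment> \<open>\<open>\<Gamma>1\<close> imposes the Ehrenfeucht-Mostowski type of
    \<open>b\<close>, and \<open>\<Gamma>2\<close> imposes indiscernibility.\<close>
  define \<Gamma>1 where "\<Gamma>1 = {(P, idx is) | P is. sorted_wrt (<) is \<and> dfn (le + length is * m) P \<and>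
      (\<forall>js. sorted_wrt (<) js \<and> length js = length is \<longrightarrow> P (e @ concat (map b js)))}"
  define T where "T = {(P, is :: nat list, js :: nat list). sorted_wrt (<) is \<and> sorted_wrt (<) js \<and> length is = length js \<and>
      dfn (le + length is * m) P}"
  define \<Gamma>2 where "\<Gamma>2 = (\<lambda>(P, is, js). (eqp P (length is), idx is @ idx js)) ` T"
  have "\<exists>s. range s \<subseteq> U \<and> (\<forall>(P, js)\<in>\<Gamma>1 \<union> \<Gamma>2. P (e @ map s js))"
  proof (rule realize_sequence[OF e])
    fix Q ks assume "(Q, ks) \<in> \<Gamma>1 \<union> \<Gamma>2"
    then consider "(Q, ks) \<in> \<Gamma>1" | "(Q, ks) \<in> \<Gamma>2" by blast
    then show "dfn (length e + length ks) Q"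
    proof cases
      case 1
      then show ?thesis by (auto simp: \<Gamma>1_def lidx le_def)
    next
      case 2
      then obtain P "is" js where *: "Q = eqp P (length is)" "ks = idx is @ idx js" "length is = length js"
          "dfn (le + length is * m) P" by (auto simp: \<Gamma>2_def T_def)
      have l: "length e + length ks = le + length is * m + length is * m" using * by (simp add: lidx le_def)
      have "dfn (le + length is * m + length is * m) (\<lambda>u. P (take (le + length is * m) u))"
        by (rule definable_select[OF *(4), of "[0..<le + length is * m]"])
          (auto simp: tuples_iff take_eq_map_nth)
      moreover have "dfn (le + length is * m + length is * m) (\<lambda>u. P (take le u @ drop (le + length is * m) u))"
        by (rule definable_select[OF *(4), of "[0..<le] @ [le + length is * m..<le + length is * m + length is * m]"])
          (auto simp: tuples_iff take_eq_map_nth drop_eq_map_nth)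
      ultimately show ?thesis unfolding *(1) eqp_def l by (rule definable_iff)
    qed
  next
    fix F assume F: "finite F" "F \<subseteq> \<Gamma>1 \<union> \<Gamma>2"
    have fin2: "finite (F \<inter> \<Gamma>2)"
      and sub2: "F \<inter> \<Gamma>2 \<subseteq> (\<lambda>(P, is, js). (eqp P (length is), idx is @ idx js)) ` T"
      using F(1) by (simp, simp add: \<Gamma>2_def)
    from finite_subset_image[OF fin2 sub2]
    obtain T' where T': "T' \<subseteq> T" "finite T'" "F \<inter> \<Gamma>2 = (\<lambda>(P, is, js). (eqp P (length is), idx is @ idx js)) ` T'"
      by (elim exE conjE)
    let ?\<Q> = "(\<lambda>(P, is, js). (\<lambda>ls. P (e @ concat (map b ls)), length is)) ` T'"
    have "finite ?\<Q>" using T'(2) by simp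
    from ex_homogeneous_set[OF this] obtain Y where Y: "infinite Y" "\<forall>P r is js. (P, r) \<in> ?\<Q> \<and> sorted_wrt (<) is \<and> sorted_wrt (<) js \<and>
      length is = r \<and> length js = r \<and> set is \<subseteq> Y \<and> set js \<subseteq> Y \<longrightarrow> P is = P js"
      by (elim exE conjE)
    define y where "y = enumerate Y"
    have y: "strict_mono y" "\<And>i. y i \<in> Y"
      using Y(1) by (auto simp: y_def strict_mono_enumerate enumerate_in_set)
    have sy: "sorted_wrt (<) (map y is)" if "sorted_wrt (<) is" for "is"
      using that by (induction "is") (auto simp: strict_monoD[OF y(1)])
    obtain x0 where x0: "x0 \<in> U" using U_nonempty by blast
    \<comment> \<open>For \<open>m = 0\<close> all blocks are empty and \<open>s\<close> only has to
      take values in the universe.\<close>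
    define s where "s v = (if m = 0 then x0 else b (y (v div m)) ! (v mod m))" for v
    have bl: "length (b i) = m" for i using b by (auto simp: tuples_iff)
    have sU: "range s \<subseteq> U"
    proof
      fix z assume "z \<in> range s"
      then obtain v where v: "z = s v" by blast
      have "b (y (v div m)) ! (v mod m) \<in> U" if "m \<noteq> 0"
        using b[of "y (v div m)"] that by (metis bl mod_less_divisor neq0_conv nth_mem subsetD tuples_iff)
      then show "z \<in> U" using v x0 by (auto simp: s_def)
    qed
    have "blk s l = b (y l)" for l
      by (rule nth_equalityI) (auto simp: blk_def s_def bl)
    then have "blk s = (\<lambda>l. b (y l))" by (rule ext)
    then have cs: "map s (idx is) = concat (map b (map y is))" for "is"
      by (simp add: blk[symmetric] comp_def)
    have "P (e @ map s js)" if "(P, js) \<in> F" for P js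
    proof (cases "(P, js) \<in> \<Gamma>1")
      case True
      then obtain "is" where "js = idx is" "sorted_wrt (<) is"
        "\<forall>js. sorted_wrt (<) js \<and> length js = length is \<longrightarrow> P (e @ concat (map b js))"
        by (auto simp: \<Gamma>1_def)
      then show ?thesis using sy by (metis cs length_map)
    next
      case False
      then have "(P, js) \<in> F \<inter> \<Gamma>2" using that F by auto
      then obtain Q i1 i2 where q: "(Q, i1, i2) \<in> T'" "P = eqp Q (length i1)" "js = idx i1 @ idx i2"
        unfolding T'(3) by auto
      then have t: "sorted_wrt (<) i1" "sorted_wrt (<) i2" "length i1 = length i2"
        using T'(1) by (auto simp: T_def)
      have in_Q: "(\<lambda>ls. Q (e @ concat (map b ls)), length i1) \<in> ?\<Q>" using q(1) by force
      have "Q (e @ concat (map b (map y i1))) = Q (e @ concat (map b (map y i2)))"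
        using Y(2)[rule_format, of "\<lambda>ls. Q (e @ concat (map b ls))" "length i1" "map y i1" "map y i2"]
          in_Q sy[OF t(1)] sy[OF t(2)] t(3) y(2) by auto
      moreover have "length (map s (idx i1)) = length i1 * m" by (simp add: lidx)
      ultimately have "eqp Q (length i1) (e @ map s (idx i1) @ map s (idx i2))"
        unfolding cs[symmetric] eqp_def le_def by simp
      then show ?thesis unfolding q(2,3) map_append .
    qed
    then show "\<exists>s. range s \<subseteq> U \<and> (\<forall>(P, js)\<in>F. P (e @ map s js))" using sU by blast
  qed
  then obtain s where s: "range s \<subseteq> U" "\<And>P js. (P, js) \<in> \<Gamma>1 \<union> \<Gamma>2 \<Longrightarrow> P (e @ map s js)" by blast
  have "indisc m e (blk s)"
    unfolding indisc_def
  proof (intro conjI allI impI)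
    show "blk s i \<in> tuples M m" for i using s(1) by (auto simp: blk_def tuples_iff)
    fix P and "is" js :: "nat list" assume *: "sorted_wrt (<) is \<and> sorted_wrt (<) js \<and> length is = length js \<and>
        dfn (length e + length is * m) P" "P (e @ concat (map (blk s) is))"
    then have "(P, is, js) \<in> T" unfolding T_def le_def by blast
    then have "(eqp P (length is), idx is @ idx js) \<in> \<Gamma>2"
      unfolding \<Gamma>2_def by (rule image_eqI[rotated]) simp
    then have "eqp P (length is) (e @ map s (idx is @ idx js))" using s(2) by blast
    then show "P (e @ concat (map (blk s) js))"
      using * by (simp add: blk eqp_def le_def lidx)
  qed
  moreover have "EM_le m e b (blk s)"
    unfolding EM_le_def
  proof (intro allI impI)
    fix P r and "is" :: "nat list" assume *: "dfn (length e + r * m) P \<and>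
       (\<forall>is. sorted_wrt (<) is \<and> length is = r \<longrightarrow> P (e @ concat (map b is)))" "sorted_wrt (<) is \<and> length is = r"
    then have "(P, idx is) \<in> \<Gamma>1" by (auto simp: \<Gamma>1_def le_def)
    then show "P (e @ concat (map (blk s) is))" using s(2)[of P "idx is"] by (simp add: blk)
  qed
  ultimately show ?thesis by blast
qed

section \<open>Dividing\<close>

definition k_contradictory :: "nat \<Rightarrow> nat \<Rightarrow> ('a list \<Rightarrow> bool) \<Rightarrow> (nat \<Rightarrow> 'a list) \<Rightarrow> bool" where
  "k_contradictory k n P c \<longleftrightarrow> (\<forall>K. finite K \<and> card K = k \<longrightarrow> \<not> (\<exists>x\<in>tuples M n. \<forall>i\<in>K. P (x @ c i)))"

text \<open>The degree \<open>k\<close> is kept explicit because the tree property asks for one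
  \<open>k\<close> at all nodes, so the chains from which the tree is built must share it.\<close>

definition k_divides :: "nat \<Rightarrow> nat \<Rightarrow> ('a list \<Rightarrow> bool) \<Rightarrow> 'a list \<Rightarrow> 'a set \<Rightarrow> bool" where
  "k_divides k n P b A \<longleftrightarrow>
     (\<exists>c. (\<forall>i. c i \<in> tuples M (length b) \<and> conjugate A (c i) b) \<and> k_contradictory k n P c)"

lemma k_divides_in_U: "k_divides k n P b A \<Longrightarrow> set b \<subseteq> U"
  by (metis conjugate_tuples k_divides_def tuples_iff)

lemma k_contradictory_mono:
  assumes "k_contradictory k n P c" "k \<le> k'" shows "k_contradictory k' n P c"
  unfolding k_contradictory_def
proof (intro allI impI notI)
  fix K assume K: "finite K \<and> card K = k'" "\<exists>x\<in>tuples M n. \<forall>i\<in>K. P (x @ c i)"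
  then obtain K' where "K' \<subseteq> K" "card K' = k" "finite K'"
    using assms(2) by (metis obtain_subset_with_card_n)
  then show False using K(2) assms(1) unfolding k_contradictory_def by blast
qed

lemma k_divides_mono_k: "k_divides k n P b A \<Longrightarrow> k \<le> k' \<Longrightarrow> k_divides k' n P b A"
  unfolding k_divides_def using k_contradictory_mono by meson

lemma k_divides_mono_base: "k_divides k n P b A \<Longrightarrow> B \<subseteq> A \<Longrightarrow> k_divides k n P b B"
  unfolding k_divides_def using conjugate_mono by meson

lemma k_contradictory_aut:
  assumes "aut g" "\<And>i. c i \<in> tuples M m" "dfn (n + m) P" "k_contradictory k n P c"
  shows "k_contradictory k n P (\<lambda>i. map g (c i))"
  unfolding k_contradictory_def
proof (intro allI impI notI)
  fix K assume K: "finite K \<and> card K = k" "\<exists>x\<in>tuples M n. \<forall>i\<in>K. P (x @ map g (c i))"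
  then obtain x where x: "x \<in> tuples M n" "\<forall>i\<in>K. P (x @ map g (c i))" by blast
  obtain h where h: "aut h" "\<And>x. x \<in> U \<Longrightarrow> g (h x) = x" using aut_inverse[OF assms(1)] by metis
  have hx: "map h x \<in> tuples M n" by (rule aut_tuples[OF h(1) x(1)])
  have "map g (map h x) = x" using x(1) h(2) by (auto simp: tuples_iff subset_iff intro!: map_idI)
  moreover have "P (map g (map h x @ c i)) \<longleftrightarrow> P (map h x @ c i)" for i
    by (rule aut_definable[OF assms(1,3)]) (use hx assms(2)[of i] in \<open>auto simp: tuples_iff\<close>)
  ultimately have "\<forall>i\<in>K. P (map h x @ c i)" using x(2) by (simp only: map_append)
  then show False using K(1) assms(4) hx unfolding k_contradictory_def by blast
qed

lemma k_divides_aut: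
  assumes g: "aut g" and P: "dfn (n + length b) P" and A: "A \<subseteq> U" and "k_divides k n P b A"
  shows "k_divides k n P (map g b) (g ` A)"
proof -
  obtain c where c: "\<And>i. c i \<in> tuples M (length b)" "\<And>i. conjugate A (c i) b" "k_contradictory k n P c"
    using assms(4) by (auto simp: k_divides_def)
  obtain h where h: "aut h" "\<And>x. x \<in> U \<Longrightarrow> h (g x) = x" using aut_inverse[OF g] by metis
  have "conjugate (g ` A) (map g (c i)) (map g b)" for i
  proof -
    obtain f where f: "aut f" "\<forall>x\<in>A. f x = x" "map f (c i) = b" using c(2) by (auto simp: conjugate_def)
    have "aut (\<lambda>x. g (f (h x)))" using aut_comp[OF g aut_comp[OF f(1) h(1)]] .
    moreover have "\<forall>x\<in>g ` A. g (f (h x)) = x" using f(2) h(2) A by auto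
    moreover have "map (\<lambda>x. g (f (h x))) (map g (c i)) = map g b"
      using f(3) h(2) c(1)[of i] by (auto simp: tuples_iff subset_iff)
    ultimately show ?thesis unfolding conjugate_def by blast
  qed
  then show ?thesis unfolding k_divides_def
    using c(1) k_contradictory_aut[OF g c(1) P c(3)] aut_tuples[OF g c(1)]
    by (intro exI[of _ "\<lambda>i. map g (c i)"]) auto
qed

lemma k_contradictory_iff_sorted:
  "k_contradictory k n P c \<longleftrightarrow> (\<forall>is. sorted_wrt (<) is \<and> length is = k \<longrightarrow>
      \<not> (\<exists>x\<in>tuples M n. \<forall>i\<in>set is. P (x @ c i)))"
proof
  assume "k_contradictory k n P c"
  then show "\<forall>is. sorted_wrt (<) is \<and> length is = k \<longrightarrow> \<not> (\<exists>x\<in>tuples M n. \<forall>i\<in>set is. P (x @ c i))"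
    unfolding k_contradictory_def by (metis List.finite_set distinct_card strict_sorted_iff)
next
  assume *: "\<forall>is. sorted_wrt (<) is \<and> length is = k \<longrightarrow> \<not> (\<exists>x\<in>tuples M n. \<forall>i\<in>set is. P (x @ c i))"
  show "k_contradictory k n P c"
    unfolding k_contradictory_def
  proof (intro allI impI)
    fix K :: "nat set" assume "finite K \<and> card K = k"
    then show "\<not> (\<exists>x\<in>tuples M n. \<forall>i\<in>K. P (x @ c i))"
      using *[rule_format, of "sorted_list_of_set K"] by (auto simp: strict_sorted_list_of_set)
  qed
qed

text \<open>Here \<open>u\<close> is a parameter tuple of length \<open>l\<close> followed by
  \<open>k\<close> blocks of length \<open>m\<close>. As this is a definable condition on
  \<open>u\<close>, joint solvability can be transferred by indiscernibility and by
  \<open>EM_le\<close>.\<close>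

definition common :: "nat \<Rightarrow> nat \<Rightarrow> nat \<Rightarrow> nat \<Rightarrow> ('a list \<Rightarrow> bool) \<Rightarrow> 'a list \<Rightarrow> bool" where
  "common l m k n Q u \<longleftrightarrow>
     (\<exists>x\<in>tuples M n. \<forall>j\<in>{..<k}. Q (x @ take l u @ take m (drop (l + j * m) u)))"

lemma definable_common:
  assumes "dfn (n + (l + m)) Q" shows "dfn (l + k * m) (common l m k n Q)"
proof -
  have "dfn (n + (l + k * m)) (\<lambda>w. \<forall>j\<in>{..<k}. Q (take n w @ take l (drop n w) @ take m (drop (n + l + j * m) w)))"
  proof (rule definable_Ball)
    fix j assume jk: "j \<in> {..<k}"
    then have "Suc j * m \<le> k * m" by (intro mult_le_mono1) auto
    then have j: "j * m + m \<le> k * m" by simp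
    show "dfn (n + (l + k * m)) (\<lambda>w. Q (take n w @ take l (drop n w) @ take m (drop (n + l + j * m) w)))"
    proof (rule definable_select[OF assms, of "[0..<n] @ [n..<n + l] @ [n + l + j * m..<n + l + j * m + m]"])
      fix w assume w: "w \<in> tuples M (n + (l + k * m))"
      have "take l (drop n w) = map ((!) w) [n..<n + l]"
        using w by (intro nth_equalityI) (auto simp: tuples_iff)
      moreover have "take m (drop (n + l + j * m) w) = map ((!) w) [n + l + j * m..<n + l + j * m + m]"
        using w j jk by (intro nth_equalityI) (auto simp: tuples_iff intro!: nth_drop)
      ultimately show "take n w @ take l (drop n w) @ take m (drop (n + l + j * m) w) =
          map ((!) w) ([0..<n] @ [n..<n + l] @ [n + l + j * m..<n + l + j * m + m])"
        using w by (simp add: tuples_iff take_eq_map_nth)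
    qed (use j in auto)
  qed simp
  then have "dfn (l + k * m) (\<lambda>u. \<exists>x\<in>tuples M n. \<forall>j\<in>{..<k}.
      Q (take n (x @ u) @ take l (drop n (x @ u)) @ take m (drop (n + l + j * m) (x @ u))))"
    by (rule definable_Ex)
  then show ?thesis
    by (rule definable_cong) (auto simp: common_def tuples_iff)
qed

lemma take_drop_blocks:
  assumes "\<And>i. length (c i) = m" "j < length is"
  shows "take m (drop (j * m) (concat (map c is))) = c (is ! j)"
  using assms(2)
proof (induction "is" arbitrary: j)
  case (Cons a js)
  then show ?case using assms(1) by (cases j) auto
qed simp

lemma common_blocks:
  assumes "\<And>i. length (c i) = m" "length e = l" "length is = k"
  shows "common l m k n Q (e @ concat (map c is)) \<longleftrightarrow> (\<exists>x\<in>tuples M n. \<forall>i\<in>set is. Q (x @ e @ c i))"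
proof -
  have "(\<forall>j\<in>{..<k}. Q (x @ take l (e @ concat (map c is)) @ take m (drop (l + j * m) (e @ concat (map c is)))))
     \<longleftrightarrow> (\<forall>i\<in>set is. Q (x @ e @ c i))" for x
    using assms take_drop_blocks[where c = c, OF assms(1)] by (auto simp: all_set_conv_all_nth)
  then show ?thesis unfolding common_def by simp
qed

text \<open>Unsolvability for every increasing choice of \<open>k\<close> members is a definable
  condition met by all of them, hence part of the Ehrenfeucht-Mostowski type.\<close>

lemma EM_le_no_common:
  assumes EM: "EM_le m e c c'" and c: "\<And>i. length (c i) = m" "\<And>i. length (c' i) = m"
    and Q: "dfn (n + (length e + m)) Q"
    and no: "\<And>js. sorted_wrt (<) js \<Longrightarrow> length js = k \<Longrightarrow> \<not> (\<exists>x\<in>tuples M n. \<forall>i\<in>set js. Q (x @ e @ c i))"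
    and S: "sorted_wrt (<) is" "length is = k"
  shows "\<not> (\<exists>x\<in>tuples M n. \<forall>i\<in>set is. Q (x @ e @ c' i))"
proof -
  have "\<not> common (length e) m k n Q (e @ concat (map c' is))"
  proof (rule EM_leD[OF EM definable_not[OF definable_common[OF Q]] _ S])
    fix js :: "nat list" assume "sorted_wrt (<) js" "length js = k"
    then show "\<not> common (length e) m k n Q (e @ concat (map c js))"
      using no[of js] common_blocks[where c = c and e = e and Q = Q and n = n, OF c(1) refl, of js k] by simp
  qed
  then show ?thesis using common_blocks[where c = c' and e = e and Q = Q and n = n, OF c(2) refl S(2)] by simp
qed

lemma definable_skip:
  assumes "dfn (n + m) P" shows "dfn (n + (l + m)) (\<lambda>u. P (take n u @ drop (n + l) u))"
proof (rule definable_select[OF assms, of "[0..<n] @ [n + l..<n + (l + m)]"])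
  fix u assume "u \<in> tuples M (n + (l + m))"
  then show "take n u @ drop (n + l) u = map ((!) u) ([0..<n] @ [n + l..<n + (l + m)])"
    by (simp add: tuples_iff take_eq_map_nth drop_eq_map_nth)
qed auto

lemma EM_le_k_contradictory:
  assumes EM: "EM_le m e c c'" and c: "\<And>i. length (c i) = m" "\<And>i. length (c' i) = m"
    and P: "dfn (n + m) P" and "k_contradictory k n P c"
  shows "k_contradictory k n P c'"
proof -
  let ?Q = "\<lambda>u. P (take n u @ drop (n + length e) u)"
  have Q: "?Q (x @ e @ y) = P (x @ y)" if "x \<in> tuples M n" for x y using that by (simp add: tuples_iff)
  show ?thesis
    unfolding k_contradictory_iff_sorted
  proof (intro allI impI)
    fix "is" :: "nat list" assume S: "sorted_wrt (<) is \<and> length is = k"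
    have "\<not> (\<exists>x\<in>tuples M n. \<forall>i\<in>set is. ?Q (x @ e @ c' i))"
    proof (rule EM_le_no_common[OF EM c definable_skip[OF P]])
      fix js :: "nat list" assume "sorted_wrt (<) js" "length js = k"
      then have "\<not> (\<exists>x\<in>tuples M n. \<forall>i\<in>set js. P (x @ c i))" using assms(5) k_contradictory_iff_sorted by blast
      then show "\<not> (\<exists>x\<in>tuples M n. \<forall>i\<in>set js. ?Q (x @ e @ c i))" using Q by blast
    qed (use S in auto)
    then show "\<not> (\<exists>x\<in>tuples M n. \<forall>i\<in>set is. P (x @ c' i))" using Q by blast
  qed
qed

text \<open>A type over \<open>e\<close> shared by all members is part of the Ehrenfeucht-Mostowski
  type over the longer tuple \<open>e @ f\<close>; the predicates merely skip
  \<open>f\<close>.\<close>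

lemma EM_le_conjugate:
  assumes EM: "EM_le m (e @ f) c c'" and ef: "set (e @ f) \<subseteq> U"
    and c: "\<And>i. c i \<in> tuples M m" "\<And>i. c' i \<in> tuples M m"
    and conjugate: "\<And>i. conjugate (set e) (c i) b"
  shows "conjugate (set e) (c' i) b"
proof -
  have b: "b \<in> tuples M m" using conjugate_tuples[OF conjugate c(1)] .
  have "conjugate (set e) b (c' i)"
  proof (rule conjugate_of_equiv[OF _ b c(2)])
    fix P assume P: "dfn (length e + m) P" "P (e @ b)"
    let ?Q = "\<lambda>u. P (take (length e) u @ drop (length e + length f) u)"
    have Q: "dfn (length (e @ f) + 1 * m) ?Q" using definable_skip[OF P(1), of "length f"] by (simp add: add.assoc)
    have "?Q ((e @ f) @ concat (map c' [i]))"
    proof (rule EM_leD[OF EM Q])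
      fix js :: "nat list" assume "length js = 1"
      then obtain j where j: "js = [j]" by (metis One_nat_def length_0_conv length_Suc_conv)
      obtain g where g: "aut g" "\<forall>x\<in>set e. g x = x" "map g (c j) = b" using conjugate[of j] by (auto simp: conjugate_def)
      have "map g (e @ c j) = e @ b" using g by (auto simp: map_idI)
      moreover have "e @ c j \<in> tuples M (length e + m)" using ef c(1)[of j] by (auto simp: tuples_iff)
      ultimately have "P (e @ c j)" using aut_definable[OF g(1) P(1)] P(2) by metis
      then show "?Q ((e @ f) @ concat (map c js))" by (simp add: j)
    qed auto
    then show "P (e @ c' i)" by simp
  qed (use ef in auto)
  then show ?thesis by (rule conjugate_sym) (use b ef in \<open>auto simp: tuples_iff\<close>)
qed

lemma conjugate_of_indisc:
  assumes "indisc m e c" "set e \<subseteq> U" shows "conjugate (set e) (c i) (c j)"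
proof (rule conjugate_of_equiv[OF assms(2)])
  show "c i \<in> tuples M m" "c j \<in> tuples M m" using assms(1) by (auto simp: indisc_def)
  fix P assume P: "dfn (length e + m) P" "P (e @ c i)"
  have "dfn (length e + length [i] * m) P" using P(1) by simp
  then have "P (e @ concat (map c [i])) \<longrightarrow> P (e @ concat (map c [j]))"
    using assms(1) unfolding indisc_def by (metis length_Cons sorted_wrt1)
  then show "P (e @ c j)" using P(2) by simp
qed

lemma k_divides_indisc:
  assumes kd: "k_divides k n P b (set e)" and P: "dfn (n + length b) P" and ef: "set (e @ f) \<subseteq> U"
  shows "\<exists>c. indisc (length b) (e @ f) c \<and> k_contradictory k n P c \<and> (\<forall>i. conjugate (set e) (c i) b)"
proof -
  obtain c where c: "\<And>i. c i \<in> tuples M (length b)" "\<And>i. conjugate (set e) (c i) b" "k_contradictory k n P c"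
    using kd by (auto simp: k_divides_def)
  obtain c' where c': "indisc (length b) (e @ f) c'" "EM_le (length b) (e @ f) c c'"
    using extract_indisc[of c "length b" "e @ f"] c(1) ef by blast
  have t: "\<And>i. c' i \<in> tuples M (length b)" using c'(1) by (auto simp: indisc_def)
  have "k_contradictory k n P c'"
    by (rule EM_le_k_contradictory[OF c'(2) _ _ P c(3)]) (use c(1) t in \<open>auto simp: tuples_iff\<close>)
  moreover have "conjugate (set e) (c' i) b" for i by (rule EM_le_conjugate[OF c'(2) ef c(1) t c(2)])
  ultimately show ?thesis using c'(1) by blast
qed

text \<open>A witness of dividing over \<open>A\<close> can be chosen indiscernible over
  \<open>A \<union> C\<close>. Its members are then conjugate to the first one over the larger set,
  so the same sequence witnesses dividing of its first member there.\<close>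

lemma k_divides_extend:
  assumes kd: "k_divides k n P b A" and P: "dfn (n + length b) P" and "finite A" "A \<subseteq> U" "finite C" "C \<subseteq> U"
  shows "\<exists>b'. conjugate A b b' \<and> k_divides k n P b' (A \<union> C)"
proof -
  obtain e f where e: "set e = A" "set f = C" using assms finite_list by metis
  have ef: "set (e @ f) \<subseteq> U" using assms e by auto
  obtain c where c: "indisc (length b) (e @ f) c" "k_contradictory k n P c" "\<And>i. conjugate (set e) (c i) b"
    using k_divides_indisc[OF kd[folded e(1)] P ef] by blast
  have t: "\<And>i. c i \<in> tuples M (length b)" using c(1) by (auto simp: indisc_def)
  have "conjugate A b (c 0)" using conjugate_sym[OF c(3)] t[of 0] e assms by (auto simp: tuples_iff)
  moreover have "k_divides k n P (c 0) (A \<union> C)"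
    unfolding k_divides_def using c(2) t conjugate_of_indisc[OF c(1) ef] e by (intro exI[of _ c]) (auto simp: tuples_iff)
  ultimately show ?thesis by blast
qed

text \<open>\<open>non_dividing c A w\<close>: the type of \<open>c\<close> over \<open>w\<close> does not divide over \<open>A\<close>.\<close>

definition non_dividing :: "'a list \<Rightarrow> 'a set \<Rightarrow> 'a list \<Rightarrow> bool" where
  "non_dividing c A w \<longleftrightarrow> (\<forall>k Q. dfn (length c + length w) Q \<and> Q (c @ w) \<longrightarrow> \<not> k_divides k (length c) Q w A)"

lemma non_dividing_mono_base: "non_dividing c A w \<Longrightarrow> A \<subseteq> B \<Longrightarrow> non_dividing c B w"
  unfolding non_dividing_def using k_divides_mono_base by blast

text \<open>An automorphism over \<open>A\<close> taking \<open>w'\<close> to a member of a witness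
  carries \<open>w\<close> along. A witness for \<open>w'\<close> thus lifts to one for
  \<open>w\<close>, and the formula at \<open>w'\<close> divides also when its parameters are read
  off from \<open>w\<close>, in any order and with repetitions.\<close>

lemma non_dividing_subset:
  assumes "non_dividing c A w" "set w' \<subseteq> set w" "set w \<subseteq> U" "A \<subseteq> U"
  shows "non_dividing c A w'"
  unfolding non_dividing_def
proof (intro allI impI notI)
  let ?n = "length c"
  fix k Q assume Q: "dfn (?n + length w') Q \<and> Q (c @ w')" and kd: "k_divides k ?n Q w' A"
  have "\<forall>x\<in>set w'. \<exists>i<length w. w ! i = x" using assms(2) by (metis in_set_conv_nth subsetD)
  then obtain f where f: "\<And>x. x \<in> set w' \<Longrightarrow> f x < length w \<and> w ! f x = x" by metis
  define ids where "ids = map f w'"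
  have ids: "set ids \<subseteq> {..<length w}" "map ((!) w) ids = w'" "length ids = length w'"
    using f by (auto simp: ids_def map_idI)
  define Q' where "Q' u = Q (take ?n u @ map (\<lambda>i. u ! (?n + i)) ids)" for u
  have Q': "Q' (x @ v) = Q (x @ map ((!) v) ids)" if "x \<in> tuples M ?n" for x v
    using that by (auto simp: Q'_def tuples_iff nth_append)
  have "dfn (?n + length w) Q'"
    unfolding Q'_def
  proof (rule definable_select[where js = "[0..<?n] @ map ((+) ?n) ids"])
    show "dfn (?n + length w') Q" using Q by blast
    fix u assume "u \<in> tuples M (?n + length w)"
    then show "take ?n u @ map (\<lambda>i. u ! (?n + i)) ids = map ((!) u) ([0..<?n] @ map ((+) ?n) ids)"
      by (simp add: tuples_iff take_eq_map_nth)
  qed (use ids in auto)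
  moreover have "Q' (c @ w)" using Q ids by (simp add: Q'_def nth_append)
  moreover have "k_divides k ?n Q' w A"
  proof -
    obtain d where d: "\<And>i. d i \<in> tuples M (length w')" "\<And>i. conjugate A (d i) w'" "k_contradictory k ?n Q d"
      using kd by (auto simp: k_divides_def)
    have "\<exists>v. v \<in> tuples M (length w) \<and> conjugate A v w \<and> map ((!) v) ids = d i" for i
    proof -
      have "conjugate A w' (d i)" by (rule conjugate_sym[OF d(2)]) (use assms d(1)[of i] in \<open>auto simp: tuples_iff\<close>)
      then obtain h where h: "aut h" "\<forall>x\<in>A. h x = x" "map h w' = d i" by (auto simp: conjugate_def)
      have "conjugate A w (map h w)" using h by (auto simp: conjugate_def)
      then have "conjugate A (map h w) w" by (rule conjugate_sym) (use assms in auto)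
      moreover have "map ((!) (map h w)) ids = d i"
        using ids by (auto simp: h(3)[symmetric] ids(2)[symmetric] simp del: ids(2))
      moreover have "map h w \<in> tuples M (length w)" using aut_tuples[OF h(1)] assms(3) by (auto simp: tuples_iff aut_in[OF h(1)])
      ultimately show ?thesis by blast
    qed
    then obtain v where v: "\<And>i. v i \<in> tuples M (length w)" "\<And>i. conjugate A (v i) w" "\<And>i. map ((!) (v i)) ids = d i"
      by metis
    have "k_contradictory k ?n Q' v" using d(3) Q' v(3) unfolding k_contradictory_def by simp
    then show ?thesis unfolding k_divides_def using v by blast
  qed
  ultimately show False using assms(1) unfolding non_dividing_def by blast
qed

text \<open>A common realization \<open>c'\<close> of the conjugates of the type of \<open>c\<close> along an indiscernible witness
  makes all members of the witness conjugate over \<open>A, c'\<close>.\<close>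

lemma k_divides_over_independent:
  assumes kd: "k_divides k n P b A" and P: "dfn (n + length b) P" and A: "finite A" "A \<subseteq> U"
    and nd: "non_dividing c A w" and w: "A \<union> set b \<subseteq> set w" "set w \<subseteq> U" and c: "set c \<subseteq> U"
  shows "k_divides k n P b (A \<union> set c)"
proof -
  let ?m = "length b" and ?n = "length c"
  obtain e where e: "set e = A" using A finite_list by metis
  have eU: "set e \<subseteq> U" using e A by simp
  have bU: "set b \<subseteq> U" using w by auto
  obtain d where d: "indisc ?m e d" "k_contradictory k n P d" "\<And>i. conjugate A (d i) b"
    using k_divides_indisc[OF kd[folded e] P, of "[]"] eU e by auto
  have t: "\<And>i. d i \<in> tuples M ?m" using d(1) by (auto simp: indisc_def)
  have nd': "non_dividing c A (e @ b)" by (rule non_dividing_subset[OF nd]) (use w e A in auto)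
  \<comment> \<open>The type of \<open>c\<close> over \<open>A\<close> and \<open>b\<close>, copied
    to \<open>A\<close> and \<open>d l\<close> for all \<open>l\<close> at once.\<close>
  define \<Gamma> where "\<Gamma> = (\<lambda>(Q, l). (Q, e @ d l)) ` {(Q, l). dfn (?n + (length e + ?m)) Q \<and> Q (c @ e @ b)}"
  have "\<exists>x\<in>tuples M ?n. \<forall>(Q, v)\<in>\<Gamma>. Q (x @ v)"
  proof (rule realize_definable)
    show "countable (set e \<union> (\<Union>l. set (d l)))" by (auto simp: countable_finite)
    show "set e \<union> (\<Union>l. set (d l)) \<subseteq> U" using eU t by (auto simp: tuples_iff)
    fix Q v assume "(Q, v) \<in> \<Gamma>"
    then obtain l where "v = e @ d l" "dfn (?n + (length e + ?m)) Q" by (auto simp: \<Gamma>_def)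
    then show "set v \<subseteq> set e \<union> (\<Union>l. set (d l)) \<and> dfn (?n + length v) Q"
      using t[of l] by (auto simp: tuples_iff)
  next
    fix F assume F: "finite F" "F \<subseteq> \<Gamma>"
    from finite_subset_image[OF F(1) F(2)[unfolded \<Gamma>_def]]
    obtain T where T: "T \<subseteq> {(Q, l). dfn (?n + (length e + ?m)) Q \<and> Q (c @ e @ b)}" "finite T"
      "F = (\<lambda>(Q, l). (Q, e @ d l)) ` T" by (elim exE conjE)
    define R where "R u \<longleftrightarrow> (\<forall>z\<in>fst ` T. z u)" for u
    define K where "K = snd ` T"
    have R: "dfn (?n + (length e + ?m)) R" unfolding R_def
      by (rule definable_Ball) (use T in auto)
    have "R (c @ e @ b)" using T by (auto simp: R_def)
    \<comment> \<open>If no \<open>card K\<close> members of \<open>d\<close> allowed a common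
      solution of \<open>R\<close>, then \<open>R\<close> would divide at \<open>e @ b\<close>,
      against independence. The solution obtained for some increasing indices is then moved to
      \<open>K\<close> by indiscernibility.\<close>
    then have "\<not> k_divides (card K) ?n R (e @ b) A" using nd' R unfolding non_dividing_def by (metis length_append)
    moreover have "conjugate A (e @ d i) (e @ b)" for i
    proof -
      obtain g where "aut g" "\<forall>x\<in>A. g x = x" "map g (d i) = b" using d(3)[of i] by (auto simp: conjugate_def)
      then show ?thesis unfolding conjugate_def using e by (intro exI[of _ g]) (auto simp: map_idI)
    qed
    moreover have "e @ d i \<in> tuples M (length (e @ b))" for i using t[of i] eU by (auto simp: tuples_iff)
    ultimately have "\<not> k_contradictory (card K) ?n R (\<lambda>i. e @ d i)"
      unfolding k_divides_def by (metis (no_types, lifting))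
    then obtain "is" where S: "sorted_wrt (<) is" "length is = card K"
      "\<exists>x\<in>tuples M ?n. \<forall>i\<in>set is. R (x @ e @ d i)" unfolding k_contradictory_iff_sorted by blast
    define js where "js = sorted_list_of_set K"
    have js: "sorted_wrt (<) js" "length js = card K" "set js = K"
      using T(2) by (auto simp: js_def K_def strict_sorted_list_of_set)
    have dl: "length (d i) = ?m" for i using t by (auto simp: tuples_iff)
    have "common (length e) ?m (card K) ?n R (e @ concat (map d is))"
      using common_blocks[where c = d and e = e and Q = R and n = ?n, OF dl refl S(2)] S(3) by blast
    moreover have "dfn (length e + length is * ?m) (common (length e) ?m (card K) ?n R)"
      using definable_common[OF R] S(2) by simp
    ultimately have "common (length e) ?m (card K) ?n R (e @ concat (map d js))"
      using d(1) S(1,2) js(1,2) unfolding indisc_def by metis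
    then obtain x where "x \<in> tuples M ?n" "\<forall>i\<in>K. R (x @ e @ d i)"
      using common_blocks[where c = d and e = e and Q = R and n = ?n, OF dl refl js(2)] js(3) by blast
    then show "\<exists>x\<in>tuples M ?n. \<forall>(Q, v)\<in>F. Q (x @ v)"
      by (intro bexI[of _ x]) (force simp: T(3) K_def R_def)+
  qed
  then obtain c' where c': "c' \<in> tuples M ?n" "\<And>Q l. dfn (?n + (length e + ?m)) Q \<Longrightarrow> Q (c @ e @ b) \<Longrightarrow> Q (c' @ e @ d l)"
    unfolding \<Gamma>_def by force
  have conj: "conjugate A (d l @ c') (b @ c)" for l
  proof -
    have "conjugate (set e) (b @ c) (d l @ c')"
    proof (rule conjugate_of_equiv[OF eU, where n = "?m + ?n"])
      fix Q assume Q: "dfn (length e + (?m + ?n)) Q" "Q (e @ b @ c)"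
      have "dfn (?n + (length e + ?m)) (\<lambda>u. Q (drop ?n u @ take ?n u))"
        by (rule definable_swap) (use Q(1) in \<open>simp add: add.assoc\<close>)
      from c'(2)[OF this, of l] Q(2) c'(1) show "Q (e @ d l @ c')" by (simp add: tuples_iff)
    qed (use bU c c'(1) t[of l] in \<open>auto simp: tuples_iff\<close>)
    then show ?thesis using conjugate_sym[of "set e"] e eU bU c by auto
  qed
  \<comment> \<open>Moving \<open>c'\<close> back to \<open>c\<close> over \<open>A\<close> turns
    \<open>d\<close> into a sequence of conjugates of \<open>b\<close> over \<open>A\<close> and
    \<open>c\<close>, still \<open>k\<close>-contradictory.\<close>
  obtain h where h: "aut h" "\<forall>x\<in>A. h x = x" "map h (d 0 @ c') = b @ c" using conj[of 0] by (auto simp: conjugate_def)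
  have hc: "map h c' = c" using h(3) t[of 0] by (auto simp: tuples_iff)
  have "k_contradictory k n P (\<lambda>i. map h (d i))" by (rule k_contradictory_aut[OF h(1) t P d(2)])
  moreover have "conjugate (A \<union> set c) (map h (d i)) b" for i
  proof -
    have "conjugate A (map h (d i) @ c) (d i @ c')"
    proof (rule conjugate_sym)
      show "conjugate A (d i @ c') (map h (d i) @ c)" unfolding conjugate_def using h hc by (intro exI[of _ h]) auto
    qed (use A t[of i] c'(1) in \<open>auto simp: tuples_iff\<close>)
    from conjugate_trans[OF this conj[of i]] obtain g where g: "aut g" "\<forall>x\<in>A. g x = x"
      "map g (map h (d i) @ c) = b @ c" by (auto simp: conjugate_def)
    have "map g (map h (d i)) = b" "map g c = c" using g(3) t[of i] by (auto simp: tuples_iff)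
    then have "\<forall>x\<in>set c. g x = x" by (metis map_eq_conv map_idI list.map_ident)
    then show ?thesis using g(1,2) \<open>map g (map h (d i)) = b\<close> unfolding conjugate_def by blast
  qed
  moreover have "map h (d i) \<in> tuples M ?m" for i by (rule aut_tuples[OF h(1) t])
  ultimately show ?thesis unfolding k_divides_def by (intro exI[of _ "\<lambda>i. map h (d i)"]) simp
qed

section \<open>Dividing chains and the tree property\<close>

text \<open>The greatest length of a chain with labels in a given finite set plays the role of a
  local dividing rank of the type of \<open>x\<close> over \<open>A\<close>.\<close>

primrec chain :: "nat \<Rightarrow> nat \<Rightarrow> 'a set \<Rightarrow> 'a list \<Rightarrow> (('a list \<Rightarrow> bool) \<times> 'a list) list \<Rightarrow> bool" where
  "chain k n A x [] \<longleftrightarrow> True"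
| "chain k n A x (p # ps) \<longleftrightarrow> dfn (n + length (snd p)) (fst p) \<and> fst p (x @ snd p) \<and>
     k_divides k n (fst p) (snd p) A \<and> chain k n (A \<union> set (snd p)) x ps"

text \<open>What remains of an entry when automorphisms move its parameters; bounds on the length of
  chains depend on the labels alone.\<close>

definition label :: "('a list \<Rightarrow> bool) \<times> 'a list \<Rightarrow> ('a list \<Rightarrow> bool) \<times> nat" where
  "label p = (fst p, length (snd p))"

lemma chain_mono: "chain k n A x ps \<Longrightarrow> B \<subseteq> A \<Longrightarrow> chain k n B x ps"
proof (induction ps arbitrary: A B)
  case (Cons p ps)
  have "chain k n (B \<union> set (snd p)) x ps" by (rule Cons.IH[of "A \<union> set (snd p)"]) (use Cons.prems in auto)
  then show ?case using Cons.prems k_divides_mono_base by auto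
qed simp

lemma chain_append:
  "chain k n A x (ps @ qs) \<longleftrightarrow> chain k n A x ps \<and> chain k n (A \<union> (\<Union>p\<in>set ps. set (snd p))) x qs"
  by (induction ps arbitrary: A) (auto simp: Un_assoc)

text \<open>Deleting entries shrinks the bases of the later ones, and dividing passes to smaller
  bases.\<close>

lemma chain_filter: "chain k n A x ps \<Longrightarrow> chain k n A x (filter f ps)"
proof (induction ps arbitrary: A)
  case (Cons p ps)
  then have "chain k n (A \<union> set (snd p)) x (filter f ps)" by simp
  then show ?case using Cons.prems chain_mono[of k n "A \<union> set (snd p)" x "filter f ps" A] by auto
qed simp

lemma chain_aut:
  assumes g: "aut g" and x: "x \<in> tuples M n"
  shows "A \<subseteq> U \<Longrightarrow> chain k n A x ps \<Longrightarrow> chain k n (g ` A) (map g x) (map (\<lambda>p. (fst p, map g (snd p))) ps)"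
proof (induction ps arbitrary: A)
  case (Cons p ps)
  have c: "set (snd p) \<subseteq> U" by (rule k_divides_in_U) (use Cons.prems in auto)
  have "chain k n (g ` (A \<union> set (snd p))) (map g x) (map (\<lambda>p. (fst p, map g (snd p))) ps)"
    by (rule Cons.IH) (use Cons.prems c in auto)
  moreover have "fst p (map g (x @ snd p)) \<longleftrightarrow> fst p (x @ snd p)"
    by (rule aut_definable[OF g, of "n + length (snd p)"]) (use Cons.prems c x in \<open>auto simp: tuples_iff\<close>)
  moreover have "k_divides k n (fst p) (map g (snd p)) (g ` A)"
    by (rule k_divides_aut[OF g]) (use Cons.prems in auto)
  ultimately show ?case using Cons.prems by (simp add: image_Un)
qed simp

lemma label_map: "map label (map (\<lambda>p. (fst p, map g (snd p))) ps) = map label ps"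
  by (simp add: label_def)

lemma chain_conjugate:
  assumes "chain k n A x ps" "conjugate A x y" "A \<subseteq> U" "x \<in> tuples M n"
  shows "\<exists>qs. chain k n A y qs \<and> map label qs = map label ps"
proof -
  obtain g where g: "aut g" "\<forall>z\<in>A. g z = z" "map g x = y" using assms by (auto simp: conjugate_def)
  have "g ` A = A" using g(2) by force
  then have "chain k n A y (map (\<lambda>p. (fst p, map g (snd p))) ps)"
    using chain_aut[OF g(1) assms(4,3,1)] g(3) by simp
  then show ?thesis using label_map by blast
qed

text \<open>The first parameter is replaced by a conjugate over \<open>B\<close> that still gives
  dividing over \<open>B \<union> C\<close>; the rest of the chain and \<open>x\<close> are carried
  along, and the argument recurs over the enlarged base. Induction is on the length because the rest
  is replaced by its image. As \<open>x\<close> moves too, only conjugacy of \<open>y\<close> over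
  \<open>B\<close> can be kept.\<close>

lemma chain_extend:
  assumes "finite C" "C \<subseteq> U"
  shows "chain k n B x ps \<Longrightarrow> finite B \<Longrightarrow> B \<subseteq> U \<Longrightarrow> x \<in> tuples M n \<Longrightarrow>
     \<exists>y qs. conjugate B x y \<and> chain k n (B \<union> C) y qs \<and> map label qs = map label ps"
proof (induction ps arbitrary: B x rule: measure_induct_rule[where f = length])
  case (less qs)
  note IH = less.IH
  show ?case
  proof (cases qs)
    case Nil
    then show ?thesis by (intro exI[of _ x] exI[of _ qs]) (simp add: conjugate_refl)
  next
    case (Cons p ps)
    note prems = less.prems[unfolded Cons]
    let ?P = "fst p" and ?c = "snd p"
    have p: "dfn (n + length ?c) ?P" "?P (x @ ?c)" "k_divides k n ?P ?c B" "chain k n (B \<union> set ?c) x ps"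
      using prems by auto
    have cU: "set ?c \<subseteq> U" using k_divides_in_U[OF p(3)] .
    obtain c' where c': "conjugate B ?c c'" "k_divides k n ?P c' (B \<union> C)"
      using k_divides_extend[OF p(3,1) prems(2,3) assms] by blast
    obtain g where g: "aut g" "\<forall>z\<in>B. g z = z" "map g ?c = c'" using c'(1) by (auto simp: conjugate_def)
    let ?ps = "map (\<lambda>p. (fst p, map g (snd p))) ps"
    have gB: "g ` (B \<union> set ?c) = B \<union> set c'" using g(2,3) by (force simp: image_Un)
    have c'U: "set c' \<subseteq> U" using k_divides_in_U[OF c'(2)] .
    have gx: "map g x \<in> tuples M n" by (rule aut_tuples[OF g(1) prems(4)])
    have "chain k n (B \<union> set c') (map g x) ?ps"
      using chain_aut[OF g(1) prems(4) _ p(4)] gB prems(3) cU by auto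
    then obtain y qs where y: "conjugate (B \<union> set c') (map g x) y" "chain k n (B \<union> set c' \<union> C) y qs" "map label qs = map label ?ps"
      using IH[of ?ps "B \<union> set c'" "map g x"] Cons prems gx c'U by auto
    have "conjugate B x (map g x)" using g by (auto simp: conjugate_def)
    then have 1: "conjugate B x y" using conjugate_mono[OF y(1)] conjugate_trans by blast
    have lc: "length c' = length ?c" using g(3) by auto
    have "?P (map g (x @ ?c)) \<longleftrightarrow> ?P (x @ ?c)"
      by (rule aut_definable[OF g(1) p(1)]) (use prems(4) cU in \<open>auto simp: tuples_iff\<close>)
    then have "?P (map g x @ c')" using p(2) g(3) by simp
    moreover have "?P (map g x @ c') \<longleftrightarrow> ?P (y @ c')"
      by (rule conjugate_definable[OF y(1) gx, of c' "length c'"]) (use c'U p(1) lc in \<open>auto simp: tuples_iff\<close>)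
    ultimately have "chain k n (B \<union> C) y ((?P, c') # qs)"
      using p(1) lc c'(2) y(2) by (simp add: Un_ac)
    moreover have "map label ((?P, c') # qs) = map label (p # ps)"
      using y(3) lc label_map by (simp add: label_def)
    ultimately show ?thesis using 1 unfolding Cons by blast
  qed
qed

text \<open>Once the chain over \<open>B\<close> is moved to a chain over \<open>B\<close> and all
  parameters of \<open>D\<close>, its new realization satisfies an instance from \<open>D\<close>.
  This instance divides over \<open>A\<close>, and the moved chain is a chain over \<open>A\<close>
  and its parameter, so it can be put in front. With \<open>A = B\<close> the step can be
  iterated.\<close>

lemma chain_step:
  assumes B: "finite B" "A \<subseteq> B" "B \<subseteq> U" and a: "a \<in> tuples M n"
    and D: "finite D" "\<And>P d. (P, d) \<in> D \<Longrightarrow> dfn (n + length d) P \<and> k_divides k n P d A"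
    and cover: "\<And>a'. conjugate B a a' \<Longrightarrow> \<exists>(P, d)\<in>D. P (a' @ d)"
    and ch: "chain k n B a ps" "set (map label ps) \<subseteq> \<Delta>" "label ` D \<subseteq> \<Delta>"
  shows "\<exists>qs. chain k n A a qs \<and> length qs = Suc (length ps) \<and> set (map label qs) \<subseteq> \<Delta>"
proof -
  let ?C = "\<Union>p\<in>D. set (snd p)"
  have C: "finite ?C" "?C \<subseteq> U" using D(1) D(2) k_divides_in_U by fastforce+
  obtain y qs where y: "conjugate B a y" "chain k n (B \<union> ?C) y qs" "map label qs = map label ps"
    using chain_extend[OF C ch(1) B(1,3) a] by blast
  have ya: "conjugate B y a" by (rule conjugate_sym[OF y(1)]) (use B a in \<open>auto simp: tuples_iff\<close>)
  obtain P d where P: "(P, d) \<in> D" "P (y @ d)" using cover[OF y(1)] by blast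
  have "set d \<subseteq> ?C" using P(1) by force
  then have "chain k n (A \<union> set d) y qs" by (intro chain_mono[OF y(2)] Un_mono B(2))
  then have "chain k n A y ((P, d) # qs)" using D(2)[OF P(1)] P(2) by simp
  then obtain rs where rs: "chain k n A a rs" "map label rs = map label ((P, d) # qs)"
    using chain_conjugate[of k n A y "(P, d) # qs" a] conjugate_mono[OF ya B(2)] B conjugate_tuples[OF y(1) a] by blast
  have "length rs = Suc (length ps)" using arg_cong[OF rs(2), of length] arg_cong[OF y(3), of length] by simp
  moreover have "set (map label rs) \<subseteq> \<Delta>" unfolding rs(2) using y(3) ch P(1) by auto
  ultimately show ?thesis using rs(1) by blast
qed

text \<open>The dividing witness of the first instance supplies the children of the root, and
  automorphisms taking its parameter to each child copy the tree of the remaining chain below them.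
  Conjugacy of the branch realizations to \<open>x\<close> over the base is carried through the
  induction: once the base contains the first parameter, it keeps the first instance true.\<close>

lemma chain_tree:
  assumes P: "dfn (n + m) P"
  shows "chain k n A x ps \<Longrightarrow> set (map label ps) \<subseteq> {(P, m)} \<Longrightarrow> A \<subseteq> U \<Longrightarrow> x \<in> tuples M n \<Longrightarrow>
    \<exists>b. (\<forall>s. b s \<in> tuples M m) \<and>
      (\<forall>s. length s < length ps \<longrightarrow> k_contradictory k n P (\<lambda>i. b (s @ [i]))) \<and>
      (\<forall>s. length s = length ps \<longrightarrow>
         (\<exists>y. conjugate A x y \<and> (\<forall>l. 0 < l \<and> l \<le> length s \<longrightarrow> P (y @ b (take l s)))))"
proof (induction ps arbitrary: A)
  case Nil
  obtain x0 where "x0 \<in> U" using U_nonempty by blast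
  then have "replicate m x0 \<in> tuples M m" by (auto simp: tuples_iff)
  then show ?case by (intro exI[of _ "\<lambda>s. replicate m x0"]) (auto intro: conjugate_refl)
next
  case (Cons p ps)
  let ?c = "snd p"
  have p: "fst p = P" "length ?c = m" "P (x @ ?c)" "k_divides k n P ?c A" "chain k n (A \<union> set ?c) x ps"
    using Cons.prems by (auto simp: label_def)
  have cU: "set ?c \<subseteq> U" using k_divides_in_U[OF p(4)] .
  obtain b where b: "\<And>s. b s \<in> tuples M m" "\<And>s. length s < length ps \<Longrightarrow> k_contradictory k n P (\<lambda>i. b (s @ [i]))"
    "\<And>s. length s = length ps \<Longrightarrow>
       \<exists>y. conjugate (A \<union> set ?c) x y \<and> (\<forall>l. 0 < l \<and> l \<le> length s \<longrightarrow> P (y @ b (take l s)))"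
    using Cons.IH[OF p(5)] Cons.prems cU by auto
  obtain d where d: "\<And>i. d i \<in> tuples M m" "\<And>i. conjugate A (d i) ?c" "k_contradictory k n P d"
    using p(4) p(2) by (auto simp: k_divides_def)
  have "\<forall>i. \<exists>h. aut h \<and> (\<forall>z\<in>A. h z = z) \<and> map h ?c = d i"
  proof
    fix i
    have "conjugate A ?c (d i)" by (rule conjugate_sym[OF d(2)]) (use Cons.prems d(1)[of i] in \<open>auto simp: tuples_iff\<close>)
    then show "\<exists>h. aut h \<and> (\<forall>z\<in>A. h z = z) \<and> map h ?c = d i" by (auto simp: conjugate_def)
  qed
  then obtain h where h: "\<And>i. aut (h i)" "\<And>i z. z \<in> A \<Longrightarrow> h i z = z" "\<And>i. map (h i) ?c = d i"
    by metis
  \<comment> \<open>No condition concerns the root, so any tuple of length \<open>m\<close> may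
    stand there.\<close>
  define b' where "b' s = (case s of [] \<Rightarrow> ?c | i # t \<Rightarrow> if t = [] then d i else map (h i) (b t))" for s
  have "b' s \<in> tuples M m" for s
    using d(1) aut_tuples[OF h(1) b(1)] cU p(2) by (auto simp: b'_def tuples_iff split: list.split)
  moreover have "k_contradictory k n P (\<lambda>i. b' (s @ [i]))" if "length s < length (p # ps)" for s
  proof (cases s)
    case Nil
    then show ?thesis using d(3) by (simp add: b'_def)
  next
    case (Cons j t)
    have "k_contradictory k n P (\<lambda>i. map (h j) (b (t @ [i])))"
      by (rule k_contradictory_aut[OF h(1) b(1) P b(2)]) (use that Cons in auto)
    then show ?thesis using Cons by (simp add: b'_def)
  qed
  moreover have "\<exists>y. conjugate A x y \<and> (\<forall>l. 0 < l \<and> l \<le> length s \<longrightarrow> P (y @ b' (take l s)))"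
    if s: "length s = length (p # ps)" for s
  proof -
    obtain j t where jt: "s = j # t" "length t = length ps" using s by (cases s) auto
    obtain y where y: "conjugate (A \<union> set ?c) x y" "\<And>l. 0 < l \<and> l \<le> length t \<Longrightarrow> P (y @ b (take l t))"
      using b(3)[OF jt(2)] by blast
    have yt: "y \<in> tuples M n" using conjugate_tuples[OF y(1)] Cons.prems by blast
    have hP: "P (map (h j) (y @ v)) \<longleftrightarrow> P (y @ v)" if "v \<in> tuples M m" for v
      by (rule aut_definable[OF h(1) P]) (use yt that in \<open>auto simp: tuples_iff\<close>)
    have "conjugate A x (map (h j) y)"
    proof -
      have "conjugate A y (map (h j) y)" using h by (auto simp: conjugate_def)
      then show ?thesis using conjugate_mono[OF y(1)] conjugate_trans by blast
    qed
    moreover have "P (map (h j) y @ b' (take l s))" if l: "0 < l \<and> l \<le> length s" for l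
    proof (cases "l = 1")
      case True
      have "P (x @ ?c) \<longleftrightarrow> P (y @ ?c)"
        by (rule conjugate_definable[OF y(1), of n _ m]) (use Cons.prems cU p P in \<open>auto simp: tuples_iff\<close>)
      then have "P (map (h j) (y @ ?c))" using hP[of ?c] p cU by (auto simp: tuples_iff)
      then show ?thesis using True jt by (simp add: b'_def h(3))
    next
      case False
      then obtain l' where l': "l = Suc l'" "0 < l'" "l' \<le> length t" using l jt by (cases l) auto
      then have "P (map (h j) (y @ b (take l' t)))" using y(2)[of l'] hP[OF b(1)] by blast
      then show ?thesis using jt l' by (auto simp: b'_def)
    qed
    ultimately show ?thesis by blast
  qed
  ultimately show ?case by (intro exI[of _ b']) blast
qed

section \<open>Compactness: from long chains to the tree property, and bounds on chains\<close>

lemma k_contradictory_cong: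
  assumes "\<And>u. u \<in> tuples M (n + m) \<Longrightarrow> P u \<longleftrightarrow> Q u" "\<And>i. c i \<in> tuples M m" "k_contradictory k n P c"
  shows "k_contradictory k n Q c"
proof -
  have "P (x @ c i) \<longleftrightarrow> Q (x @ c i)" if "x \<in> tuples M n" for x i
    by (rule assms(1)) (use that assms(2)[of i] in \<open>auto simp: tuples_iff\<close>)
  then show ?thesis using assms(3) unfolding k_contradictory_def by blast
qed

lemma consistent_finite: "finite q \<Longrightarrow> consistent M n q \<longleftrightarrow> (\<exists>a\<in>tuples M n. realizes M a q)"
  unfolding consistent_def realizes_def by blast

lemma k_inconsistent_iff_k_contradictory: "k_inconsistent M k n \<phi> c \<longleftrightarrow> k_contradictory k n (holds M \<phi>) c"
proof -
  have "consistent M n {(\<phi>, c i) | i. i \<in> K} \<longleftrightarrow> (\<exists>x\<in>tuples M n. \<forall>i\<in>K. holds M \<phi> (x @ c i))"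
    if "finite K" for K
    using that by (subst consistent_finite) (auto simp: realizes_def)
  then show ?thesis unfolding k_inconsistent_def k_contradictory_def by (simp cong: imp_cong)
qed

text \<open>\<open>chain_tree\<close> gives trees of every finite depth. An infinite tree is coded
  as one sequence of elements, with node \<open>s\<close> in block \<open>to_nat s\<close>, so that
  \<open>realize_sequence\<close> provides it.\<close>

lemma tree_property_of_long_chains:
  assumes P: "dfn (n + m) P"
    and long: "\<And>N. \<exists>A x ps. A \<subseteq> U \<and> x \<in> tuples M n \<and> chain k n A x ps \<and> length ps = N \<and> set (map label ps) \<subseteq> {(P, m)}"
  shows "\<exists>\<phi>. formula_in L (n + m) \<phi> \<and> tree_property L M n m \<phi>"
proof -
  define blk where "blk z s = map z [to_nat s * m..<to_nat s * m + m]" for z :: "nat \<Rightarrow> 'a" and s :: "nat list"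
  define idx where "idx ss = concat (map (\<lambda>s. [to_nat s * m..<to_nat s * m + m]) ss)" for ss :: "nat list list"
  have blk: "map z (idx ss) = concat (map (blk z) ss)" for z ss
    by (induction ss) (auto simp: blk_def idx_def)
  have lidx: "length (idx ss) = length ss * m" for ss
    unfolding idx_def by (induction ss) auto
  have lblk: "length (blk z s) = m" for z s by (simp add: blk_def)
  define kids where "kids s js = map (\<lambda>i. s @ [i]) js" for s :: "nat list" and js
  define path where "path s = map (\<lambda>l. take l s) [1..<Suc (length s)]" for s :: "nat list"
  have lp: "length (path s) = length s" for s unfolding path_def by (simp del: upt_Suc)
  have com: "common 0 m (length ss) n P (map z (idx ss)) \<longleftrightarrow> (\<exists>x\<in>tuples M n. \<forall>s\<in>set ss. P (x @ blk z s))" for z ss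
  proof -
    \<comment> \<open>Padding, because \<open>common_blocks\<close> wants a block of length
      \<open>m\<close> at every index.\<close>
    define c where "c i = (if i < length ss then blk z (ss ! i) else replicate m undefined)" for i
    have "map (blk z) ss = map c [0..<length ss]" by (rule nth_equalityI) (auto simp: c_def)
    moreover have "common 0 m (length ss) n P ([] @ concat (map c [0..<length ss])) \<longleftrightarrow>
        (\<exists>x\<in>tuples M n. \<forall>i\<in>set [0..<length ss]. P (x @ [] @ c i))"
      by (rule common_blocks) (auto simp: c_def lblk)
    moreover have "(\<forall>i\<in>set [0..<length ss]. P (x @ [] @ c i)) \<longleftrightarrow> (\<forall>s\<in>set ss. P (x @ blk z s))" for x
      by (auto simp: c_def all_set_conv_all_nth)
    ultimately show ?thesis by (simp add: blk)
  qed
  \<comment> \<open>\<open>None\<close> asks for a common solution along the nonempty initial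
    segments of \<open>s\<close>; \<open>Some js\<close> forbids one for the children of
    \<open>s\<close> numbered by \<open>js\<close>.\<close>
  define con where "con t = (case t of
       (s, None) \<Rightarrow> (common 0 m (length s) n P, idx (path s))
     | (s, Some js) \<Rightarrow> (\<lambda>u. \<not> common 0 m k n P u, idx (kids s js)))" for t
  define T where "T = {(s :: nat list, ojs :: nat list option). case ojs of None \<Rightarrow> True | Some js \<Rightarrow> sorted_wrt (<) js \<and> length js = k}"
  have "\<exists>z. range z \<subseteq> U \<and> (\<forall>(Q, js)\<in>con ` T. Q ([] @ map z js))"
  proof (rule realize_sequence)
    fix Q js assume "(Q, js) \<in> con ` T"
    then show "dfn (length [] + length js) Q"
      using definable_common[of n 0 m P] P
      by (auto simp: con_def T_def lidx lp kids_def intro!: definable_not split: option.splits)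
  next
    fix F assume F: "finite F" "F \<subseteq> con ` T"
    from finite_subset_image[OF F] obtain T' where T': "T' \<subseteq> T" "finite T'" "F = con ` T'" by (elim exE conjE)
    define N where "N = Suc (Max (insert 0 ((\<lambda>t. length (fst t)) ` T')))"
    have N: "length s < N" if "(s, ojs) \<in> T'" for s ojs
    proof -
      have "length s \<in> insert 0 ((\<lambda>t. length (fst t)) ` T')" using that by force
      then show ?thesis unfolding N_def using T'(2) by (simp add: less_Suc_eq_le)
    qed
    obtain A x ps where ch: "A \<subseteq> U" "x \<in> tuples M n" "chain k n A x ps" "length ps = N" "set (map label ps) \<subseteq> {(P, m)}"
      using long by metis
    obtain b where b: "\<And>s. b s \<in> tuples M m" "\<And>s. length s < N \<Longrightarrow> k_contradictory k n P (\<lambda>i. b (s @ [i]))"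
      "\<And>s. length s = N \<Longrightarrow> \<exists>y. conjugate A x y \<and> (\<forall>l. 0 < l \<and> l \<le> length s \<longrightarrow> P (y @ b (take l s)))"
      using chain_tree[OF P ch(3,5,1,2)] ch(4) by blast
    have bl: "length (b s) = m" "set (b s) \<subseteq> U" for s using b(1) by (auto simp: tuples_iff)
    obtain x0 where x0: "x0 \<in> U" using U_nonempty by blast
    define z where "z v = (if m = 0 then x0 else b (from_nat (v div m)) ! (v mod m))" for v
    have "z v \<in> U" for v
    proof (cases "m = 0")
      case False
      then have "v mod m < length (b (from_nat (v div m)))" by (simp add: bl)
      then show ?thesis using False bl(2) nth_mem by (fastforce simp: z_def)
    qed (simp add: z_def x0)
    then have zU: "range z \<subseteq> U" by blast
    have zb: "blk z s = b s" for s
      by (rule nth_equalityI) (auto simp: blk_def z_def bl)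
    have "Q (map z js)" if Q: "(Q, js) \<in> F" for Q js
    proof -
      obtain s ojs where t: "(s, ojs) \<in> T'" "(Q, js) = con (s, ojs)" using Q T'(3) by force
      show ?thesis
      proof (cases ojs)
        case None
        have "Q = common 0 m (length (path s)) n P" "js = idx (path s)" using t None by (auto simp: con_def lp)
        moreover have "\<exists>x\<in>tuples M n. \<forall>s\<in>set (path s). P (x @ blk z s)"
        proof -
          \<comment> \<open>Realizations are available for branches of full depth \<open>N\<close>,
            so \<open>s\<close> is prolonged arbitrarily.\<close>
          let ?s = "s @ replicate (N - length s) 0"
          have "length ?s = N" using N[OF t(1)] by simp
          then obtain y where y: "conjugate A x y" "\<forall>l. 0 < l \<and> l \<le> length ?s \<longrightarrow> P (y @ b (take l ?s))"
            using b(3) by blast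
          have "P (y @ b (take l s))" if "0 < l" "l \<le> length s" for l
            using y(2)[rule_format, of l] that by simp
          then show ?thesis using conjugate_tuples[OF y(1) ch(2)] by (intro bexI[of _ y]) (auto simp: path_def zb simp del: upt_Suc)
        qed
        ultimately show ?thesis using com by simp
      next
        case (Some ks)
        have ks: "sorted_wrt (<) ks" "length ks = k" using t(1) T'(1) Some by (auto simp: T_def)
        have "Q = (\<lambda>u. \<not> common 0 m (length (kids s ks)) n P u)" "js = idx (kids s ks)"
          using t Some ks by (auto simp: con_def kids_def)
        moreover have "\<not> (\<exists>x\<in>tuples M n. \<forall>s\<in>set (kids s ks). P (x @ blk z s))"
          using b(2)[OF N[OF t(1)]] ks unfolding k_contradictory_iff_sorted by (auto simp: kids_def zb)
        ultimately show ?thesis using com by simp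
      qed
    qed
    then show "\<exists>z. range z \<subseteq> U \<and> (\<forall>(Q, js)\<in>F. Q ([] @ map z js))" using zU by (intro exI[of _ z]) auto
  qed simp
  then obtain z where z: "range z \<subseteq> U" "\<And>t Q js. t \<in> T \<Longrightarrow> con t = (Q, js) \<Longrightarrow> Q (map z js)" by fastforce
  obtain \<phi> where \<phi>: "formula_in L (n + m) \<phi>" "\<forall>u\<in>tuples M (n + m). P u \<longleftrightarrow> holds M \<phi> u"
    using P by (auto simp: definable_def)
  let ?b = "blk z"
  have bt: "?b s \<in> tuples M m" for s using z(1) by (auto simp: blk_def tuples_iff)
  have "k_inconsistent M k n \<phi> (\<lambda>i. ?b (s @ [i]))" for s
    unfolding k_inconsistent_iff_k_contradictory
  proof (rule k_contradictory_cong[of n m P])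
    show "k_contradictory k n P (\<lambda>i. ?b (s @ [i]))"
      unfolding k_contradictory_iff_sorted
    proof (intro allI impI)
      fix js :: "nat list" assume js: "sorted_wrt (<) js \<and> length js = k"
      then have "\<not> common 0 m k n P (map z (idx (kids s js)))"
        using z(2)[of "(s, Some js)"] by (auto simp: T_def con_def)
      then show "\<not> (\<exists>x\<in>tuples M n. \<forall>i\<in>set js. P (x @ ?b (s @ [i])))"
        using com[of "kids s js" z] js by (auto simp: kids_def)
    qed
  qed (use \<phi>(2) bt in auto)
  moreover have "consistent M n {(\<phi>, ?b (map \<sigma> [0..<l])) | l. l > 0}" for \<sigma> :: "nat \<Rightarrow> nat"
    unfolding consistent_def
  proof (intro allI impI)
    fix q assume q: "finite q \<and> q \<subseteq> {(\<phi>, ?b (map \<sigma> [0..<l])) | l. l > 0}"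
    have eq: "{(\<phi>, ?b (map \<sigma> [0..<l])) | l. l > 0} = (\<lambda>l. (\<phi>, ?b (map \<sigma> [0..<l]))) ` {0<..}" by auto
    from finite_subset_image[OF conjunct1[OF q] conjunct2[OF q, unfolded eq]]
    obtain S where S: "S \<subseteq> {0<..}" "finite S" "q = (\<lambda>l. (\<phi>, ?b (map \<sigma> [0..<l]))) ` S" by (elim exE conjE)
    define N where "N = Max (insert 0 S)"
    have N: "0 < l \<and> l \<le> N" if "l \<in> S" for l using that S by (auto simp: N_def)
    let ?s = "map \<sigma> [0..<N]"
    have "common 0 m (length (path ?s)) n P (map z (idx (path ?s)))"
      using z(2)[of "(?s, None)"] by (auto simp: T_def con_def lp)
    then obtain x where x: "x \<in> tuples M n" "\<forall>s\<in>set (path ?s). P (x @ blk z s)" using com by blast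
    have "holds M \<phi> (x @ ?b (map \<sigma> [0..<l]))" if "l \<in> S" for l
    proof -
      have "map \<sigma> [0..<l] = take l ?s" using N[OF that] by (simp add: take_map)
      then have "map \<sigma> [0..<l] \<in> set (path ?s)" using N[OF that] unfolding path_def by (auto simp: image_iff)
      then have "P (x @ ?b (map \<sigma> [0..<l]))" using x(2) by blast
      moreover have "x @ ?b (map \<sigma> [0..<l]) \<in> tuples M (n + m)" using x(1) bt[of "map \<sigma> [0..<l]"] by (auto simp: tuples_iff)
      ultimately show ?thesis using \<phi>(2) by blast
    qed
    then show "\<exists>a\<in>tuples M n. realizes M a q" using x(1) S(3) by (intro bexI[of _ x]) (auto simp: realizes_def)
  qed
  ultimately have "tree_property L M n m \<phi>" unfolding tree_property_def using bt by blast
  then show ?thesis using \<phi>(1) by blast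
qed

lemma length_eq_sum_filter:
  assumes "finite \<Delta>" "set (map f ps) \<subseteq> \<Delta>"
  shows "length ps = (\<Sum>\<delta>\<in>\<Delta>. length (filter (\<lambda>p. f p = \<delta>) ps))"
  using assms(2)
proof (induction ps)
  case (Cons p ps)
  have "(\<Sum>\<delta>\<in>\<Delta>. length (filter (\<lambda>q. f q = \<delta>) (p # ps))) =
      (\<Sum>\<delta>\<in>\<Delta>. (if f p = \<delta> then 1 else 0) + length (filter (\<lambda>q. f q = \<delta>) ps))"
    by (rule sum.cong) auto
  also have "\<dots> = (\<Sum>\<delta>\<in>\<Delta>. if f p = \<delta> then 1 else 0) + length ps"
    using Cons by (simp add: sum.distrib)
  also have "(\<Sum>\<delta>\<in>\<Delta>. if f p = \<delta> then 1 else 0) = (1::nat)"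
    using assms(1) Cons.prems by simp
  finally show ?case by simp
qed simp

text \<open>The entries with one fixed label again form a chain. If these had no bound, truncation
  would give chains of every length with that label, hence the tree property; the bounds are then
  summed over the finite set of labels.\<close>

lemma chain_bound:
  assumes simple: "simple_theory L M" and \<Delta>: "finite \<Delta>" "\<And>P m. (P, m) \<in> \<Delta> \<Longrightarrow> dfn (n + m) P"
  shows "\<exists>N. \<forall>A x ps. A \<subseteq> U \<and> x \<in> tuples M n \<and> chain k n A x ps \<and> set (map label ps) \<subseteq> \<Delta> \<longrightarrow> length ps < N"
proof -
  have "\<exists>N. \<forall>A x ps. A \<subseteq> U \<and> x \<in> tuples M n \<and> chain k n A x ps \<and> set (map label ps) \<subseteq> {\<delta>} \<longrightarrow> length ps < N"
    if \<delta>: "\<delta> \<in> \<Delta>" for \<delta>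
  proof (rule ccontr)
    assume neg: "\<not> ?thesis"
    obtain P m where Pm: "\<delta> = (P, m)" by (cases \<delta>)
    have P: "dfn (n + m) P" using \<Delta>(2) \<delta> Pm by blast
    have "\<exists>A x ps. A \<subseteq> U \<and> x \<in> tuples M n \<and> chain k n A x ps \<and> length ps = N \<and> set (map label ps) \<subseteq> {(P, m)}" for N
    proof -
      obtain A x ps where ps: "A \<subseteq> U" "x \<in> tuples M n" "chain k n A x ps" "set (map label ps) \<subseteq> {\<delta>}" "\<not> length ps < N"
        using neg by blast
      have "chain k n A x (take N ps)" using ps(3) chain_append[of k n A x "take N ps" "drop N ps"] by simp
      moreover have "set (map label (take N ps)) \<subseteq> {(P, m)}" using ps(4) Pm set_take_subset[of N ps] by auto
      moreover have "length (take N ps) = N" using ps(5) by simp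
      ultimately show ?thesis using ps(1,2) by blast
    qed
    from tree_property_of_long_chains[OF P this] show False
      using simple unfolding simple_theory_def by blast
  qed
  then obtain f where f: "\<And>\<delta> A x ps. \<delta> \<in> \<Delta> \<Longrightarrow> A \<subseteq> U \<Longrightarrow> x \<in> tuples M n \<Longrightarrow> chain k n A x ps \<Longrightarrow>
      set (map label ps) \<subseteq> {\<delta>} \<Longrightarrow> length ps < f \<delta>"
    by metis
  have "length ps < Suc (\<Sum>\<delta>\<in>\<Delta>. f \<delta>)"
    if "A \<subseteq> U" "x \<in> tuples M n" "chain k n A x ps" "set (map label ps) \<subseteq> \<Delta>" for A x ps
  proof -
    have "length ps = (\<Sum>\<delta>\<in>\<Delta>. length (filter (\<lambda>p. label p = \<delta>) ps))"
      by (rule length_eq_sum_filter[OF \<Delta>(1) that(4)])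
    also have "\<dots> \<le> (\<Sum>\<delta>\<in>\<Delta>. f \<delta>)"
    proof (rule sum_mono)
      fix \<delta> assume "\<delta> \<in> \<Delta>"
      then have "length (filter (\<lambda>p. label p = \<delta>) ps) < f \<delta>"
        by (rule f[OF _ that(1,2) chain_filter[OF that(3)]]) auto
      then show "length (filter (\<lambda>p. label p = \<delta>) ps) \<le> f \<delta>" by simp
    qed
    finally show ?thesis by simp
  qed
  then show ?thesis by blast
qed

lemma k_divides_uniform:
  assumes "finite D" "\<And>P d. (P, d) \<in> D \<Longrightarrow> \<exists>k. k_divides k n P d A"
  shows "\<exists>k. \<forall>(P, d)\<in>D. k_divides k n P d A"
proof -
  have "\<forall>p\<in>D. \<exists>k. k_divides k n (fst p) (snd p) A" using assms(2) by simp
  then obtain f where f: "\<forall>p\<in>D. k_divides (f p) n (fst p) (snd p) A" by (rule bchoice[THEN exE])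
  have "k_divides (Max (f ` D)) n P d A" if "(P, d) \<in> D" for P d
    using bspec[OF f that] k_divides_mono_k[of "f (P, d)" n P d A "Max (f ` D)"] that assms(1) by simp
  then show ?thesis by blast
qed

section \<open>Independent realizations and Morley sequences\<close>

text \<open>Otherwise, by compactness, finitely many instances dividing over \<open>A\<close> cover
  all conjugates of \<open>j\<close> over \<open>A\<close>. Then \<open>chain_step\<close> with both
  bases equal to \<open>A\<close> lengthens chains for \<open>j\<close> without end, against
  \<open>chain_bound\<close>.\<close>

lemma ex_non_dividing:
  assumes simple: "simple_theory L M" and A: "finite A" "A \<subseteq> U" and j: "j \<in> tuples M n" and w: "set w \<subseteq> U"
  shows "\<exists>j'. conjugate A j j' \<and> non_dividing j' A w"
proof (rule ccontr)
  assume neg: "\<not> ?thesis"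
  obtain e where e: "set e = A" using A finite_list by metis
  define S where "S = {Q. dfn (n + length w) Q \<and> (\<exists>k. k_divides k n Q w A)}"
  define \<Gamma>1 where "\<Gamma>1 = {(Q, e) | Q. dfn (n + length e) Q \<and> Q (j @ e)}"
  define \<Gamma>2 where "\<Gamma>2 = (\<lambda>Q. (\<lambda>u. \<not> Q u, w)) ` S"
  have "\<exists>F. finite F \<and> F \<subseteq> \<Gamma>1 \<union> \<Gamma>2 \<and> \<not> (\<exists>x\<in>tuples M n. \<forall>(P, w)\<in>F. P (x @ w))"
  proof (rule ccontr)
    assume fin: "\<not> ?thesis"
    have "\<exists>x\<in>tuples M n. \<forall>(P, w)\<in>\<Gamma>1 \<union> \<Gamma>2. P (x @ w)"
    proof (rule realize_definable)
      show "countable (set (e @ w))" "set (e @ w) \<subseteq> U" using e A w by (auto simp: countable_finite)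
      fix P v assume "(P, v) \<in> \<Gamma>1 \<union> \<Gamma>2"
      then show "set v \<subseteq> set (e @ w) \<and> dfn (n + length v) P"
        by (auto simp: \<Gamma>1_def \<Gamma>2_def S_def intro: definable_not)
    next
      fix F assume "finite F" "F \<subseteq> \<Gamma>1 \<union> \<Gamma>2"
      then show "\<exists>x\<in>tuples M n. \<forall>(P, w)\<in>F. P (x @ w)" using fin by (metis (no_types))
    qed
    then obtain x where x: "x \<in> tuples M n" "\<And>P v. (P, v) \<in> \<Gamma>1 \<union> \<Gamma>2 \<Longrightarrow> P (x @ v)" by blast
    have "conjugate (set e) j x"
    proof (rule conjugate_of_equiv[OF _ j x(1)])
      fix P assume P: "dfn (length e + n) P" "P (e @ j)"
      let ?P = "\<lambda>u. P (drop n u @ take n u)"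
      have "(?P, e) \<in> \<Gamma>1" using definable_swap[OF P(1)] P(2) j by (auto simp: \<Gamma>1_def tuples_iff)
      then have "?P (x @ e)" using x(2) by blast
      then show "P (e @ x)" using x(1) by (simp add: tuples_iff)
    qed (use e A in auto)
    then have "conjugate A j x" using e by simp
    moreover have "non_dividing x A w"
      unfolding non_dividing_def
    proof (intro allI impI notI)
      fix k Q assume Q: "dfn (length x + length w) Q \<and> Q (x @ w)" "k_divides k (length x) Q w A"
      have "length x = n" using x(1) by (simp add: tuples_iff)
      then have "(\<lambda>u. \<not> Q u, w) \<in> \<Gamma>2" using Q by (auto simp: \<Gamma>2_def S_def)
      then show False using x(2)[of "\<lambda>u. \<not> Q u" w] Q by blast
    qed
    ultimately show False using neg by blast
  qed
  then obtain F where F: "finite F" "F \<subseteq> \<Gamma>1 \<union> \<Gamma>2" "\<not> (\<exists>x\<in>tuples M n. \<forall>(P, w)\<in>F. P (x @ w))" by blast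
  have f2: "finite (F \<inter> \<Gamma>2)" and s2: "F \<inter> \<Gamma>2 \<subseteq> (\<lambda>Q. (\<lambda>u. \<not> Q u, w)) ` S"
    using F(1) by (simp, simp add: \<Gamma>2_def)
  from finite_subset_image[OF f2 s2] obtain S' where S': "S' \<subseteq> S" "finite S'"
    "F \<inter> \<Gamma>2 = (\<lambda>Q. (\<lambda>u. \<not> Q u, w)) ` S'" by (elim exE conjE)
  define D where "D = (\<lambda>Q. (Q, w)) ` S'"
  have D: "finite D" "\<And>P d. (P, d) \<in> D \<Longrightarrow> d = w \<and> dfn (n + length d) P \<and> (\<exists>k. k_divides k n P d A)"
    using S' by (auto simp: D_def S_def)
  obtain k where k: "\<forall>(P, d)\<in>D. k_divides k n P d A" using k_divides_uniform[OF D(1), of n A] D(2) by blast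
  have cover: "\<exists>(P, d)\<in>D. P (x @ d)" if x: "conjugate A j x" for x
  proof -
    have xt: "x \<in> tuples M n" by (rule conjugate_tuples[OF x j])
    then obtain P v where P: "(P, v) \<in> F" "\<not> P (x @ v)" using F(3) by blast
    have "(P, v) \<notin> \<Gamma>1"
    proof
      assume "(P, v) \<in> \<Gamma>1"
      then have *: "v = e" "dfn (n + length e) P" "P (j @ e)" by (auto simp: \<Gamma>1_def)
      have "P (j @ e) \<longleftrightarrow> P (x @ e)"
        by (rule conjugate_definable[OF x j _ _ *(2)]) (use e A in \<open>auto simp: tuples_iff\<close>)
      then show False using P(2) * by simp
    qed
    then have "(P, v) \<in> F \<inter> \<Gamma>2" using P(1) F(2) by blast
    then obtain Q where "Q \<in> S'" "P = (\<lambda>u. \<not> Q u)" "v = w" unfolding S'(3) by blast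
    then show ?thesis using P(2) unfolding D_def by blast
  qed
  define \<Delta> where "\<Delta> = label ` D"
  have \<Delta>: "finite \<Delta>" "\<And>P m. (P, m) \<in> \<Delta> \<Longrightarrow> dfn (n + m) P"
    using D by (auto simp: \<Delta>_def label_def)
  have "\<exists>ps. chain k n A j ps \<and> length ps = N \<and> set (map label ps) \<subseteq> \<Delta>" for N
  proof (induction N)
    case 0
    show ?case by (rule exI[of _ "[]"]) simp
  next
    case (Suc N)
    then obtain ps where ps: "chain k n A j ps" "length ps = N" "set (map label ps) \<subseteq> \<Delta>" by blast
    have "\<exists>qs. chain k n A j qs \<and> length qs = Suc (length ps) \<and> set (map label qs) \<subseteq> \<Delta>"
      by (rule chain_step[OF A(1) subset_refl A(2) j D(1) _ cover ps(1,3)])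
        (use D(2) k in \<open>auto simp: \<Delta>_def\<close>)
    then show ?case using ps(2) by simp
  qed
  then show False using chain_bound[OF simple \<Delta>, of k] A(2) j by (metis less_irrefl)
qed

lemma k_divides_conjugate: "k_divides k n P b A \<Longrightarrow> conjugate A b b' \<Longrightarrow> k_divides k n P b' A"
  unfolding k_divides_def using conjugate_trans conjugate_length by metis

lemma map_concat_blocks: "map g (e @ concat (map c is)) = map g e @ concat (map (\<lambda>i. map g (c i)) is)"
  by (simp add: map_concat comp_def)

lemma blocks_tuples:
  assumes "\<And>i. c i \<in> tuples M m" "set e \<subseteq> U"
  shows "e @ concat (map c ks) \<in> tuples M (length e + length ks * m)"
  using assms length_concat_blocks[of c m ks] by (fastforce simp: tuples_iff)

lemma indisc_aut:
  assumes "indisc m e c" "aut g" "\<forall>x\<in>set e. g x = x" "set e \<subseteq> U"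
  shows "indisc m e (\<lambda>i. map g (c i))"
  unfolding indisc_def
proof (intro conjI allI impI)
  have t: "\<And>i. c i \<in> tuples M m" using assms(1) by (auto simp: indisc_def)
  then show "map g (c i) \<in> tuples M m" for i using aut_tuples[OF assms(2)] by blast
  fix P and "is" js :: "nat list"
  assume *: "sorted_wrt (<) is \<and> sorted_wrt (<) js \<and> length is = length js \<and> dfn (length e + length is * m) P"
    "P (e @ concat (map (\<lambda>i. map g (c i)) is))"
  have e: "map g e = e" using assms(3) by (simp add: map_idI)
  have eq: "P (e @ concat (map (\<lambda>i. map g (c i)) ks)) \<longleftrightarrow> P (e @ concat (map c ks))" if "length ks = length is" for ks
  proof -
    have "dfn (length e + length ks * m) P" using * that by metis
    from aut_definable[OF assms(2) this blocks_tuples[where c = c and ks = ks, OF t assms(4)]]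
    show ?thesis unfolding map_concat_blocks e .
  qed
  have "P (e @ concat (map c is))" using *(2) eq[OF refl] by simp
  then have "P (e @ concat (map c js))" using assms(1) * unfolding indisc_def by blast
  then show "P (e @ concat (map (\<lambda>i. map g (c i)) js))" using eq[of js] * by simp
qed

text \<open>In a sequence of successively independent conjugates \<open>b\<^sub>0, b\<^sub>1, \<dots>\<close> of \<open>j\<close>, an instance dividing
  over \<open>e\<close> at \<open>b\<^sub>i\<close> still divides over \<open>e\<close> and all later members; so a common solution of the
  instances is a dividing chain when the sequence is read backwards. Bounding the length of such
  chains before passing to an indiscernible sequence keeps the conclusion a definable condition.\<close>

lemma ex_morley:
  assumes simple: "simple_theory L M" and e: "set e \<subseteq> U" and j: "j \<in> tuples M m"
  shows "\<exists>J. indisc m e J \<and> J 0 = j \<and>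
    (\<forall>k n Q. dfn (n + (length e + m)) Q \<and> k_divides k n Q (e @ j) (set e) \<longrightarrow>
      (\<exists>N. \<forall>is. sorted_wrt (<) is \<and> length is = N \<longrightarrow> \<not> (\<exists>y\<in>tuples M n. \<forall>i\<in>set is. Q (y @ e @ J i))))"
proof -
  let ?A = "set e"
  define nxt where "nxt h = (SOME b. conjugate ?A j b \<and> non_dividing b ?A (e @ h))" for h
  have nxt: "conjugate ?A j (nxt h) \<and> non_dividing (nxt h) ?A (e @ h)" if h: "set h \<subseteq> U" for h
  proof -
    have "\<exists>b. conjugate ?A j b \<and> non_dividing b ?A (e @ h)" by (rule ex_non_dividing[OF simple _ e j]) (use e h in auto)
    then show ?thesis unfolding nxt_def by (rule someI_ex)
  qed
  \<comment> \<open>Each new member must be independent from all earlier ones, so the recursion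
    carries their concatenation.\<close>
  define hist where "hist = rec_nat [] (\<lambda>_ h. h @ nxt h)"
  have hist: "hist 0 = []" "hist (Suc i) = hist i @ nxt (hist i)" for i by (simp_all add: hist_def)
  define b where "b i = nxt (hist i)" for i
  have histU: "set (hist i) \<subseteq> U" for i
  proof (induction i)
    case (Suc i)
    have "nxt (hist i) \<in> tuples M m" using conjugate_tuples[OF conjunct1[OF nxt[OF Suc]] j] .
    then show ?case using Suc by (simp add: hist tuples_iff)
  qed (simp add: hist)
  have bj: "conjugate ?A j (b i)" and bnd: "non_dividing (b i) ?A (e @ hist i)" for i
    using nxt[OF histU] by (auto simp: b_def)
  have bt: "b i \<in> tuples M m" for i using conjugate_tuples[OF bj j] .
  have b_hist: "set (b i) \<subseteq> set (hist l)" if "i < l" for i l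
    using that by (induction l) (auto simp: hist b_def less_Suc_eq)
  have k_divides_later: "k_divides k n Q (e @ b i) (?A \<union> (\<Union>l\<in>set ls. set (b l)))"
    if kd: "k_divides k n Q (e @ j) ?A" and Q: "dfn (n + (length e + m)) Q"
      and "sorted_wrt (<) (i # ls)" for k n Q i ls
    using that(3)
  proof (induction ls rule: rev_induct)
    case Nil
    obtain g where g: "aut g" "\<forall>x\<in>?A. g x = x" "map g j = b i" using bj[of i] by (auto simp: conjugate_def)
    then have "conjugate ?A (e @ j) (e @ b i)" unfolding conjugate_def by (intro exI[of _ g]) (simp add: map_idI)
    then show ?case using k_divides_conjugate[OF kd] by simp
  next
    case (snoc l ls)
    let ?B = "?A \<union> (\<Union>l\<in>set ls. set (b l))"
    have lt: "i < l" "\<forall>x\<in>set ls. x < l" and s: "sorted_wrt (<) (i # ls)"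
      using snoc.prems by (auto simp: sorted_wrt_append)
    have BU: "finite ?B" "?B \<subseteq> U" using e bt by (auto simp: tuples_iff)
    \<comment> \<open>Both \<open>?B\<close> and \<open>b i\<close> lie in \<open>e\<close> and the
      history at \<open>l\<close>, from which \<open>b l\<close> is independent over
      \<open>e\<close>, hence over \<open>?B\<close>.\<close>
    have "k_divides k n Q (e @ b i) (?B \<union> set (b l))"
    proof (rule k_divides_over_independent[OF snoc.IH[OF s] _ BU non_dividing_mono_base[OF bnd[of l]]])
      show "dfn (n + length (e @ b i)) Q" using Q bt[of i] by (simp add: tuples_iff)
      show "?B \<union> set (e @ b i) \<subseteq> set (e @ hist l)" using b_hist lt by fastforce
      show "set (e @ hist l) \<subseteq> U" using e histU by simp
      show "set (b l) \<subseteq> U" using bt by (simp add: tuples_iff)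
    qed simp
    then show ?case by (simp add: Un_ac)
  qed
  have inconsistent: "\<exists>N. \<forall>is. sorted_wrt (<) is \<and> length is = N \<longrightarrow> \<not> (\<exists>y\<in>tuples M n. \<forall>i\<in>set is. Q (y @ e @ b i))"
    if Q: "dfn (n + (length e + m)) Q" and kd: "k_divides k n Q (e @ j) ?A" for k n Q
  proof -
    have ch: "chain k n ?A y (map (\<lambda>i. (Q, e @ b i)) (rev is))"
      if "sorted_wrt (<) is" "\<forall>i\<in>set is. Q (y @ e @ b i)" for y "is"
      using that
    proof (induction "is")
      case (Cons i "is")
      have "chain k n ?A y (map (\<lambda>i. (Q, e @ b i)) (rev is))" by (rule Cons.IH) (use Cons.prems in auto)
      moreover have "?A \<union> (\<Union>p\<in>set (map (\<lambda>i. (Q, e @ b i)) (rev is)). set (snd p)) = ?A \<union> (\<Union>l\<in>set is. set (b l))"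
        by auto
      moreover have "dfn (n + length (e @ b i)) Q" using Q bt[of i] by (simp add: tuples_iff)
      ultimately show ?case
        using k_divides_later[OF kd Q Cons.prems(1)] Cons.prems(2) by (simp add: chain_append)
    qed simp
    have "\<exists>N. \<forall>A x ps. A \<subseteq> U \<and> x \<in> tuples M n \<and> chain k n A x ps \<and>
        set (map label ps) \<subseteq> {(Q, length e + m)} \<longrightarrow> length ps < N"
      by (rule chain_bound[OF simple]) (use Q in auto)
    then obtain N where N: "\<And>A x ps. A \<subseteq> U \<Longrightarrow> x \<in> tuples M n \<Longrightarrow>
        chain k n A x ps \<Longrightarrow> set (map label ps) \<subseteq> {(Q, length e + m)} \<Longrightarrow> length ps < N"
      by blast
    have "\<not> (\<exists>y\<in>tuples M n. \<forall>i\<in>set is. Q (y @ e @ b i))" if S: "sorted_wrt (<) is" "length is = N" for "is"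
    proof
      assume "\<exists>y\<in>tuples M n. \<forall>i\<in>set is. Q (y @ e @ b i)"
      then obtain y where y: "y \<in> tuples M n" "\<forall>i\<in>set is. Q (y @ e @ b i)" by blast
      have "set (map label (map (\<lambda>i. (Q, e @ b i)) (rev is))) \<subseteq> {(Q, length e + m)}"
        using bt by (auto simp: label_def tuples_iff)
      from N[OF e y(1) ch[OF S(1) y(2)] this] S(2) show False by simp
    qed
    then show ?thesis by blast
  qed
  obtain J where J: "indisc m e J" "EM_le m e b J" using extract_indisc[of b m e, OF bt e] by blast
  have Jt: "J i \<in> tuples M m" for i using J(1) by (auto simp: indisc_def)
  have len: "length (b i) = m" "length (J i) = m" for i using bt Jt by (auto simp: tuples_iff)
  have "conjugate ?A (b i) j" for i by (rule conjugate_sym[OF bj e]) (use j in \<open>auto simp: tuples_iff\<close>)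
  \<comment> \<open>The extracted sequence starts only at a conjugate of \<open>j\<close>. An
    automorphism over \<open>e\<close> makes it start at \<open>j\<close>, and unsolvability, being
    definable, is preserved.\<close>
  then have "conjugate ?A (J 0) j" using EM_le_conjugate[of m e "[]" b J j] J(2) e bt Jt by simp
  then obtain g where g: "aut g" "\<forall>x\<in>?A. g x = x" "map g (J 0) = j" by (auto simp: conjugate_def)
  have ge: "map g e = e" using g(2) by (simp add: map_idI)
  have "indisc m e (\<lambda>i. map g (J i))" by (rule indisc_aut[OF J(1) g(1,2) e])
  moreover have "\<exists>N. \<forall>is. sorted_wrt (<) is \<and> length is = N \<longrightarrow>
      \<not> (\<exists>y\<in>tuples M n. \<forall>i\<in>set is. Q (y @ e @ map g (J i)))"
    if Q: "dfn (n + (length e + m)) Q" and kd: "k_divides k n Q (e @ j) ?A" for k n Q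
  proof -
    obtain N where N: "\<And>is. sorted_wrt (<) is \<Longrightarrow> length is = N \<Longrightarrow> \<not> (\<exists>y\<in>tuples M n. \<forall>i\<in>set is. Q (y @ e @ b i))"
      using inconsistent[OF Q kd] by blast
    have "\<not> (\<exists>y\<in>tuples M n. \<forall>i\<in>set is. Q (y @ e @ map g (J i)))" if S: "sorted_wrt (<) is" "length is = N" for "is"
    proof -
      have "\<not> (\<exists>y\<in>tuples M n. \<forall>i\<in>set is. Q (y @ e @ J i))"
        by (rule EM_le_no_common[OF J(2) len Q N S])
      then have "\<not> common (length e) m N n Q (e @ concat (map J is))"
        using common_blocks[where c = J and e = e and Q = Q and n = n, OF len(2) refl S(2)] by simp
      moreover have "common (length e) m N n Q (map g (e @ concat (map J is))) \<longleftrightarrow> common (length e) m N n Q (e @ concat (map J is))"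
        by (rule aut_definable[OF g(1) definable_common[OF Q]]) (use blocks_tuples[where c = J and ks = "is", OF Jt e] S(2) in simp)
      ultimately have "\<not> common (length e) m N n Q (e @ concat (map (\<lambda>i. map g (J i)) is))"
        unfolding map_concat_blocks ge by simp
      then show ?thesis
        using common_blocks[where c = "\<lambda>i. map g (J i)" and e = e and Q = Q and n = n, OF _ refl S(2)] len by simp
    qed
    then show ?thesis by blast
  qed
  ultimately show ?thesis using g(3) by (intro exI[of _ "\<lambda>i. map g (J i)"]) blast
qed

section \<open>Indiscernible sequences remembering a dividing chain\<close>

text \<open>Non-dividing of \<open>d\<close> survives enlarging the base by the parameters already
  passed, so \<open>k_divides_over_independent\<close> treats the instances one after another;
  \<open>w\<close> contains the whole chain and serves at every step.\<close>

lemma chain_over_independent: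
  assumes "chain k n A x ps" "finite A" "A \<subseteq> U" "non_dividing d A w" "set d \<subseteq> U" "set w \<subseteq> U"
    "A \<union> (\<Union>p\<in>set ps. set (snd p)) \<subseteq> set w"
  shows "chain k n (A \<union> set d) x ps"
  using assms
proof (induction ps arbitrary: A)
  case (Cons p ps)
  let ?c = "snd p"
  have p: "dfn (n + length ?c) (fst p)" "fst p (x @ ?c)" "k_divides k n (fst p) ?c A" "chain k n (A \<union> set ?c) x ps"
    using Cons.prems by auto
  have cU: "set ?c \<subseteq> U" by (rule k_divides_in_U[OF p(3)])
  have "chain k n (A \<union> set ?c \<union> set d) x ps"
    by (rule Cons.IH[OF p(4)]) (use Cons.prems cU non_dividing_mono_base[OF Cons.prems(4)] in auto)
  moreover have "k_divides k n (fst p) ?c (A \<union> set d)"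
    by (rule k_divides_over_independent[OF p(3,1) Cons.prems(2,3,4)]) (use Cons.prems in auto)
  ultimately show ?case using p by (simp add: Un_ac)
qed simp

lemma concat_blocks_nth:
  assumes "\<And>i. length (c i) = m" "p < length ks" "t < m"
  shows "concat (map c ks) ! (p * m + t) = c (ks ! p) ! t"
proof -
  have lc: "length (concat (map c ks)) = length ks * m" using length_concat_blocks assms(1) by blast
  have "Suc p * m \<le> length ks * m" using assms(2) by (intro mult_le_mono1) auto
  then have "p * m + m \<le> length ks * m" by simp
  then have "p * m \<le> length (concat (map c ks))" using lc by linarith
  then have "concat (map c ks) ! (p * m + t) = take m (drop (p * m) (concat (map c ks))) ! t"
    using assms(3) by (simp only: nth_take nth_drop)
  also have "take m (drop (p * m) (concat (map c ks))) = c (ks ! p)"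
    by (rule take_drop_blocks) (use assms in auto)
  finally show ?thesis .
qed

text \<open>What is asked of \<open>d\<close> concerns \<open>I\<close> and \<open>a\<close> alone,
  so it can be verified through an automorphism. The parameters of the chain are hidden in the
  Morley sequence \<open>J\<close> of which \<open>I\<close> is a part.\<close>

lemma ex_sequence_of_chain:
  assumes simple: "simple_theory L M" and e: "set e \<subseteq> U" and a: "a \<in> tuples M n"
    and ch: "chain k n (set e) a ps"
  shows "\<exists>I. indisc n e I \<and> I 0 = a \<and>
    (\<forall>d. set d \<subseteq> U \<and> (\<forall>i. conjugate (set d) (I i) a) \<longrightarrow>
       (\<exists>qs. chain k n (set d) a qs \<and> map label qs = map label ps))"
proof -
  let ?A = "set e" and ?le = "length e"
  define j where "j = a @ concat (map snd ps)"
  define m where "m = length j"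
  have an: "length a = n" using a by (simp add: tuples_iff)
  have nm: "n \<le> m" by (simp add: m_def j_def an)
  have "set (snd p) \<subseteq> U" if p: "p \<in> set ps" for p
  proof -
    obtain ps1 ps2 where "ps = ps1 @ p # ps2" using split_list[OF p] by blast
    then show ?thesis using ch by (auto simp: chain_append dest!: k_divides_in_U)
  qed
  then have jt: "j \<in> tuples M m" using a by (auto simp: j_def m_def tuples_iff)
  obtain J where J: "indisc m e J" "J 0 = j"
    and morley: "\<And>k n Q. dfn (n + (?le + m)) Q \<Longrightarrow> k_divides k n Q (e @ j) ?A \<Longrightarrow>
      \<exists>N. \<forall>is. sorted_wrt (<) is \<and> length is = N \<longrightarrow> \<not> (\<exists>y\<in>tuples M n. \<forall>i\<in>set is. Q (y @ e @ J i))"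
    using ex_morley[OF simple e jt] by blast
  have Jt: "J i \<in> tuples M m" for i using J(1) by (auto simp: indisc_def)
  define I where "I i = take n (J i)" for i
  have It: "I i \<in> tuples M n" for i
    using Jt[of i] nm set_take_subset[of n "J i"] by (auto simp: I_def tuples_iff)
  have "indisc n e I"
    unfolding indisc_def
  proof (intro conjI allI impI)
    fix P and "is" js :: "nat list"
    assume *: "sorted_wrt (<) is \<and> sorted_wrt (<) js \<and> length is = length js \<and> dfn (?le + length is * n) P"
      "P (e @ concat (map I is))"
    define r where "r = length is"
    \<comment> \<open>Keeps \<open>e\<close> and the first \<open>n\<close> entries of each block of
      length \<open>m\<close>, thus reading \<open>I\<close> off from \<open>J\<close>.\<close>
    define ids where "ids = [0..<?le] @ concat (map (\<lambda>l. [?le + l * m..<?le + l * m + n]) [0..<r])"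
    have idl: "length ids = ?le + r * n"
      unfolding ids_def by (simp add: length_concat comp_def sum_list_triv)
    have ids: "set ids \<subseteq> {..<?le + r * m}"
    proof -
      have "?le + l * m + n \<le> ?le + r * m" if "l < r" for l
      proof -
        have "Suc l * m \<le> r * m" using that by (intro mult_le_mono1) auto
        then show ?thesis using nm by simp
      qed
      then show ?thesis unfolding ids_def by fastforce
    qed
    have sel: "map ((!) (e @ concat (map J ks))) ids = e @ concat (map I ks)" if ks: "length ks = r" for ks
    proof -
      have Jl: "length (J i) = m" for i using Jt by (simp add: tuples_iff)
      have "map ((!) (e @ concat (map J ks))) [?le + l * m..<?le + l * m + n] = I (ks ! l)" if l: "l < r" for l
      proof (rule nth_equalityI)
        fix t assume "t < length (map ((!) (e @ concat (map J ks))) [?le + l * m..<?le + l * m + n])"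
        then have t: "t < n" by simp
        have "concat (map J ks) ! (l * m + t) = J (ks ! l) ! t"
          by (rule concat_blocks_nth) (use Jl l ks t nm in auto)
        then have "concat (map J ks) ! (l * m + t) = I (ks ! l) ! t" using t by (simp add: I_def)
        then show "map ((!) (e @ concat (map J ks))) [?le + l * m..<?le + l * m + n] ! t = I (ks ! l) ! t"
          using t by (simp add: nth_append add.assoc)
      qed (use It[of "ks ! l"] in \<open>simp add: tuples_iff\<close>)
      then have "map (\<lambda>l. map ((!) (e @ concat (map J ks))) [?le + l * m..<?le + l * m + n]) [0..<r] = map (\<lambda>l. I (ks ! l)) [0..<r]"
        by (intro map_cong) auto
      also have "\<dots> = map I ks" using ks by (intro nth_equalityI) auto
      finally have 2: "map ((!) (e @ concat (map J ks))) (concat (map (\<lambda>l. [?le + l * m..<?le + l * m + n]) [0..<r])) = concat (map I ks)"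
        by (simp add: map_concat comp_def)
      have "map ((!) (e @ concat (map J ks))) [0..<?le] = e" by (intro nth_equalityI) (auto simp: nth_append)
      with 2 show ?thesis by (simp add: ids_def)
    qed
    have "dfn (?le + r * m) (\<lambda>u. P (map ((!) u) ids))"
      by (rule definable_reindex[OF _ ids]) (use *(1) idl r_def in metis)
    moreover have "P (map ((!) (e @ concat (map J is))) ids)" using sel[of "is"] * r_def by simp
    ultimately have "P (map ((!) (e @ concat (map J js))) ids)"
      using J(1)[unfolded indisc_def, THEN conjunct2, rule_format, of "is" js "\<lambda>u. P (map ((!) u) ids)"] *(1) r_def by simp
    then show "P (e @ concat (map I js))" using sel[of js] * r_def by simp
  qed (rule It)
  moreover have "I 0 = a" by (simp add: I_def J(2) j_def an)
  moreover have "\<exists>qs. chain k n (set d) a qs \<and> map label qs = map label ps"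
    if d: "set d \<subseteq> U" and Id: "\<And>i. conjugate (set d) (I i) a" for d
  proof -
    let ?ld = "length d"
    have edU: "set (e @ d) \<subseteq> U" using e d by simp
    \<comment> \<open>Besides indiscernibility over \<open>e\<close> and \<open>d\<close>, two
      features of \<open>J\<close> survive: its first coordinates have the type of \<open>a\<close>
      over \<open>d\<close>, and instances dividing at \<open>j\<close> are inconsistent along
      it.\<close>
    obtain J' where J': "indisc m (e @ d) J'" "EM_le m (e @ d) J J'"
      using extract_indisc[of J m "e @ d", OF Jt edU] by blast
    have J't: "J' i \<in> tuples M m" for i using J'(1) by (auto simp: indisc_def)
    have len: "length (J i) = m" "length (J' i) = m" for i using Jt J't by (auto simp: tuples_iff)
    have "conjugate ?A (J i) j" for i using conjugate_of_indisc[OF J(1) e, of i 0] J(2) by simp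
    then have "conjugate ?A (J' 0) j" using EM_le_conjugate[of m e d J J', OF J'(2) edU Jt J't] by blast
    then have jj': "conjugate ?A j (J' 0)" by (rule conjugate_sym[OF _ e]) (use J't[of 0] in \<open>auto simp: tuples_iff\<close>)
    then obtain g where g: "aut g" "\<forall>x\<in>?A. g x = x" "map g j = J' 0" by (auto simp: conjugate_def)
    define a' where "a' = map g a"
    define ps' where "ps' = map (\<lambda>p. (fst p, map g (snd p))) ps"
    have gA: "g ` ?A = ?A" using g(2) by force
    have ch': "chain k n ?A a' ps'" using chain_aut[OF g(1) a e ch] gA by (simp add: a'_def ps'_def)
    have lab: "map label ps' = map label ps" unfolding ps'_def by (rule label_map)
    have J'0: "J' 0 = a' @ concat (map snd ps')"
      unfolding g(3)[symmetric] by (simp add: j_def a'_def ps'_def map_concat comp_def)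
    have a't: "a' \<in> tuples M n" unfolding a'_def by (rule aut_tuples[OF g(1) a])
    have "conjugate (set d) a a'"
    proof (rule conjugate_of_equiv[OF d a a't])
      fix P assume P: "dfn (?ld + n) P" "P (d @ a)"
      let ?Q = "\<lambda>u. P (take ?ld (drop ?le u) @ take n (drop (?le + ?ld) u))"
      have Q: "dfn (length (e @ d) + 1 * m) ?Q"
      proof (rule definable_select[OF P(1), of "[?le..<?le + ?ld + n]"])
        fix u assume "u \<in> tuples M (length (e @ d) + 1 * m)"
        then show "take ?ld (drop ?le u) @ take n (drop (?le + ?ld) u) = map ((!) u) [?le..<?le + ?ld + n]"
          using nm by (intro nth_equalityI) (auto simp: tuples_iff nth_append)
      qed (use nm in auto)
      have "?Q ((e @ d) @ concat (map J' [0]))"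
      proof (rule EM_leD[OF J'(2) Q])
        fix js :: "nat list" assume "length js = 1"
        then obtain i where i: "js = [i]" by (metis One_nat_def length_0_conv length_Suc_conv)
        obtain f where f: "aut f" "\<forall>x\<in>set d. f x = x" "map f (I i) = a" using Id[of i] by (auto simp: conjugate_def)
        have "map f (d @ I i) = d @ a" using f by (auto simp: map_idI)
        moreover have "d @ I i \<in> tuples M (?ld + n)" using d It[of i] by (auto simp: tuples_iff)
        ultimately have "P (d @ I i)" using aut_definable[OF f(1) P(1)] P(2) by metis
        then show "?Q ((e @ d) @ concat (map J js))" by (simp add: i I_def)
      qed auto
      then show "P (d @ a')" using a't by (simp add: J'0 tuples_iff)
    qed
    then have a'a: "conjugate (set d) a' a" by (rule conjugate_sym[OF _ d]) (use a in \<open>auto simp: tuples_iff\<close>)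
    have nd: "non_dividing d ?A (e @ J' 0)"
      unfolding non_dividing_def
    proof (intro allI impI notI)
      fix k' Q assume Q: "dfn (?ld + length (e @ J' 0)) Q \<and> Q (d @ e @ J' 0)" and kd: "k_divides k' ?ld Q (e @ J' 0) ?A"
      have Qd: "dfn (?ld + (?le + m)) Q" using Q len by simp
      have "conjugate ?A (J' 0) j" by (rule conjugate_sym[OF jj' e]) (use jt in \<open>auto simp: tuples_iff\<close>)
      then have "conjugate ?A (e @ J' 0) (e @ j)"
        unfolding conjugate_def by (auto simp: map_idI)
      then have "k_divides k' ?ld Q (e @ j) ?A" using k_divides_conjugate[OF kd] by blast
      then obtain N where N: "\<And>is. sorted_wrt (<) is \<Longrightarrow> length is = N \<Longrightarrow> \<not> (\<exists>y\<in>tuples M ?ld. \<forall>i\<in>set is. Q (y @ e @ J i))"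
        using morley[OF Qd] by blast
      let ?Q = "\<lambda>u. Q (take (?ld + ?le) u @ drop (?ld + ?le + ?ld) u)"
      have "dfn (?ld + ?le + (?ld + m)) ?Q" by (rule definable_skip) (use Qd in \<open>simp add: add.assoc\<close>)
      then have Q': "dfn (?ld + (length (e @ d) + m)) ?Q" by (simp add: add_ac)
      have eqQ: "?Q (y @ (e @ d) @ v) \<longleftrightarrow> Q (y @ e @ v)" if "y \<in> tuples M ?ld" for y v
        using that by (simp add: tuples_iff)
      have no: "\<not> (\<exists>y\<in>tuples M ?ld. \<forall>i\<in>set [0..<N]. ?Q (y @ (e @ d) @ J' i))"
      proof (rule EM_le_no_common[OF J'(2) len Q'])
        fix js :: "nat list" assume "sorted_wrt (<) js" "length js = N"
        from N[OF this] show "\<not> (\<exists>y\<in>tuples M ?ld. \<forall>i\<in>set js. ?Q (y @ (e @ d) @ J i))" using eqQ by blast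
      qed auto
      have dt: "d \<in> tuples M ?ld" using d by (simp add: tuples_iff)
      \<comment> \<open>By indiscernibility over \<open>e\<close> and \<open>d\<close>, a condition
        linking \<open>d\<close> to \<open>J' 0\<close> links \<open>d\<close> to every
        \<open>J' i\<close>, so \<open>d\<close> itself would be the forbidden common
        solution.\<close>
      have "Q (d @ e @ J' i)" for i
      proof -
        obtain f where f: "aut f" "\<forall>x\<in>set (e @ d). f x = x" "map f (J' i) = J' 0"
          using conjugate_of_indisc[OF J'(1) edU, of i 0] by (auto simp: conjugate_def)
        have "map f (d @ e @ J' i) = d @ e @ J' 0" using f by (auto simp: map_idI)
        moreover have "d @ e @ J' i \<in> tuples M (?ld + (?le + m))" using d e J't[of i] by (auto simp: tuples_iff)
        ultimately show ?thesis using aut_definable[OF f(1) Qd] Q by metis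
      qed
      then show False using no dt eqQ[OF dt] by blast
    qed
    have "chain k n (?A \<union> set d) a' ps'"
      by (rule chain_over_independent[OF ch' finite_set e nd d]) (use e J't[of 0] J'0 in \<open>auto simp: tuples_iff\<close>)
    \<comment> \<open>Here \<open>e\<close> leaves the base; later \<open>d\<close> will be the
      image of another base, which has to be compared with \<open>e\<close> through chain lengths
      only.\<close>
    then have "chain k n (set d) a' ps'" by (rule chain_mono) simp
    from chain_conjugate[OF this a'a d a't] show ?thesis using lab by simp
  qed
  ultimately show ?thesis by blast
qed

section \<open>Sequences of equal type and the comparison of chain lengths\<close>

lemma aut_of_seq_equiv:
  assumes It: "\<And>i. I i \<in> tuples M n" and Jt: "\<And>i. J i \<in> tuples M n" and eq: "seq_equiv L M I J"
  shows "\<exists>g. aut g \<and> (\<forall>i. map g (I i) = J i)"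
proof -
  have len: "length (I i) = n" "length (J i) = n" for i using It Jt by (auto simp: tuples_iff)
  have nth: "I i ! t \<in> U" "J i ! t \<in> U" if "t < n" for i t
    using It[of i] Jt[of i] that by (metis nth_mem subsetD tuples_iff)+
  have "\<exists>g. aut g \<and> (\<forall>q\<in>UNIV \<times> {..<n}. g (I (fst q) ! snd q) = J (fst q) ! snd q)"
  proof (rule aut_of_equiv)
    show "countable (UNIV \<times> {..<n} :: (nat \<times> nat) set)" by simp
    show "(\<lambda>q. I (fst q) ! snd q) ` (UNIV \<times> {..<n}) \<subseteq> U" "(\<lambda>q. J (fst q) ! snd q) ` (UNIV \<times> {..<n}) \<subseteq> U"
      using nth by auto
    fix js :: "(nat \<times> nat) list" and P assume js: "set js \<subseteq> UNIV \<times> {..<n}" and P: "dfn (length js) P"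
    \<comment> \<open>Blocks are listed in the order and with the repetitions of \<open>js\<close>;
      from the block at place \<open>p\<close> only the coordinate named by \<open>js ! p\<close> is
      kept. This uses that \<open>seq_equiv\<close> admits arbitrary index lists.\<close>
    define ids where "ids = map (\<lambda>p. p * n + snd (js ! p)) [0..<length js]"
    have snd_lt: "snd (js ! p) < n" if "p < length js" for p using js nth_mem[OF that] by auto
    have sel: "map ((!) (concat (map c (map fst js)))) ids = map (\<lambda>q. c (fst q) ! snd q) js"
      if "\<And>i. length (c i) = n" for c :: "nat \<Rightarrow> 'a list"
    proof (rule nth_equalityI)
      fix p assume "p < length (map ((!) (concat (map c (map fst js)))) ids)"
      then have p: "p < length js" by (simp add: ids_def)
      then show "map ((!) (concat (map c (map fst js)))) ids ! p = map (\<lambda>q. c (fst q) ! snd q) js ! p"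
        using concat_blocks_nth[of c n p "map fst js" "snd (js ! p)"] that snd_lt[OF p]
        by (simp add: ids_def del: map_map)
    qed (simp add: ids_def)
    have ids: "set ids \<subseteq> {..<length js * n}"
    proof -
      have "p * n + snd (js ! p) < length js * n" if p: "p < length js" for p
      proof -
        have "Suc p * n \<le> length js * n" using p by (intro mult_le_mono1) auto
        then show ?thesis using snd_lt[OF p] by simp
      qed
      then show ?thesis by (auto simp: ids_def)
    qed
    have d: "dfn (length js * n) (\<lambda>u. P (map ((!) u) ids))"
      by (rule definable_reindex[OF _ ids]) (use P in \<open>simp add: ids_def\<close>)
    have "P (map ((!) (concat (map I (map fst js)))) ids) \<longleftrightarrow> P (map ((!) (concat (map J (map fst js)))) ids)"
    proof (rule tp_empty_eq_definable[OF _ _ _ d])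
      show "tp L M (concat (map I (map fst js))) {} = tp L M (concat (map J (map fst js))) {}"
        using eq unfolding seq_equiv_def by blast
      show "concat (map I (map fst js)) \<in> tuples M (length js * n)" "concat (map J (map fst js)) \<in> tuples M (length js * n)"
        using blocks_tuples[where c = I and e = "[]" and ks = "map fst js", OF It]
          blocks_tuples[where c = J and e = "[]" and ks = "map fst js", OF Jt] by simp_all
    qed
    then show "P (map (\<lambda>q. I (fst q) ! snd q) js) \<longleftrightarrow> P (map (\<lambda>q. J (fst q) ! snd q) js)"
      using sel[of I] sel[of J] len by simp
  qed
  then obtain g where g: "aut g" "\<And>i t. t < n \<Longrightarrow> g (I i ! t) = J i ! t" by auto
  have "map g (I i) = J i" for i by (rule nth_equalityI) (auto simp: len g(2))
  then show ?thesis using g(1) by blast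
qed

lemma indiscernible_of_indisc:
  assumes "indisc n e I" "set e \<subseteq> U" shows "indiscernible L M {} I"
  unfolding indiscernible_def
proof (intro conjI allI impI)
  have It: "\<And>i. I i \<in> tuples M n" using assms by (auto simp: indisc_def)
  then show "I j \<in> tuples M (length (I 0))" for j by (simp add: tuples_iff)
  fix "is" js :: "nat list" assume *: "sorted_wrt (<) is \<and> sorted_wrt (<) js \<and> length is = length js"
  have len: "length (concat (map I ks)) = length ks * n" for ks
    using length_concat_blocks[of I n ks] It by (simp add: tuples_iff)
  have imp: "holds M \<phi> (concat (map I ks)) \<longrightarrow> holds M \<phi> (concat (map I ls))"
    if "formula_in L (length is * n) \<phi>" "sorted_wrt (<) ks" "sorted_wrt (<) ls" "length ks = length is" "length ls = length is" for \<phi> ks ls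
  proof -
    have "dfn (0 + (length e + length is * n)) (\<lambda>u. holds M \<phi> (take 0 u @ drop (0 + length e) u))"
      by (rule definable_skip) (use definable_holds[OF that(1)] in simp)
    then have "dfn (length e + length ks * n) (\<lambda>u. holds M \<phi> (drop (length e) u))" using that by simp
    then show ?thesis
      using assms(1)[unfolded indisc_def, THEN conjunct2, rule_format, of ks ls "\<lambda>u. holds M \<phi> (drop (length e) u)"] that
      by simp
  qed
  show "tp L M (concat (map I is)) {} = tp L M (concat (map I js)) {}"
    by (rule tp_empty_eqI) (use len * imp in \<open>metis+\<close>)
qed

lemma conjugate_aut:
  assumes "conjugate A u v" "aut g" "A \<subseteq> U" "set u \<subseteq> U" shows "conjugate (g ` A) (map g u) (map g v)"
proof -
  obtain f where f: "aut f" "\<forall>x\<in>A. f x = x" "map f u = v" using assms by (auto simp: conjugate_def)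
  obtain h where h: "aut h" "\<And>x. x \<in> U \<Longrightarrow> h (g x) = x" using aut_inverse[OF assms(2)] by metis
  have "aut (\<lambda>x. g (f (h x)))" using aut_comp[OF assms(2) aut_comp[OF f(1) h(1)]] .
  moreover have "\<forall>x\<in>g ` A. g (f (h x)) = x" using f(2) h(2) assms(3) by auto
  moreover have "map (\<lambda>x. g (f (h x))) (map g u) = map g v"
    using f(3) h(2) assms(4) by (auto simp: subset_iff)
  ultimately show ?thesis unfolding conjugate_def by blast
qed

lemma ex_inequivalent_sequences:
  assumes simple: "simple_theory L M" and a: "a \<in> tuples M n"
    and A: "\<And>i. finite (A i)" "\<And>i. A i \<subseteq> U" "\<And>i. A i \<subseteq> A (Suc i)"
    and fork: "\<And>i. \<exists>D. finite D \<and> (\<forall>(P, d)\<in>D. dfn (n + length d) P \<and> (\<exists>k. k_divides k n P d (A i))) \<and>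
        (\<forall>a'. conjugate (A (Suc i)) a a' \<longrightarrow> (\<exists>(P, d)\<in>D. P (a' @ d)))"
  shows "\<exists>I :: nat \<Rightarrow> nat \<Rightarrow> 'a list. (\<forall>i. indiscernible L M {} (I i) \<and> I i 0 = a) \<and> (\<forall>i j. i \<noteq> j \<longrightarrow> \<not> seq_equiv L M (I i) (I j))"
proof -
  have "\<exists>k \<Delta> ps. chain k n (A i) a ps \<and> set (map label ps) \<subseteq> \<Delta> \<and>
     \<not> (\<exists>qs. chain k n (A (Suc i)) a qs \<and> length qs = length ps \<and> set (map label qs) \<subseteq> \<Delta>)" for i
  proof -
    from fork[of i] obtain D where D': "finite D" "\<forall>(P, d)\<in>D. dfn (n + length d) P \<and> (\<exists>k. k_divides k n P d (A i))"
      "\<forall>a'. conjugate (A (Suc i)) a a' \<longrightarrow> (\<exists>(P, d)\<in>D. P (a' @ d))"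
      by (elim exE conjE)
    have D: "finite D" "\<And>P d. (P, d) \<in> D \<Longrightarrow> dfn (n + length d) P \<and> (\<exists>k. k_divides k n P d (A i))"
      "\<And>a'. conjugate (A (Suc i)) a a' \<Longrightarrow> \<exists>(P, d)\<in>D. P (a' @ d)"
      using D' by blast+
    obtain k where k: "\<forall>(P, d)\<in>D. k_divides k n P d (A i)" using k_divides_uniform[OF D(1), of n "A i"] D(2) by blast
    let ?\<Delta> = "label ` D"
    define R where "R r \<longleftrightarrow> (\<exists>qs. chain k n (A (Suc i)) a qs \<and> length qs = r \<and> set (map label qs) \<subseteq> ?\<Delta>)" for r
    have "\<exists>N. \<forall>A x ps. A \<subseteq> U \<and> x \<in> tuples M n \<and> chain k n A x ps \<and> set (map label ps) \<subseteq> ?\<Delta> \<longrightarrow> length ps < N"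
      by (rule chain_bound[OF simple]) (use D in \<open>auto simp: label_def\<close>)
    then obtain N where N0: "\<forall>A x ps. A \<subseteq> U \<and> x \<in> tuples M n \<and> chain k n A x ps \<and>
        set (map label ps) \<subseteq> ?\<Delta> \<longrightarrow> length ps < N"
      by (elim exE)
    have N: "r < N" if "R r" for r using N0 that A(2)[of "Suc i"] a unfolding R_def by blast
    have R0: "R 0" unfolding R_def by (rule exI[of _ "[]"]) simp
    \<comment> \<open>The invariant that separates the bases: length \<open>Suc r\<close> is not
      attained over \<open>A (Suc i)\<close>, while \<open>chain_step\<close> attains it over
      \<open>A i\<close> by prolonging a chain of length \<open>r\<close>.\<close>
    obtain r where r: "R r" "\<not> R (Suc r)"
    proof (rule ccontr)
      assume "\<not> thesis"
      then have step: "R r \<Longrightarrow> R (Suc r)" for r using that by blast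
      have "R r" for r by (induction r) (use R0 step in auto)
      then show False using N less_irrefl by blast
    qed
    then obtain qs where qs: "chain k n (A (Suc i)) a qs" "length qs = r" "set (map label qs) \<subseteq> ?\<Delta>"
      unfolding R_def by blast
    have "\<exists>ps. chain k n (A i) a ps \<and> length ps = Suc (length qs) \<and> set (map label ps) \<subseteq> ?\<Delta>"
      by (rule chain_step[OF A(1,3,2) a D(1) _ D(3) qs(1,3)]) (use D(2) k in auto)
    then obtain ps where "chain k n (A i) a ps" "length ps = Suc r" "set (map label ps) \<subseteq> ?\<Delta>" using qs(2) by blast
    then show ?thesis using r(2) unfolding R_def by metis
  qed
  then obtain k \<Delta> ps where ps: "\<And>i. chain (k i) n (A i) a (ps i)" "\<And>i. set (map label (ps i)) \<subseteq> \<Delta> i"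
    "\<And>i. \<not> (\<exists>qs. chain (k i) n (A (Suc i)) a qs \<and> length qs = length (ps i) \<and> set (map label qs) \<subseteq> \<Delta> i)"
    by metis
  have "\<forall>i. \<exists>l. set l = A i" using finite_list[OF A(1)] by blast
  then obtain e where e: "\<And>i. set (e i) = A i" by metis
  have "\<exists>I. indisc n (e i) I \<and> I 0 = a \<and>
    (\<forall>d. set d \<subseteq> U \<and> (\<forall>l. conjugate (set d) (I l) a) \<longrightarrow>
       (\<exists>qs. chain (k i) n (set d) a qs \<and> map label qs = map label (ps i)))" for i
    by (rule ex_sequence_of_chain[OF simple _ a]) (use ps(1) e A(2) in auto)
  then obtain I where I: "\<And>i. indisc n (e i) (I i)" "\<And>i. I i 0 = a"
    "\<And>i d. set d \<subseteq> U \<Longrightarrow> (\<And>l. conjugate (set d) (I i l) a) \<Longrightarrow>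
       \<exists>qs. chain (k i) n (set d) a qs \<and> map label qs = map label (ps i)"
    by metis
  have It: "I i l \<in> tuples M n" for i l using I(1) by (auto simp: indisc_def)
  have ineq: "\<not> seq_equiv L M (I i') (I i)" if "i < i'" for i i'
  proof
    assume "seq_equiv L M (I i') (I i)"
    then obtain g where g: "aut g" "\<And>l. map g (I i' l) = I i l" using aut_of_seq_equiv[of "I i'" n "I i", OF It It] by blast
    obtain h where h: "aut h" "\<And>x. x \<in> U \<Longrightarrow> h (g x) = x" using aut_inverse[OF g(1)] by metis
    \<comment> \<open>All members of \<open>I i'\<close> are conjugate over \<open>e i'\<close>;
      hence those of \<open>I i\<close> are conjugate over \<open>?d\<close>, although
      \<open>I i\<close> was built over \<open>A i\<close>.\<close>
    let ?d = "map g (e i')"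
    have eU: "set (e i') \<subseteq> U" using e A(2) by simp
    have dU: "set ?d \<subseteq> U" using eU aut_in[OF g(1)] by auto
    \<comment> \<open>The common first entry makes \<open>g\<close> fix \<open>a\<close>, so the
      chain found over \<open>?d\<close> pulls back to a chain for the same \<open>a\<close> over
      \<open>A i'\<close>, hence over \<open>A (Suc i)\<close>.\<close>
    have ga: "map g a = a" using g(2)[of 0] I(2) by simp
    have "conjugate (set ?d) (I i l) a" for l
    proof -
      have "conjugate (set (e i')) (I i' l) (I i' 0)" by (rule conjugate_of_indisc[OF I(1) eU])
      from conjugate_aut[OF this g(1) eU] It[of i' l] show ?thesis by (simp add: g(2) I(2) ga tuples_iff)
    qed
    then obtain qs where qs: "chain (k i) n (set ?d) a qs" "map label qs = map label (ps i)" using I(3)[OF dU] by blast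
    let ?qs = "map (\<lambda>p. (fst p, map h (snd p))) qs"
    have "h ` set ?d = A i'" using h(2) eU e by (force simp: image_image)
    moreover have "map h (map g a) = a" using h(2) a by (auto simp: tuples_iff subset_iff intro!: map_idI)
    then have "map h a = a" unfolding ga .
    ultimately have "chain (k i) n (A i') a ?qs" using chain_aut[OF h(1) a dU qs(1)] by simp
    moreover have "A (Suc i) \<subseteq> A i'" using lift_Suc_mono_le[of A, OF A(3)] that by simp
    ultimately have ch: "chain (k i) n (A (Suc i)) a ?qs" by (rule chain_mono)
    have lab: "map label ?qs = map label (ps i)" unfolding label_map by (rule qs(2))
    have "length ?qs = length (ps i)" using arg_cong[OF lab, of length] by simp
    moreover have "set (map label ?qs) \<subseteq> \<Delta> i" unfolding lab by (rule ps(2))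
    ultimately show False using ps(3)[of i] ch by blast
  qed
  have "\<not> seq_equiv L M (I i) (I j)" if "i \<noteq> j" for i j
  proof (cases "i < j")
    case True
    then show ?thesis using ineq[of i j] by (auto simp: seq_equiv_def)
  next
    case False
    then show ?thesis using ineq[of j i] that by auto
  qed
  moreover have "indiscernible L M {} (I i)" for i using indiscernible_of_indisc[OF I(1)] e A(2) by simp
  ultimately show ?thesis using I(2) by (intro exI[of _ I]) simp
qed

end

section \<open>From the monster model to an increasing sequence of finite bases\<close>

lemma big_model_of_monster:
  fixes M :: "('a, 'f, 'r) struct"
  assumes "monster_model L T \<kappa> M" shows "big_model L M"
proof
  have \<kappa>: "natLeq <o \<kappa>" and sat: "saturated L \<kappa> M" and hom: "strongly_homogeneous L \<kappa> M"
    using assms by (auto simp: monster_model_def)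
  have small: "|A| <o \<kappa>" if cA: "countable A" for A :: "'a set"
  proof -
    obtain f :: "'a \<Rightarrow> nat" where "inj_on f A" using countableE[OF cA] by blast
    then have "|A| \<le>o |UNIV :: nat set|" by (auto intro: card_of_ordLeqI)
    then have "|A| \<le>o natLeq" using card_of_nat ordLeq_ordIso_trans by blast
    then show ?thesis using \<kappa> ordLeq_ordLess_trans by blast
  qed
  show "structure_of L M" using assms by (auto simp: monster_model_def is_model_def)
  show "\<exists>a\<in>tuples M n. realizes M a p"
    if "A \<subseteq> univ M" "countable A" "p \<subseteq> formulas_over L n A" "consistent M n p" for A p n
    using sat that small[OF that(2)] unfolding saturated_def by blast
  show "\<exists>g. isomorphism L M M g \<and> (\<forall>x\<in>A. g x = f x)"
    if "countable A" "elementary_map L M A f" for A f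
    using hom that small[OF that(1)] unfolding strongly_homogeneous_def by blast
qed

text \<open>Since \<open>A\<close> may be uncountable, compactness is applied here with the saturation of \<open>M\<close> itself.\<close>

lemma forks_finite_part:
  assumes mon: "monster_model L T \<kappa> M" and a: "set a \<subseteq> univ M" and A: "A \<subseteq> univ M" "|A| <o \<kappa>"
    and B: "finite B" "B \<subseteq> A" and forks: "forks L M B (length a) (tp L M a A)"
  shows "\<exists>C D. finite C \<and> B \<subseteq> C \<and> C \<subseteq> A \<and> finite D \<and>
    (\<forall>(P, d)\<in>D. definable L M (length a + length d) P \<and> (\<exists>k. big_model.k_divides L M k (length a) P d B)) \<and>
    (\<forall>a'. big_model.conjugate L M C a a' \<longrightarrow> (\<exists>(P, d)\<in>D. P (a' @ d)))"
proof -
  interpret big_model L M by (rule big_model_of_monster[OF mon])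
  let ?n = "length a" and ?p = "tp L M a A"
  obtain E where E: "finite E" "E \<subseteq> formulas_over L ?n U" "\<forall>(\<psi>, c)\<in>E. divides L M B ?n \<psi> c"
    "\<forall>x\<in>tuples M ?n. realizes M x ?p \<longrightarrow> (\<exists>(\<psi>, c)\<in>E. holds M \<psi> (x @ c))"
    using forks unfolding forks_def by (elim exE conjE)
  define par where "par = (\<Union>q\<in>E. set (snd q))"
  define neg where "neg = (\<lambda>q. (Neg (fst q), snd q)) ` E"
  have par: "finite par" "par \<subseteq> U" using E(1,2) by (auto simp: par_def formulas_over_def)
  have \<kappa>: "Card_order \<kappa>" "natLeq <o \<kappa>" "saturated L \<kappa> M" using mon by (auto simp: monster_model_def)
  have inf: "infinite (Field \<kappa>)"
    using \<kappa> by (meson Card_order_iff_ordLeq_card_of ctwo_def infinite_iff_natLeq_ordLeq ordLess_imp_ordLeq ordLeq_transitive)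
  have "|par| \<le>o natLeq" using par(1)
    by (meson finite_iff_ordLess_natLeq ordLess_imp_ordLeq)
  then have "|par| <o \<kappa>" using \<kappa>(2) ordLeq_ordLess_trans by blast
  then have small: "|A \<union> par| <o \<kappa>"
    using card_of_Un_ordLess_infinite_Field[OF inf \<kappa>(1) A(2)] by blast
  have nreal: "\<not> realizes M x (?p \<union> neg)" if x: "x \<in> tuples M ?n" for x
  proof
    assume r: "realizes M x (?p \<union> neg)"
    then have "realizes M x ?p" by (auto simp: realizes_def)
    then obtain \<psi> c where c: "(\<psi>, c) \<in> E" "holds M \<psi> (x @ c)" using E(4) x by blast
    have "(Neg \<psi>, c) \<in> neg" using c(1) by (force simp: neg_def)
    then have "holds M (Neg \<psi>) (x @ c)" using r by (auto simp: realizes_def)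
    then show False using c(2) by (simp add: holds_def)
  qed
  have "?p \<union> neg \<subseteq> formulas_over L ?n (A \<union> par)"
  proof -
    have "?p \<subseteq> formulas_over L ?n A" by (auto simp: tp_def)
    then have "?p \<subseteq> formulas_over L ?n (A \<union> par)" by (fastforce simp: formulas_over_def)
    moreover have "(Neg \<psi>, c) \<in> formulas_over L ?n (A \<union> par)" if q: "(\<psi>, c) \<in> E" for \<psi> c
    proof -
      have "set c \<subseteq> par" using q by (force simp: par_def)
      moreover have "formula_in L (?n + length c) (Neg \<psi>)"
        using q E(2) by (fastforce simp: formulas_over_def formula_in_def)
      ultimately show ?thesis by (auto simp: formulas_over_def)
    qed
    ultimately show ?thesis by (auto simp: neg_def)
  qed
  then have "\<not> consistent M ?n (?p \<union> neg)"
    using \<kappa>(3) small A(1) par(2) nreal unfolding saturated_def by (meson Un_least)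
  then obtain q where q: "finite q" "q \<subseteq> ?p \<union> neg" "\<not> (\<exists>x\<in>tuples M ?n. realizes M x q)"
    unfolding consistent_def by blast
  \<comment> \<open>The finite set \<open>q\<close> is not realized; it consists of formulas from
    the type of \<open>a\<close> and negated dividing instances. With the parameters of the former
    in \<open>C\<close>, every conjugate of \<open>a\<close> over \<open>C\<close> keeps these
    formulas and must satisfy one of the dividing instances.\<close>
  define C where "C = B \<union> (\<Union>z\<in>q \<inter> ?p. set (snd z))"
  have C: "finite C" "B \<subseteq> C" "C \<subseteq> A"
    using B q(1) by (auto simp: C_def tp_def formulas_over_def)
  define D where "D = (\<lambda>z. (holds M (fst z), snd z)) ` E"
  have "finite D" using E(1) by (simp add: D_def)
  moreover have "dfn (?n + length d) P \<and> (\<exists>k. k_divides k ?n P d B)" if PD: "(P, d) \<in> D" for P d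
  proof -
    obtain \<psi> where \<psi>: "P = holds M \<psi>" "(\<psi>, d) \<in> E" using PD by (force simp: D_def)
    have f: "formula_in L (?n + length d) \<psi>" "d \<in> lists U" using \<psi>(2) E(2) by (auto simp: formulas_over_def)
    obtain k c where c: "\<And>i. c i \<in> tuples M (length d) \<and> tp L M (c i) B = tp L M d B" "k_inconsistent M k ?n \<psi> c"
      using E(3) \<psi>(2) unfolding divides_def by blast
    have "conjugate B (c i) d" for i
      by (rule conjugate_of_tp[OF B(1)]) (use c(1)[of i] f(2) B(2) A(1) in \<open>auto simp: tuples_iff\<close>)
    then have "k_divides k ?n P d B"
      unfolding k_divides_def \<psi>(1) using c by (intro exI[of _ c]) (auto simp: k_inconsistent_iff_k_contradictory)
    then show ?thesis using definable_holds[OF f(1)] \<psi>(1) by blast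
  qed
  moreover have "\<exists>(P, d)\<in>D. P (a' @ d)" if a': "conjugate C a a'" for a'
  proof -
    have CU: "C \<subseteq> U" using C(3) A(1) by simp
    have a't: "a' \<in> tuples M ?n" by (rule conjugate_tuples[OF a']) (use a in \<open>simp add: tuples_iff\<close>)
    then obtain \<psi> c where \<psi>: "(\<psi>, c) \<in> q" "\<not> holds M \<psi> (a' @ c)" using q(3) unfolding realizes_def by blast
    have "(\<psi>, c) \<notin> ?p"
    proof
      assume p: "(\<psi>, c) \<in> ?p"
      have "set c \<subseteq> C" using p \<psi>(1) by (force simp: C_def)
      then have "(\<psi>, c) \<in> tp L M a C" using p by (auto simp: tp_def formulas_over_def)
      then have "(\<psi>, c) \<in> tp L M a' C" using tp_of_conjugate[OF a' CU a] by simp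
      then show False using \<psi>(2) by (simp add: tp_def)
    qed
    then obtain \<psi>' where "\<psi> = Neg \<psi>'" "(\<psi>', c) \<in> E" using \<psi>(1) q(2) by (force simp: neg_def)
    then have "(holds M \<psi>', c) \<in> D" "holds M \<psi>' (a' @ c)" using \<psi>(2) by (force simp: D_def, simp add: holds_def)
    then show ?thesis by blast
  qed
  ultimately show ?thesis using C by (intro exI[of _ C] exI[of _ D]) blast
qed

theorem theorem6p3:
  fixes L :: "('f, 'r) lang" and T :: "('f, 'r) fm set"
    and \<kappa> :: "'k rel" and M :: "('a, 'f, 'r) struct"
  assumes "countable_lang L"
    and "complete_theory L T"
    and "monster_model L T \<kappa> M"
    and "omega_categorical L T"
    and "simple_theory L M"
    and "\<not> supersimple_theory L \<kappa> M"
  shows "\<exists>b\<in>lists (univ M). \<exists>I :: nat \<Rightarrow> nat \<Rightarrow> 'a list.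
           (\<forall>i. indiscernible L M {} (I i) \<and> I i 0 = b) \<and>
           (\<forall>i j. i \<noteq> j \<longrightarrow> \<not> seq_equiv L M (I i) (I j))"
proof -
  interpret big_model L M by (rule big_model_of_monster[OF assms(3)])
  have "\<exists>a A. a \<in> lists U \<and> A \<subseteq> U \<and> |A| <o \<kappa> \<and>
      (\<forall>B. finite B \<and> B \<subseteq> A \<longrightarrow> forks L M B (length a) (tp L M a A))"
  proof (rule ccontr)
    assume neg: "\<not> ?thesis"
    have "supersimple_theory L \<kappa> M"
      unfolding supersimple_theory_def
    proof (intro conjI allI impI)
      fix a A assume "a \<in> lists U \<and> A \<subseteq> U \<and> |A| <o \<kappa>"
      then show "\<exists>A\<^sub>0. finite A\<^sub>0 \<and> A\<^sub>0 \<subseteq> A \<and> \<not> forks L M A\<^sub>0 (length a) (tp L M a A)"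
        using neg by meson
    qed (rule assms(5))
    with assms(6) show False ..
  qed
  then obtain a A where aA: "a \<in> lists U" "A \<subseteq> U" "|A| <o \<kappa>"
    and forks': "\<forall>B. finite B \<and> B \<subseteq> A \<longrightarrow> forks L M B (length a) (tp L M a A)"
    by (elim exE conjE)
  have forks: "forks L M B (length a) (tp L M a A)" if "finite B" "B \<subseteq> A" for B
    using forks' that by simp
  have aU: "set a \<subseteq> U" using aA(1) by auto
  \<comment> \<open>Forking of the type of \<open>a\<close> over \<open>C\<close> over the base
    \<open>B\<close>, in the form that \<open>ex_inequivalent_sequences\<close> consumes.\<close>
  define good where "good B C \<longleftrightarrow> finite C \<and> B \<subseteq> C \<and> C \<subseteq> A \<and> (\<exists>D. finite D \<and>
    (\<forall>(P, d)\<in>D. dfn (length a + length d) P \<and> (\<exists>k. k_divides k (length a) P d B)) \<and>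
    (\<forall>a'. conjugate C a a' \<longrightarrow> (\<exists>(P, d)\<in>D. P (a' @ d))))" for B C
  have ex: "\<exists>C. good B C" if "finite B" "B \<subseteq> A" for B
  proof -
    from forks_finite_part[OF assms(3) aU aA(2,3) that forks[OF that]]
    obtain C D where "finite C" "B \<subseteq> C" "C \<subseteq> A" "finite D"
      "\<forall>(P, d)\<in>D. dfn (length a + length d) P \<and> (\<exists>k. k_divides k (length a) P d B)"
      "\<forall>a'. conjugate C a a' \<longrightarrow> (\<exists>(P, d)\<in>D. P (a' @ d))"
      by (elim exE conjE)
    then show ?thesis unfolding good_def by (intro exI[of _ C] exI[of _ D] conjI)
  qed
  \<comment> \<open>The construction never stops, because the type over the whole of
    \<open>A\<close> forks over each finite subset reached.\<close>
  define B where "B = rec_nat {} (\<lambda>_ C. SOME C'. good C C')"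
  have B_simps: "B 0 = {}" "B (Suc i) = (SOME C. good (B i) C)" for i by (simp_all add: B_def)
  have B: "finite (B i) \<and> B i \<subseteq> A" for i
  proof (induction i)
    case (Suc i)
    then have "good (B i) (B (Suc i))" unfolding B_simps(2) by (rule_tac someI_ex[of "good (B i)"], rule_tac ex) auto
    then show ?case by (auto simp: good_def)
  qed (simp add: B_simps)
  have good: "good (B i) (B (Suc i))" for i
    unfolding B_simps(2) by (rule someI_ex[of "good (B i)"], rule ex) (use B in auto)
  have "\<exists>I :: nat \<Rightarrow> nat \<Rightarrow> 'a list. (\<forall>i. indiscernible L M {} (I i) \<and> I i 0 = a) \<and> (\<forall>i j. i \<noteq> j \<longrightarrow> \<not> seq_equiv L M (I i) (I j))"
  proof (rule ex_inequivalent_sequences[OF assms(5)])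
    show "a \<in> tuples M (length a)" using aU by (simp add: tuples_iff)
    show "finite (B i)" "B i \<subseteq> U" for i using B aA(2) by blast+
    show "B i \<subseteq> B (Suc i)" for i using good[of i] by (simp add: good_def)
    show "\<exists>D. finite D \<and> (\<forall>(P, d)\<in>D. dfn (length a + length d) P \<and> (\<exists>k. k_divides k (length a) P d (B i))) \<and>
        (\<forall>a'. conjugate (B (Suc i)) a a' \<longrightarrow> (\<exists>(P, d)\<in>D. P (a' @ d)))" for i
      using good[of i] by (simp add: good_def)
  qed
  then show ?thesis by (rule bexI[OF _ aA(1)])
qed

end
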